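(* Let $d=3$, $\kappa\in\mathbb R^4$ with all $\kappa_i>-1$, and $\nu,\mu\in\mathbb N_0^3$ with $|\nu|=|\mu|=n$. Then $$\widehat c_{\nu,\mu}^{\,(123)}(\kappa)=(-1)^{n+\nu_3}\sqrt{w_{\mathsf R}(x;\beta,n)}\;\widehat{\mathsf R}_{(\mu_3,\mu_2)}(x;\beta,n),$$ where $\beta=(\beta_0,\beta_1,\beta_2,\beta_3)=(\kappa_1,\ \kappa_1+\kappa_4+1,\ \kappa_1+\kappa_3+\kappa_4+2,\ |\kappa|+3)$ and $x=(\nu_3,\nu_2+\nu_3)$. Moreover, $$\widehat c_{\nu,\mu}^{\,(132)}(\kappa)=\widehat c_{\mu,\nu}^{\,(123)}((132)\kappa)=(-1)^{n+\mu_3}\sqrt{w_{\mathsf R}(y;\beta^*,n)}\;\widehat{\mathsf R}_{(\nu_3,\nu_2)}(y;\beta^*,n),$$ where $\beta^*=(\kappa_3,\ \kappa_3+\kappa_4+1,\ \kappa_2+\kappa_3+\kappa_4+2,\ |\kappa|+3)$ and $y=(\mu_3,\mu_2+\mu_3)$. Here $\widehat{\mathsf R}$ denotes the orthonormal Racah polynomials of two variables.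
   Context: **Vectors.** $|y|$ is the sum of the entries of $y$; $\mathbf y_j=(y_1,\dots,y_j)$; $\mathbf y^j$ is the tail from the $j$-th to the last entry ($\boldsymbol\kappa^j=(\kappa_j,\dots,\kappa_{d+1})$, $\boldsymbol\nu^j=(\nu_j,\dots,\nu_d)$); empty parts have sum $0$. $(a)_k=a(a+1)\cdots(a+k-1)$. $(123)$ is the cycle $1\mapsto2\mapsto3\mapsto1$ and $(132)$ its inverse. **Jacobi polynomials on the simplex** ($d=3$ here). $T^d=\{x\in\mathbb R^d:x_i\ge0,|x|\le1\}$, $W_\kappa(x)=x_1^{\kappa_1}\cdots x_d^{\kappa_d}(1-|x|)^{\kappa_{d+1}}$, $\langle f,g\rangle_{W_\kappa}=\frac{\Gamma(|\kappa|+d+1)}{\prod_{i=1}^{d+1}\Gamma(\kappa_i+1)}\int_{T^d}fgW_\kappa\,dx$. With $a_j=|\boldsymbol\kappa^{j+1}|+2|\boldsymbol\nu^{j+1}|+d-j$, $$P_\nu^\kappa(x)=\prod_{j=1}^d(1-|\mathbf x_{j-1}|)^{\nu_j}P_{\nu_j}^{(a_j,\kappa_j)}\Big(\frac{2x_j}{1-|\mathbf x_{j-1}|}-1\Big)$$ (classical Jacobi polynomials, $P_n^{(\alpha,\beta)}(1)=(\alpha+1)_n/n!$). For each $n$ these, $|\nu|=n$, form an orthogonal basis of the space of degree-$n$ orthogonal polynomials; $A_\nu(\kappa)=\langle P_\nu^\kappa,P_\nu^\kappa\rangle_{W_\kappa}$. **Connection coefficients.** For $\tau\in S_{d+1}$: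 $\tau y=(y_{\tau(1)},\dots,y_{\tau(d+1)})$ for $y\in\mathbb R^{d+1}$, and $\tau x=(x_{\tau(1)},\dots,x_{\tau(d)})$ with $x_{d+1}:=1-|x|$ for $x\in T^d$. $c^\tau_{\nu,\mu}(\kappa)$ is defined by $P_\nu^{\tau\kappa}(\tau x)=\sum_{|\mu|=|\nu|}c^\tau_{\nu,\mu}(\kappa)P_\mu^\kappa(x)$, and $\widehat c^{\,\tau}_{\nu,\mu}(\kappa)=\sqrt{A_\mu(\kappa)/A_\nu(\tau\kappa)}\,c^\tau_{\nu,\mu}(\kappa)$. **Racah polynomials of $p$ variables** (here $p=2$). Let $N\in\mathbb N_0$, $\beta=(\beta_0,\dots,\beta_{p+1})$, $V_N=\{x\in\mathbb N_0^p:0\le x_1\le\cdots\le x_p\le N\}$, $x_0=0$, $x_{p+1}=N$, $$w_{\mathsf R}(x;\beta,N)=\prod_{j=0}^p\frac{(\beta_{j+1}-\beta_j)_{x_{j+1}-x_j}(\beta_{j+1})_{x_{j+1}+x_j}}{(x_{j+1}-x_j)!\,(\beta_j+1)_{x_{j+1}+x_j}}\prod_{j=1}^p\frac{((\beta_j+2)/2)_{x_j}}{(\beta_j/2)_{x_j}}.$$ For $\nu\in\mathbb N_0^p$, $|\nu|\le N$, $$\mathsf R_\nu(x;\beta,N)=\prod_{j=1}^p(u_j)_{\nu_j}(v_j)_{\nu_j}(t_j)_{\nu_j}\;{}_4F_3\!\left(\begin{matrix}-\nu_j,\ \nu_j+2|\boldsymbol\nu_{j-1}|+\beta_{j+1}-\beta_0-1,\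 |\boldsymbol\nu_{j-1}|-x_j,\ |\boldsymbol\nu_{j-1}|+\beta_j+x_j\\ u_j,\ v_j,\ t_j\end{matrix};1\right),$$ $u_j=2|\boldsymbol\nu_{j-1}|+\beta_j-\beta_0$, $v_j=|\boldsymbol\nu_{j-1}|+\beta_{j+1}+x_{j+1}$, $t_j=|\boldsymbol\nu_{j-1}|-x_{j+1}$, where $(u)_m(v)_m(t)_m\,{}_4F_3(-m,a,b,c;u,v,t;1)$ means $\sum_{k=0}^m\frac{(-m)_k(a)_k(b)_k(c)_k}{k!}(u+k)_{m-k}(v+k)_{m-k}(t+k)_{m-k}$. These are mutually orthogonal on $V_N$ with weight $w_{\mathsf R}$; $\widehat{\mathsf R}_\nu=\mathsf R_\nu/r_\nu$ with $r_\nu^2=\sum_{y\in V_N}w_{\mathsf R}(y;\beta,N)\mathsf R_\nu(y;\beta,N)^2$. The product $\sqrt{w_{\mathsf R}}\,\widehat{\mathsf R}_\nu$ is read as $\mathsf R_\nu\cdot\sqrt{w_{\mathsf R}/r_\nu^2}$ (positive root), extended by continuity in the parameters at removable singularities. *)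

theory Defs
  imports "HOL-Analysis.Analysis" "HOL-Combinatorics.Cycles"
begin

text \<open>
  A vector \<open>(y\<^sub>1, \<dots>, y\<^sub>m)\<close> is a function on \<^typ>\<open>nat\<close> of which only the entries
  \<open>1, \<dots>, m\<close> matter (the parameters \<open>\<beta>\<close> of the Racah polynomials start at index \<open>0\<close>).
  Sets of multi-indices that are summed over consist of functions vanishing elsewhere, so that
  each tuple occurs exactly once.
\<close>

definition multi_index :: "nat \<Rightarrow> nat \<Rightarrow> (nat \<Rightarrow> nat) set" where
  "multi_index d n = {\<nu>. (\<forall>i. i \<notin> {1..d} \<longrightarrow> \<nu> i = 0) \<and> (\<Sum>i=1..d. \<nu> i) = n}"


section \<open>Jacobi polynomials on the simplex\<close>

text \<open>
  The classical Jacobi polynomial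
  \<open>(\<alpha>+1)\<^sub>n / n! \<cdot> \<^sub>2F\<^sub>1(-n, n+\<alpha>+\<beta>+1; \<alpha>+1; (1-t)/2)\<close>; the denominators \<open>(\<alpha>+1)\<^sub>k\<close> of the
  hypergeometric sum are cancelled against \<open>(\<alpha>+1)\<^sub>n\<close>.
\<close>

definition jacobi :: "nat \<Rightarrow> real \<Rightarrow> real \<Rightarrow> real \<Rightarrow> real" where
  "jacobi n \<alpha> \<beta> t =
     (\<Sum>k\<le>n. pochhammer (real n + \<alpha> + \<beta> + 1) k * pochhammer (\<alpha> + real k + 1) (n - k)
              / (fact k * fact (n - k)) * ((t - 1) / 2) ^ k)"

definition simplex_set :: "nat \<Rightarrow> (nat \<Rightarrow> real) set" where
  "simplex_set d = {x. (\<forall>i\<in>{1..d}. 0 \<le> x i) \<and> (\<Sum>i=1..d. x i) \<le> 1}"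

definition simplex_weight :: "nat \<Rightarrow> (nat \<Rightarrow> real) \<Rightarrow> (nat \<Rightarrow> real) \<Rightarrow> real" where
  "simplex_weight d \<kappa> x =
     (\<Prod>i=1..d. x i powr \<kappa> i) * (1 - (\<Sum>i=1..d. x i)) powr \<kappa> (d + 1)"

definition simplex_inner ::
  "nat \<Rightarrow> (nat \<Rightarrow> real) \<Rightarrow> ((nat \<Rightarrow> real) \<Rightarrow> real) \<Rightarrow> ((nat \<Rightarrow> real) \<Rightarrow> real) \<Rightarrow> real" where
  "simplex_inner d \<kappa> f g =
     Gamma ((\<Sum>i=1..d+1. \<kappa> i) + real d + 1) / (\<Prod>i=1..d+1. Gamma (\<kappa> i + 1)) *
     set_lebesgue_integral (Pi\<^sub>M {1..d} (\<lambda>_. lborel)) (simplex_set d)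
       (\<lambda>x. f x * g x * simplex_weight d \<kappa> x)"

text \<open>
  Where \<open>1 - |x\<^sub>j\<^sub>-\<^sub>1| = 0\<close> the \<open>j\<close>-th factor is to be read as the polynomial it represents. On the
  simplex the formula with \<open>x / 0 = 0\<close> gives the right value: there also \<open>x\<^sub>j = 0\<close>, so the factor,
  homogeneous of degree \<open>\<nu>\<^sub>j\<close> in \<open>x\<^sub>j\<close> and \<open>1 - |x\<^sub>j\<^sub>-\<^sub>1|\<close>, is \<open>0\<close> for \<open>\<nu>\<^sub>j > 0\<close> and \<open>1\<close> for \<open>\<nu>\<^sub>j = 0\<close>.
  The polynomials are only ever evaluated on the simplex below.
\<close>

definition simplex_jacobi ::
  "nat \<Rightarrow> (nat \<Rightarrow> nat) \<Rightarrow> (nat \<Rightarrow> real) \<Rightarrow> (nat \<Rightarrow> real) \<Rightarrow> real" where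
  "simplex_jacobi d \<nu> \<kappa> x =
     (\<Prod>j=1..d.
        (1 - (\<Sum>i=1..<j. x i)) ^ \<nu> j *
        jacobi (\<nu> j)
          ((\<Sum>i=j+1..d+1. \<kappa> i) + 2 * (\<Sum>i=j+1..d. real (\<nu> i)) + real (d - j))
          (\<kappa> j)
          (2 * x j / (1 - (\<Sum>i=1..<j. x i)) - 1))"

definition simplex_sqnorm :: "nat \<Rightarrow> (nat \<Rightarrow> nat) \<Rightarrow> (nat \<Rightarrow> real) \<Rightarrow> real" where
  "simplex_sqnorm d \<nu> \<kappa> = simplex_inner d \<kappa> (simplex_jacobi d \<nu> \<kappa>) (simplex_jacobi d \<nu> \<kappa>)"


section \<open>Connection coefficients\<close>

text \<open>On parameter vectors a permutation \<open>\<tau>\<close> of \<open>{1..d+1}\<close> acts by \<open>\<kappa> \<mapsto> \<kappa> \<circ> \<tau>\<close>.\<close>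

definition simplex_permute :: "nat \<Rightarrow> (nat \<Rightarrow> nat) \<Rightarrow> (nat \<Rightarrow> real) \<Rightarrow> nat \<Rightarrow> real" where
  "simplex_permute d \<tau> x = x(d + 1 := 1 - (\<Sum>i=1..d. x i)) \<circ> \<tau>"

definition connection_coeff ::
  "nat \<Rightarrow> (nat \<Rightarrow> nat) \<Rightarrow> (nat \<Rightarrow> real) \<Rightarrow> (nat \<Rightarrow> nat) \<Rightarrow> (nat \<Rightarrow> nat) \<Rightarrow> real" where
  "connection_coeff d \<tau> \<kappa> \<nu> =
     (THE c. (\<forall>\<mu>. \<mu> \<notin> multi_index d (\<Sum>i=1..d. \<nu> i) \<longrightarrow> c \<mu> = 0) \<and>
             (\<forall>x\<in>simplex_set d.
                simplex_jacobi d \<nu> (\<kappa> \<circ> \<tau>) (simplex_permute d \<tau> x) =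
                (\<Sum>\<mu>\<in>multi_index d (\<Sum>i=1..d. \<nu> i). c \<mu> * simplex_jacobi d \<mu> \<kappa> x)))"

definition connection_coeff_hat ::
  "nat \<Rightarrow> (nat \<Rightarrow> nat) \<Rightarrow> (nat \<Rightarrow> real) \<Rightarrow> (nat \<Rightarrow> nat) \<Rightarrow> (nat \<Rightarrow> nat) \<Rightarrow> real" where
  "connection_coeff_hat d \<tau> \<kappa> \<nu> \<mu> =
     sqrt (simplex_sqnorm d \<mu> \<kappa> / simplex_sqnorm d \<nu> (\<kappa> \<circ> \<tau>)) * connection_coeff d \<tau> \<kappa> \<nu> \<mu>"


section \<open>Racah polynomials of several variables\<close>

text \<open>Coordinates with the conventions \<open>x\<^sub>0 = 0\<close> and \<open>x\<^sub>p\<^sub>+\<^sub>1 = N\<close>.\<close>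

definition racah_node :: "nat \<Rightarrow> nat \<Rightarrow> (nat \<Rightarrow> nat) \<Rightarrow> nat \<Rightarrow> nat" where
  "racah_node p N x j = (if j = 0 then 0 else if j = p + 1 then N else x j)"

definition racah_points :: "nat \<Rightarrow> nat \<Rightarrow> (nat \<Rightarrow> nat) set" where
  "racah_points p N =
     {x. (\<forall>i. i \<notin> {1..p} \<longrightarrow> x i = 0) \<and> (\<forall>j\<le>p. racah_node p N x j \<le> racah_node p N x (j + 1))}"

definition racah_weight :: "nat \<Rightarrow> (nat \<Rightarrow> nat) \<Rightarrow> (nat \<Rightarrow> real) \<Rightarrow> nat \<Rightarrow> real" where
  "racah_weight p x \<beta> N =
     (let X = racah_node p N x in
      (\<Prod>j=0..p.
         pochhammer (\<beta> (j + 1) - \<beta> j) (X (j + 1) - X j) * pochhammer (\<beta> (j + 1)) (X (j + 1) + X j)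
         / (fact (X (j + 1) - X j) * pochhammer (\<beta> j + 1) (X (j + 1) + X j))) *
      (\<Prod>j=1..p. pochhammer ((\<beta> j + 2) / 2) (X j) / pochhammer (\<beta> j / 2) (X j)))"

text \<open>\<open>(u)\<^sub>m (v)\<^sub>m (t)\<^sub>m \<^sub>4F\<^sub>3(-m, a, b, c; u, v, t; 1)\<close> with the denominators cancelled.\<close>

definition cleared_4F3 ::
  "nat \<Rightarrow> real \<Rightarrow> real \<Rightarrow> real \<Rightarrow> real \<Rightarrow> real \<Rightarrow> real \<Rightarrow> real" where
  "cleared_4F3 m a b c u v t =
     (\<Sum>k\<le>m. pochhammer (- real m) k * pochhammer a k * pochhammer b k * pochhammer c k / fact k *
              (pochhammer (u + real k) (m - k) * pochhammer (v + real k) (m - k) *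
               pochhammer (t + real k) (m - k)))"

definition racah_poly :: "nat \<Rightarrow> (nat \<Rightarrow> nat) \<Rightarrow> (nat \<Rightarrow> nat) \<Rightarrow> (nat \<Rightarrow> real) \<Rightarrow> nat \<Rightarrow> real" where
  "racah_poly p \<nu> x \<beta> N =
     (\<Prod>j=1..p.
        let X = (\<lambda>i. real (racah_node p N x i)); s = (\<Sum>i=1..<j. real (\<nu> i)) in
        cleared_4F3 (\<nu> j)
          (real (\<nu> j) + 2 * s + \<beta> (j + 1) - \<beta> 0 - 1) (s - X j) (s + \<beta> j + X j)
          (2 * s + \<beta> j - \<beta> 0) (s + \<beta> (j + 1) + X (j + 1)) (s - X (j + 1)))"

definition racah_sqnorm :: "nat \<Rightarrow> (nat \<Rightarrow> nat) \<Rightarrow> (nat \<Rightarrow> real) \<Rightarrow> nat \<Rightarrow> real" where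
  "racah_sqnorm p \<nu> \<beta> N =
     (\<Sum>y\<in>racah_points p N. racah_weight p y \<beta> N * (racah_poly p \<nu> y \<beta> N)\<^sup>2)"

text \<open>
  The parameters for which no denominator in the weights on \<open>V\<^sub>N\<close> vanishes and the squared norm
  is nonzero.
\<close>

definition racah_regular :: "nat \<Rightarrow> (nat \<Rightarrow> nat) \<Rightarrow> nat \<Rightarrow> (nat \<Rightarrow> real) set" where
  "racah_regular p \<nu> N =
     {\<beta>. (\<forall>y\<in>racah_points p N.
            (\<forall>j\<le>p. pochhammer (\<beta> j + 1) (racah_node p N y (j + 1) + racah_node p N y j) \<noteq> 0) \<and>
            (\<forall>j\<in>{1..p}. pochhammer (\<beta> j / 2) (racah_node p N y j) \<noteq> 0)) \<and>
         racah_sqnorm p \<nu> \<beta> N \<noteq> 0}"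

text \<open>
  The product of \<open>\<surd>w\<close> and the orthonormal Racah polynomial, extended by continuity in \<open>\<beta>\<close> to
  parameters outside the regular set (for instance \<open>\<beta>\<^sub>1 = 0\<close>, where the weight contains \<open>0/0\<close>, or
  \<open>\<beta>\<^sub>p\<^sub>+\<^sub>1 = 0\<close>, where the weight and the squared norm both vanish). The limit is taken along
  regular parameters, since elsewhere the formula has the spurious values coming from \<open>x / 0 = 0\<close>.
  Weight and squared norm sit under one root because both may be negative.
\<close>

definition racah_weighted_orthonormal ::
  "nat \<Rightarrow> (nat \<Rightarrow> nat) \<Rightarrow> (nat \<Rightarrow> nat) \<Rightarrow> (nat \<Rightarrow> real) \<Rightarrow> nat \<Rightarrow> real" where
  "racah_weighted_orthonormal p \<nu> x \<beta> N =
     (let F = (\<lambda>\<beta>. racah_poly p \<nu> x \<beta> N * sqrt (racah_weight p x \<beta> N / racah_sqnorm p \<nu> \<beta> N)) in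
      if \<beta> \<in> racah_regular p \<nu> N then F \<beta> else Lim (at \<beta> within racah_regular p \<nu> N) F)"

end

theory Submission
  imports Defs
begin

text \<open>
  With \<open>x\<^sub>4 = 1 - |x|\<close> a Jacobi polynomial on the three-dimensional simplex is a product of three
  homogeneous Jacobi polynomials (\<open>jacobi_hom\<close>), attached to the chain of index sets
  \<open>{3,4} \<subset> {2,3,4} \<subset> {1,2,3,4}\<close>: each step of the chain adds one variable. The permuted polynomial
  belongs to the chain \<open>{1,4} \<subset> {1,3,4} \<subset> {1,2,3,4}\<close>. The two chains are joined by replacing one set
  at a time, first \<open>{1,4}\<close> by \<open>{3,4}\<close>, then \<open>{1,3,4}\<close> by \<open>{2,3,4}\<close>. Each replacement exchanges two
  variables in a polynomial of three (groups of) variables, and its coefficients are Racah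
  polynomials of one variable (\<open>swap_expansion\<close>). A replacement preserves the total degree that
  belongs to each of the other sets, so the intermediate index is determined by \<open>\<nu>\<close> and \<open>\<mu>\<close>: the
  connection coefficient is a product of two \<open>\<^sub>4F\<^sub>3\<close> sums, without summation (\<open>cyc_expansion\<close>), and
  this product is the Racah polynomial of two variables, up to explicit factors (\<open>cyc_coeff_racah\<close>).

  The exchange of two variables rests on the fact that the homogeneous polynomials in question are
  those annihilated by a second order operator that is symmetric in the variables with their
  parameters. Such a polynomial is determined by its values on the plane \<open>x + y + z = 0\<close>. There the
  claim becomes an identity between polynomials of one variable: expand a polynomial in
  \<open>l (l + \<omega>)\<close> in the Newton basis with the nodes taken from below (the definition of the Racah
  polynomials) or from above (the basis on which the identity is a divided difference). The passage
  between the two is Sears' transformation, that is, the Pfaff-Saalschuetz sum applied twice.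

  What remains is normalisation. Orthogonality on the simplex gives the norms \<open>A\<^sub>\<nu>\<close> in closed form,
  and \<open>w\<^sub>R\<close> at the point of \<open>\<nu>\<close> equals a constant times the square of the \<open>\<nu>\<close>-dependent factor of
  the coefficient divided by \<open>A\<^sub>\<nu>\<close> (\<open>racah_weight_eq\<close>). The norm of the Racah polynomial then needs no
  further summation: the normalised connection coefficients form an orthogonal matrix, and
  Parseval's identity for its columns is the value of the norm (\<open>racah_sqnorm_eq\<close>). The relation
  between the two cyclic permutations says that the inverse of this matrix is its transpose.

  The coefficients are continuous in \<open>\<kappa>\<close>, with closed forms that stay finite for all \<open>\<kappa>\<^sub>i > -1\<close>. The
  regular parameters accumulate at every parameter, so the continuous extension on the Racah side
  agrees with them at the exceptional parameters as well (\<open>racah_weighted_orthonormal_eq\<close>).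
\<close>

section \<open>Terminating hypergeometric sums\<close>

lemma pochhammer_nonzero: "pochhammer (x::real) n \<noteq> 0" if "x > 0"
  using pochhammer_pos[OF that, of n] by simp

lemma pochhammer_nonzero_gt_minus_one:
  fixes x :: real
  assumes "x > -1" "x \<noteq> 0"
  shows "pochhammer x m \<noteq> 0"
proof
  assume "pochhammer x m = 0"
  then obtain k where "x = - real k" by (auto simp: pochhammer_eq_0_iff)
  then show False using assms by (cases k) auto
qed

text \<open>
  Splitting \<open>(z)\<^sub>k\<^sub>+\<^sub>m\<^sub>+\<^sub>1\<^sub>+\<^sub>r\<close> at the places \<open>k\<close>, \<open>k + m\<close> and \<open>k + m + 1\<close>; with \<open>z = \<beta>\<^sub>j\<close> this
  applies to the denominators of the Racah weight, and the single factor in the middle cancels against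
  the one in \<open>pochhammer_half_quotient\<close>.
\<close>

lemma pochhammer_four_split:
  fixes z :: real
  shows "pochhammer z k * pochhammer (z + k) m * (z + (k + m)) * pochhammer (z + (k + m) + 1) r = z * pochhammer (z + 1) (k + m + r)"
proof -
  have "pochhammer z k * pochhammer (z + k) m * (z + (k + m)) * pochhammer (z + (k + m) + 1) r
     = pochhammer z (k + m) * pochhammer (z + real (k + m)) (Suc r)"
    unfolding pochhammer_product'[of z k m] pochhammer_rec[of _ r] by simp
  also have "\<dots> = pochhammer z (Suc (k + m + r))"
    by (simp only: pochhammer_product'[symmetric] add_Suc_right)
  finally show ?thesis by (simp only: pochhammer_rec)
qed

text \<open>
  For \<open>m = 0\<close> the Pochhammer symbol is empty, so \<open>x\<close> itself may be negative or zero.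
\<close>

lemma pochhammer_self_shift_pos:
  assumes "x > -1"
  shows "pochhammer (x + real m) m > 0"
  using assms by (cases m) (auto intro!: pochhammer_pos)

lemma pochhammer_shift_diff:
  fixes x :: real
  shows "pochhammer (x + 1) (Suc m) - pochhammer x (Suc m) = real (Suc m) * pochhammer (x + 1) m"
proof -
  have "pochhammer (x + 1) (Suc m) = pochhammer (x + 1) m * (x + 1 + real m)"
    by (simp add: pochhammer_Suc)
  moreover have "pochhammer x (Suc m) = x * pochhammer (x + 1) m"
    by (rule pochhammer_rec)
  ultimately show ?thesis by (simp add: algebra_simps)
qed

text \<open>
  The Pfaff-Saalschuetz sum. With all denominators cleared it holds for arbitrary real parameters.
  Pascal's rule splits the sum for \<open>n + 1\<close> into two sums over \<open>k \<le> n\<close>; in their difference from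
  \<open>(c - a + n) (c - b + n)\<close> times the sum for \<open>n\<close> everything telescopes.
\<close>

theorem saalschuetz:
  fixes a b c :: real
  shows "(\<Sum>k\<le>n. real (n choose k) * (pochhammer a k * pochhammer b k *
            pochhammer (c + real k) (n - k) * pochhammer (c - a - b) (n - k))) =
         pochhammer (c - a) n * pochhammer (c - b) n"
proof (induction n)
  case 0
  show ?case by simp
next
  case (Suc n)
  define s where "s = c - a - b"
  define U where "U k = real (n choose k) * (pochhammer a k * pochhammer b k *
            pochhammer (c + real k) (n - k) * pochhammer s (n - k))" for k
  define V where "V k = pochhammer a k * pochhammer b k *
            pochhammer (c + real k) (Suc n - k) * pochhammer s (Suc n - k)" for k
  have V1: "real (n choose k) * V k = U k * ((c + n) * (s + (real n - real k)))" if "k \<le> n" for k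
    using that unfolding U_def V_def
    by (simp add: Suc_diff_le pochhammer_Suc of_nat_diff algebra_simps)
  \<comment> \<open>The second term on the right is the shift of \<open>k \<mapsto> U k * (k * (s + n - k))\<close>, so after
  summation the terms for \<open>k\<close> and \<open>k + 1\<close> combine into one multiple of \<open>U k\<close>.\<close>
  have V2: "real (n choose k) * V (Suc k) =
      U k * ((a + k) * (b + k)) + U (Suc k) * (real (Suc k) * (s + (real n - real (Suc k))))"
    if "k \<le> n" for k
  proof (cases "k = n")
    case True
    then show ?thesis by (simp add: U_def V_def pochhammer_Suc binomial_eq_0)
  next
    case False
    with that obtain m where m: "n = k + Suc m"
      using less_imp_add_positive[of k n] by (metis Suc_pred le_neq_implies_less)
    have binom: "real (n choose Suc k) * real (Suc k) = real (n choose k) * real (Suc m)"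
    proof -
      have "Suc k * (n choose Suc k) = (n - k) * (n choose k)"
        by (metis binomial_absorb_comp binomial_absorption diff_Suc_Suc mult.commute Suc_times_binomial_add m add_diff_cancel_left')
      then show ?thesis by (metis m add_diff_cancel_left' mult.commute of_nat_mult)
    qed
    define p where "p = pochhammer (c + 1 + real k) m"
    define q where "q = pochhammer (c + real k) (Suc m)"
    have d: "pochhammer (c + 1 + real k) (Suc m) = q + real (Suc m) * p"
      using pochhammer_shift_diff[of "c + k" m] by (simp add: p_def q_def algebra_simps)
    have "real (n choose k) * V (Suc k) =
       real (n choose k) * (pochhammer a (Suc k) * pochhammer b (Suc k)) * (q + real (Suc m) * p) * pochhammer s (Suc m)"
      using d by (simp add: V_def m add_ac)
    also have "\<dots> = real (n choose k) * (pochhammer a (Suc k) * pochhammer b (Suc k)) * q * pochhammer s (Suc m)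
       + (real (n choose k) * real (Suc m)) * (pochhammer a (Suc k) * pochhammer b (Suc k)) * p * pochhammer s (Suc m)"
      by (simp add: algebra_simps)
    also have "(real (n choose k) * real (Suc m)) = real (n choose Suc k) * real (Suc k)"
      using binom by simp
    also have "real (n choose k) * (pochhammer a (Suc k) * pochhammer b (Suc k)) * q * pochhammer s (Suc m)
      = U k * ((a + k) * (b + k))"
      by (simp add: U_def m q_def pochhammer_Suc algebra_simps)
    also have "real (n choose Suc k) * real (Suc k) * (pochhammer a (Suc k) * pochhammer b (Suc k)) * p * pochhammer s (Suc m)
      = U (Suc k) * (real (Suc k) * (s + (real n - real (Suc k))))"
      by (simp add: U_def m p_def pochhammer_Suc[of s m] add_ac)
    finally show ?thesis .
  qed
  have "(\<Sum>k\<le>Suc n. real (Suc n choose k) * V k) =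
        (\<Sum>k\<le>n. real (n choose k) * V k) + (\<Sum>k\<le>n. real (n choose k) * V (Suc k))"
  proof -
    have "(\<Sum>k\<le>Suc n. real (Suc n choose k) * V k) = V 0 + (\<Sum>k\<le>n. real (Suc n choose Suc k) * V (Suc k))"
      by (simp add: sum.atMost_Suc_shift del: binomial_Suc_Suc sum.atMost_Suc)
    also have "(\<Sum>k\<le>n. real (Suc n choose Suc k) * V (Suc k)) =
       (\<Sum>k\<le>n. real (n choose k) * V (Suc k)) + (\<Sum>k\<le>n. real (n choose Suc k) * V (Suc k))"
      by (simp add: sum.distrib[symmetric] distrib_right)
    also have "V 0 + ((\<Sum>k\<le>n. real (n choose k) * V (Suc k)) + (\<Sum>k\<le>n. real (n choose Suc k) * V (Suc k)))
       = (\<Sum>k\<le>n. real (n choose k) * V (Suc k)) + (\<Sum>k\<le>Suc n. real (n choose k) * V k)"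
      by (simp add: sum.atMost_Suc_shift del: sum.atMost_Suc)
    finally show ?thesis by simp
  qed
  also have "(\<Sum>k\<le>n. real (n choose k) * V (Suc k)) =
     (\<Sum>k\<le>n. U k * ((a + k) * (b + k))) + (\<Sum>k\<le>n. U (Suc k) * (real (Suc k) * (s + (real n - real (Suc k)))))"
    using V2 by (simp add: sum.distrib del: of_nat_Suc)
  also have "(\<Sum>k\<le>n. U (Suc k) * (real (Suc k) * (s + (real n - real (Suc k))))) =
     (\<Sum>k\<le>Suc n. U k * (real k * (s + (real n - real k))))"
    by (simp add: sum.atMost_Suc_shift del: sum.atMost_Suc)
  also have "\<dots> = (\<Sum>k\<le>n. U k * (real k * (s + (real n - real k))))"
    by (simp add: U_def)
  also have "(\<Sum>k\<le>n. real (n choose k) * V k) = (\<Sum>k\<le>n. U k * ((c + n) * (s + (real n - real k))))"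
    using V1 by simp
  also have "(\<Sum>k\<le>n. U k * ((c + n) * (s + (real n - real k)))) +
      ((\<Sum>k\<le>n. U k * ((a + k) * (b + k))) + (\<Sum>k\<le>n. U k * (real k * (s + (real n - real k))))) =
      (\<Sum>k\<le>n. U k * ((c - a + n) * (c - b + n)))"
    unfolding sum.distrib[symmetric]
    by (rule sum.cong) (simp_all add: s_def algebra_simps)
  also have "\<dots> = (\<Sum>k\<le>n. U k) * ((c - a + n) * (c - b + n))"
    by (simp add: sum_distrib_right)
  also have "(\<Sum>k\<le>n. U k) = pochhammer (c - a) n * pochhammer (c - b) n"
    using Suc.IH by (simp add: U_def s_def)
  finally show ?case
    by (simp add: V_def s_def pochhammer_Suc mult_ac del: binomial_Suc_Suc)
qed

lemma pochhammer_neg_of_nat: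
  assumes "k \<le> n"
  shows "pochhammer (- real n) k = (-1) ^ k * fact n / fact (n - k)"
  using assms
proof (induction k)
  case (Suc k)
  then have "n - k = Suc (n - Suc k)" by simp
  then have "fact (n - k) = (real (n - k)) * fact (n - Suc k)"
    by (metis fact_Suc)
  with Suc show ?case
    by (simp add: pochhammer_Suc of_nat_diff field_simps)
qed simp

lemma pochhammer_reflect:
  fixes x :: real
  shows "pochhammer (- x) n = (-1) ^ n * pochhammer (x - real n + 1) n"
  by (simp add: pochhammer_minus)

text \<open>
  By induction, because the summand is the difference of two consecutive values of the right-hand
  side. The factor \<open>(\<theta> + i)\<^sub>i (\<theta> + 2 i + 1)\<^sub>M\<^sub>+\<^sub>1\<^sub>-\<^sub>i\<close> stands for \<open>(\<theta> + i)\<^sub>M\<^sub>+\<^sub>2 / (\<theta> + 2 i)\<close>; in this form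
  \<open>\<theta> = 0\<close>, \<open>i = 0\<close> is not exceptional.
\<close>

lemma alternating_sum_partial:
  fixes \<theta> :: real
  assumes "\<theta> > -1" and "m \<le> M"
  shows "(\<Sum>i\<le>m. (-1) ^ i / (fact i * fact (Suc M - i) *
            (pochhammer (\<theta> + i) i * pochhammer (\<theta> + 2 * real i + 1) (Suc M - i)))) =
         (-1) ^ m / (real (Suc M) * (fact m * fact (M - m) * pochhammer (\<theta> + real m + 1) (Suc M)))"
  using assms(2)
proof (induction m)
  case 0
  show ?case by simp
next
  case (Suc m)
  obtain d where M: "M = Suc m + d" using Suc.prems le_Suc_ex by blast
  define p where "p = pochhammer (\<theta> + real m + 1) (Suc m)"
  define q where "q = pochhammer (\<theta> + 2 * real m + 3) d"
  \<comment> \<open>The linear factors in which the denominators of consecutive terms differ.\<close>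
  define e1 where "e1 = \<theta> + real m + 1"
  define e2 where "e2 = \<theta> + 2 * real m + 2"
  define e3 where "e3 = \<theta> + 2 * real m + 3 + d"
  have pos: "p > 0" "q > 0" "e1 > 0" "e2 > 0" "e3 > 0"
    using assms(1) by (auto simp: p_def q_def e1_def e2_def e3_def intro!: pochhammer_pos)
  have t: "pochhammer (\<theta> + real (Suc m)) (Suc m) * pochhammer (\<theta> + 2 * real (Suc m) + 1) (Suc M - Suc m)
      = p * (q * e3)"
    by (simp add: p_def q_def M e3_def pochhammer_Suc add_ac)
  have e: "pochhammer (\<theta> + real m + 1) (Suc M) = p * (e2 * q)"
  proof -
    have "Suc M = Suc m + Suc d" by (simp add: M)
    then show ?thesis
      using pochhammer_product'[of "\<theta> + real m + 1" "Suc m" "Suc d"]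
      by (simp add: p_def q_def e2_def pochhammer_rec[of _ d] add_ac)
  qed
  have "pochhammer (\<theta> + real m + 1) (Suc M) * e3 = e1 * pochhammer (\<theta> + real (Suc m) + 1) (Suc M)"
    using pochhammer_rec[of e1 "Suc M"] pochhammer_rec'[of e1 "Suc M"]
    by (simp add: M e1_def e3_def algebra_simps)
  then have g: "pochhammer (\<theta> + real (Suc m) + 1) (Suc M) = p * e2 * q * e3 / e1"
    using e pos by (simp add: field_simps)
  have h: "fact (M - m) = real (Suc d) * fact d" by (simp add: M)
  have num: "real (Suc M) * e2 = real (Suc d) * e1 + real (Suc m) * e3"
    by (simp add: M e1_def e2_def e3_def algebra_simps)
  have "1 / (real (Suc m) * real (Suc d) * (p * (q * e3))) - 1 / (real (Suc M) * (real (Suc d) * (p * (e2 * q))))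
      = e1 / (real (Suc M) * (real (Suc m) * (p * e2 * q * e3)))"
  proof -
    have frac: "1 / (x * y * (p * (q * e3))) - 1 / (z * (y * (p * (e2 * q)))) = e1 / (z * (x * (p * e2 * q * e3)))"
      if "z * e2 = y * e1 + x * e3" "x > 0" "y > 0" "z > 0" for x y z :: real
    proof -
      have "1 / (x * y * (p * (q * e3))) - 1 / (z * (y * (p * (e2 * q)))) = (z * e2 - x * e3) / (x * y * z * p * q * e2 * e3)"
        using that(2-) pos by (simp add: field_simps)
      also have "\<dots> = e1 / (z * (x * (p * e2 * q * e3)))"
        using that pos by (simp add: field_simps)
      finally show ?thesis .
    qed
    show ?thesis by (rule frac[OF num]) simp_all
  qed
  then have key: "(-1) ^ Suc m / (fact m * fact d) * (1 / (real (Suc m) * real (Suc d) * (p * (q * e3))) - 1 / (real (Suc M) * (real (Suc d) * (p * (e2 * q)))))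
      = (-1) ^ Suc m / (fact m * fact d) * (e1 / (real (Suc M) * (real (Suc m) * (p * e2 * q * e3))))"
    by simp
  have "(\<Sum>i\<le>Suc m. (-1) ^ i / (fact i * fact (Suc M - i) *
            (pochhammer (\<theta> + i) i * pochhammer (\<theta> + 2 * real i + 1) (Suc M - i))))
    = (-1) ^ m / (real (Suc M) * (fact m * fact (M - m) * (p * (e2 * q))))
      + (-1) ^ Suc m / (fact (Suc m) * fact (Suc M - Suc m) * (p * (q * e3)))"
    using Suc by (simp only: sum.atMost_Suc t e) 
  also have "\<dots> = (-1) ^ Suc m / (fact m * fact d) * (1 / (real (Suc m) * real (Suc d) * (p * (q * e3))) - 1 / (real (Suc M) * (real (Suc d) * (p * (e2 * q)))))"
    unfolding h by (simp add: M diff_divide_distrib right_diff_distrib mult_ac)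
  also have "\<dots> = (-1) ^ Suc m / (real (Suc M) * (fact (Suc m) * fact (M - Suc m) * (p * e2 * q * e3 / e1)))"
    unfolding key by (simp add: M mult_ac)
  finally show ?case unfolding g .
qed

text \<open>
  Up to the sign \<open>(-1)\<^sup>M\<close> this is the divided difference of the constant \<open>1\<close> at the nodes
  \<open>i (i + \<theta>)\<close> for \<open>i \<le> M\<close>, since \<open>i (i + \<theta>) - m (m + \<theta>) = (i - m) (i + m + \<theta>)\<close>.
\<close>

lemma alternating_sum:
  fixes \<theta> :: real
  assumes "\<theta> > -1"
  shows "(\<Sum>i\<le>M. (-1) ^ i / (fact i * fact (M - i) *
            (pochhammer (\<theta> + i) i * pochhammer (\<theta> + 2 * real i + 1) (M - i)))) =
         (if M = 0 then 1 else 0)"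
proof (cases M)
  case (Suc m)
  have "pochhammer (\<theta> + real (Suc m)) (Suc m) = pochhammer (\<theta> + real m + 1) (Suc m)"
    by (simp add: add_ac)
  then show ?thesis
    unfolding Suc using alternating_sum_partial[OF assms order.refl, of m]
    by (simp del: fact_Suc of_nat_Suc add: fact_Suc[of m])
qed simp

text \<open>
  As functions of \<open>x (x + \<omega>)\<close>, the products \<open>(-x)\<^sub>k (x + \<omega>)\<^sub>k\<close> and \<open>(x - N)\<^sub>r (- x - N - \<omega>)\<^sub>r\<close> are
  the Newton bases for the nodes \<open>l (l + \<omega>)\<close> taken upwards from \<open>l = 0\<close> and downwards from \<open>l = N\<close>.
  The coefficients of the change of basis come from one Saalschuetz sum.
\<close>

lemma newton_basis_reversal:
  fixes x \<omega> N :: real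
  shows "pochhammer (- x) k * pochhammer (x + \<omega>) k =
    (\<Sum>r\<le>k. real (k choose r) * (pochhammer (x - N) r * pochhammer (- x - N - \<omega>) r *
        pochhammer (- N + real r) (k - r) * pochhammer (N + \<omega>) (k - r)))"
  using saalschuetz[where n = k and a = "x - N" and b = "- x - N - \<omega>" and c = "- N"]
  by (simp add: algebra_simps)

lemma sum_triangle_swap:
  fixes f :: "nat \<Rightarrow> nat \<Rightarrow> 'a :: comm_monoid_add"
  shows "(\<Sum>k\<le>n. \<Sum>r\<le>k. f k r) = (\<Sum>r\<le>n. \<Sum>i\<le>n - r. f (r + i) r)"
  unfolding sum.Sigma[OF finite_atMost ballI[OF finite_atMost]]
  by (rule sum.reindex_bij_witness[where i = "\<lambda>(r, i). (r + i, r)" and j = "\<lambda>(k, r). (r, k - r)"]) auto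

text \<open>
  Sears' transformation of a terminating balanced \<open>\<^sub>4F\<^sub>3\<close>: both sides are the same polynomial in
  \<open>x (x + \<omega>)\<close>, in the Newton basis from below and from above. After inserting the change of basis
  and exchanging the summations, the inner sum is again a Saalschuetz sum.
\<close>

theorem sears_cleared:
  fixes a b c x :: real
  defines "\<omega> \<equiv> b + c + 1"
  assumes "j \<le> N"
  defines "v \<equiv> real N + \<omega> + a + 1"
  shows "(\<Sum>k\<le>j. (-1) ^ k * real (j choose k) * pochhammer (real j + a + c + 1) k *
            pochhammer (c + 1 + real k) (j - k) * pochhammer (v + real k) (j - k) *
            (pochhammer (- x) k * pochhammer (x + \<omega>) k / pochhammer (- real N) k)) =
         (\<Sum>r\<le>j. (-1) ^ r * real (j choose r) * pochhammer (real j + a + c + 1) r *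
            pochhammer (a + 1 + real r) (j - r) * pochhammer (real r - real N - b) (j - r) *
            (pochhammer (x - real N) r * pochhammer (- x - real N - \<omega>) r / pochhammer (- real N) r))"
proof -
  define E where "E r = pochhammer (x - real N) r * pochhammer (- x - real N - \<omega>) r / pochhammer (- real N) r" for r
  define P where "P k = (-1) ^ k * pochhammer (real j + a + c + 1) k *
            pochhammer (c + 1 + real k) (j - k) * pochhammer (v + real k) (j - k)" for k
  have nz: "pochhammer (- real N) k \<noteq> 0" if "k \<le> N" for k
    using that by (simp add: pochhammer_neg_of_nat)
  have 1: "pochhammer (- x) k * pochhammer (x + \<omega>) k / pochhammer (- real N) k =
      (\<Sum>r\<le>k. real (k choose r) * E r * pochhammer (real N + \<omega>) (k - r))" if "k \<le> j" for k
    unfolding newton_basis_reversal[where N = "real N"] sum_divide_distrib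
  proof (rule sum.cong[OF refl])
    fix r assume r: "r \<in> {..k}"
    then have "pochhammer (- real N) k = pochhammer (- real N) r * pochhammer (- real N + real r) (k - r)"
      using pochhammer_product[of r k "- real N"] by simp
    moreover have "pochhammer (- real N) k \<noteq> 0" using nz that assms(2) by auto
    ultimately show "real (k choose r) * (pochhammer (x - real N) r * pochhammer (- x - real N - \<omega>) r *
        pochhammer (- real N + real r) (k - r) * pochhammer (real N + \<omega>) (k - r)) / pochhammer (- real N) k
      = real (k choose r) * E r * pochhammer (real N + \<omega>) (k - r)"
      by (simp add: E_def)
  qed
  have inner: "(\<Sum>i\<le>j - r. real (j choose (r + i)) * P (r + i) * (real ((r + i) choose r) * pochhammer (real N + \<omega>) i))
     = (-1) ^ r * real (j choose r) * pochhammer (real j + a + c + 1) r *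
            pochhammer (a + 1 + real r) (j - r) * pochhammer (real r - real N - b) (j - r)" if r: "r \<le> j" for r
  proof -
    define m where "m = j - r"
    have j: "j = r + m" using r by (simp add: m_def)
    \<comment> \<open>The sum over \<open>i\<close> is a Saalschuetz sum: \<open>C - A - B = - (j + a + B)\<close> is reflected to \<open>v + r + i\<close>.\<close>
    define A where "A = real j + real r + a + c + 1"
    define B where "B = real N + \<omega>"
    define C where "C = c + 1 + real r"
    have t: "real (j choose (r + i)) * P (r + i) * (real ((r + i) choose r) * pochhammer (real N + \<omega>) i)
       = (-1) ^ (r + m) * real (j choose r) * pochhammer (real j + a + c + 1) r *
         (real (m choose i) * (pochhammer A i * pochhammer B i * pochhammer (C + real i) (m - i) * pochhammer (C - A - B) (m - i)))"
      if i: "i \<le> m" for i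
    proof -
      have b: "real (j choose (r + i)) * real ((r + i) choose r) = real (j choose r) * real (m choose i)"
        using choose_mult[of r "r + i" j] i by (simp add: j of_nat_mult[symmetric] del: of_nat_mult)
      have p: "pochhammer (real j + a + c + 1) (r + i) = pochhammer (real j + a + c + 1) r * pochhammer A i"
        by (subst pochhammer_product') (simp add: A_def add_ac)
      have "C - A - B = - (real j + a + B)" by (simp add: A_def C_def)
      moreover have "real j + a + B - real (m - i) + 1 = v + real (r + i)"
        using i by (simp add: v_def B_def j of_nat_diff)
      ultimately have q: "pochhammer (C - A - B) (m - i) = (-1) ^ (m - i) * pochhammer (v + real (r + i)) (m - i)"
        by (simp only: pochhammer_reflect)
      have s: "(-1::real) ^ (r + i) = (-1) ^ (r + m) * (-1) ^ (m - i)"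
        using i by (simp add: power_add[symmetric] uminus_power_if)
      have "real (j choose (r + i)) * P (r + i) * (real ((r + i) choose r) * pochhammer (real N + \<omega>) i)
        = (real (j choose (r + i)) * real ((r + i) choose r)) * (-1) ^ (r + i) *
          pochhammer (real j + a + c + 1) (r + i) * pochhammer (C + real i) (m - i)
          * pochhammer (v + real (r + i)) (m - i) * pochhammer B i"
        by (simp add: P_def B_def C_def j add_ac mult_ac)
      also have "\<dots> = (-1) ^ (r + m) * real (j choose r) * pochhammer (real j + a + c + 1) r *
         (real (m choose i) * (pochhammer A i * pochhammer B i * pochhammer (C + real i) (m - i) * pochhammer (C - A - B) (m - i)))"
        unfolding b p q s by (simp add: mult_ac)
      finally show ?thesis .
    qed
    have "C - A = - (real j + a)" by (simp add: A_def C_def)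
    moreover have "real j + a - real m + 1 = a + 1 + real r" by (simp add: j)
    ultimately have q: "pochhammer (C - A) m = (-1) ^ m * pochhammer (a + 1 + real r) m"
      by (simp only: pochhammer_reflect)
    have q2: "C - B = real r - real N - b" by (simp add: B_def C_def \<omega>_def)
    have "(\<Sum>i\<le>m. real (j choose (r + i)) * P (r + i) * (real ((r + i) choose r) * pochhammer (real N + \<omega>) i))
      = (-1) ^ (r + m) * real (j choose r) * pochhammer (real j + a + c + 1) r * (pochhammer (C - A) m * pochhammer (C - B) m)"
      using t by (simp add: sum_distrib_left[symmetric] saalschuetz)
    then show ?thesis
      unfolding q q2 by (simp add: m_def power_add mult_ac)
  qed
  have "(\<Sum>k\<le>j. (-1) ^ k * real (j choose k) * pochhammer (real j + a + c + 1) k *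
            pochhammer (c + 1 + real k) (j - k) * pochhammer (v + real k) (j - k) *
            (pochhammer (- x) k * pochhammer (x + \<omega>) k / pochhammer (- real N) k))
     = (\<Sum>k\<le>j. \<Sum>r\<le>k. real (j choose k) * P k * (real (k choose r) * E r * pochhammer (real N + \<omega>) (k - r)))"
    by (rule sum.cong) (simp_all add: 1 P_def sum_distrib_left mult_ac)
  also have "\<dots> = (\<Sum>r\<le>j. E r * (\<Sum>i\<le>j - r. real (j choose (r + i)) * P (r + i) * (real ((r + i) choose r) * pochhammer (real N + \<omega>) i)))"
    unfolding sum_triangle_swap by (simp add: sum_distrib_left mult_ac)
  also have "\<dots> = (\<Sum>r\<le>j. (-1) ^ r * real (j choose r) * pochhammer (real j + a + c + 1) r *
            pochhammer (a + 1 + real r) (j - r) * pochhammer (real r - real N - b) (j - r) * E r)"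
    using inner by (intro sum.cong) (auto simp: mult_ac)
  finally show ?thesis by (simp add: E_def)
qed

section \<open>The exchange coefficients as divided differences\<close>

text \<open>
  The coefficient of \<open>y\<^sup>r q\<^sup>m\<^sup>-\<^sup>r\<close> in the homogeneous Jacobi polynomial \<open>q\<^sup>m P\<^sub>m\<^sup>\<alpha>\<^sup>,\<^sup>\<beta> (2 y / q - 1)\<close>.
\<close>

definition jacobi_coeff :: "nat \<Rightarrow> real \<Rightarrow> real \<Rightarrow> nat \<Rightarrow> real" where
  "jacobi_coeff m \<alpha> \<beta> r = (if m < r then 0 else
     (-1) ^ (m + r) * pochhammer (real m + \<alpha> + \<beta> + 1) r * pochhammer (\<beta> + 1 + real r) (m - r) / (fact r * fact (m - r)))"

text \<open>
  The coefficients in \<open>swap_expansion\<close>. As in \<open>alternating_sum_partial\<close> the denominator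
  \<open>(\<omega> + l)\<^sub>l (\<omega> + 2 l + 1)\<^sub>N\<^sub>-\<^sub>l\<close> stands for \<open>(\<omega> + l)\<^sub>N\<^sub>+\<^sub>1 / (\<omega> + 2 l)\<close>; it is positive for all
  \<open>\<omega> > -1\<close>, including \<open>\<omega> = 0\<close>.
\<close>

definition swap_coeff :: "nat \<Rightarrow> nat \<Rightarrow> real \<Rightarrow> real \<Rightarrow> real \<Rightarrow> nat \<Rightarrow> real" where
  "swap_coeff N j a b c l = (let \<omega> = b + c + 1 in
     (-1) ^ (N + j) * (pochhammer (b + 1) (N - j) * pochhammer (c + 1) j / (fact (N - j) * fact j)) *
     (fact (N - l) / (pochhammer (b + 1) l * pochhammer (c + 1) l *
        (pochhammer (\<omega> + l) l * pochhammer (\<omega> + 2 * real l + 1) (N - l)))) *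
     cleared_4F3 l (real l + \<omega>) (- real j) (real j + a + c + 1) (c + 1) (real N + \<omega> + a + 1) (- real N))"

text \<open>
  The \<open>\<^sub>4F\<^sub>3\<close> sum terminates at the smaller of \<open>l\<close> and \<open>j\<close>, so its denominators may be cleared by
  the \<open>l\<close>-th Pochhammer symbols, as for the Racah polynomials, or by the \<open>j\<close>-th ones, as in
  \<open>sears_cleared\<close>.
\<close>

lemma cleared_4F3_change_clearing:
  fixes c v x y :: real
  assumes "j \<le> N" "l \<le> N" and c: "\<And>k. k \<le> N \<Longrightarrow> pochhammer c k \<noteq> 0"
    and v: "\<And>k. k \<le> N \<Longrightarrow> pochhammer v k \<noteq> 0"
  shows "pochhammer c j * pochhammer v j * cleared_4F3 l x (- real j) y c v (- real N) =
     pochhammer c l * pochhammer v l * pochhammer (- real N) l *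
     (\<Sum>k\<le>j. (-1) ^ k * real (j choose k) * pochhammer y k *
            pochhammer (c + real k) (j - k) * pochhammer (v + real k) (j - k) *
            (pochhammer (- real l) k * pochhammer x k / pochhammer (- real N) k))"
proof -
  have nz: "pochhammer (- real N) k \<noteq> 0" if "k \<le> N" for k
    using that by (simp add: pochhammer_neg_of_nat)
  define f where "f k = pochhammer (- real l) k * pochhammer x k * pochhammer (- real j) k * pochhammer y k / fact k /
     (pochhammer c k * pochhammer v k * pochhammer (- real N) k)" for k
  have q: "pochhammer (z + real k) (m - k) = pochhammer z m / pochhammer z k" if "k \<le> m" "pochhammer z k \<noteq> 0" for z :: real and k m
    using that pochhammer_product[of k m z] by simp
  have "cleared_4F3 l x (- real j) y c v (- real N) = pochhammer c l * pochhammer v l * pochhammer (- real N) l * (\<Sum>k\<le>l. f k)"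
    unfolding cleared_4F3_def sum_distrib_left
  proof (rule sum.cong[OF refl])
    fix k assume k: "k \<in> {..l}"
    then have k: "k \<le> l" "k \<le> N" using assms(2) by auto
    have "- real N + real k = real k - real N" by simp
    then show "pochhammer (- real l) k * pochhammer x k * pochhammer (- real j) k * pochhammer y k / fact k *
        (pochhammer (c + real k) (l - k) * pochhammer (v + real k) (l - k) * pochhammer (- real N + real k) (l - k)) =
        pochhammer c l * pochhammer v l * pochhammer (- real N) l * f k"
      unfolding q[OF k(1) c[OF k(2)]] q[OF k(1) v[OF k(2)]] q[OF k(1) nz[OF k(2)]] by (simp add: f_def)
  qed
  moreover have "(\<Sum>k\<le>l. f k) = (\<Sum>k\<le>min l j. f k)"
    by (rule sum.mono_neutral_right) (auto simp: f_def pochhammer_of_nat_eq_0_iff)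
  moreover have "(\<Sum>k\<le>j. f k) = (\<Sum>k\<le>min l j. f k)"
    by (rule sum.mono_neutral_right) (auto simp: f_def pochhammer_of_nat_eq_0_iff)
  moreover have "pochhammer c j * pochhammer v j * (\<Sum>k\<le>j. f k) = (\<Sum>k\<le>j. (-1) ^ k * real (j choose k) * pochhammer y k *
            pochhammer (c + real k) (j - k) * pochhammer (v + real k) (j - k) *
            (pochhammer (- real l) k * pochhammer x k / pochhammer (- real N) k))"
    unfolding sum_distrib_left
  proof (rule sum.cong[OF refl])
    fix k assume "k \<in> {..j}"
    then have k: "k \<le> j" "k \<le> N" using assms(1) by auto
    have "pochhammer (- real j) k / fact k = (-1) ^ k * real (j choose k)"
      using k by (simp add: pochhammer_neg_of_nat binomial_fact)
    moreover have "pochhammer c j * pochhammer v j * f k = pochhammer c j / pochhammer c k * (pochhammer v j / pochhammer v k) *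
        (pochhammer (- real j) k / fact k) * pochhammer y k * (pochhammer (- real l) k * pochhammer x k / pochhammer (- real N) k)"
      by (simp add: f_def mult_ac)
    ultimately show "pochhammer c j * pochhammer v j * f k = (-1) ^ k * real (j choose k) * pochhammer y k *
            pochhammer (c + real k) (j - k) * pochhammer (v + real k) (j - k) *
            (pochhammer (- real l) k * pochhammer x k / pochhammer (- real N) k)"
      unfolding q[OF k(1) c[OF k(2)]] q[OF k(1) v[OF k(2)]] by (simp only: mult_ac)
  qed
  ultimately show ?thesis by simp
qed

lemma pochhammer_diff_eq_0:
  assumes "l \<le> N" "N < l + r"
  shows "pochhammer (real l - real N) r = 0"
proof -
  obtain d where N: "N = l + d" using assms(1) le_Suc_ex by blast
  have "pochhammer (- real d) r = 0"
    using assms(2) by (simp add: N pochhammer_of_nat_eq_0_iff)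
  then show ?thesis by (simp add: N)
qed

text \<open>
  Up to sign, the divided difference at the nodes \<open>l (l + \<omega>)\<close> with \<open>q \<le> l \<le> N\<close> of the Newton
  polynomial that vanishes at the uppermost \<open>r\<close> of them. Those nodes drop out, and the rest is
  \<open>alternating_sum\<close> with \<open>\<theta> = \<omega> + 2 q\<close>.
\<close>

lemma divided_difference_sum:
  fixes \<omega> :: real
  assumes \<omega>: "\<omega> > -1" and q: "q \<le> N" and r: "r \<le> N"
  shows "(\<Sum>l=q..N. (-1) ^ l * pochhammer (real l + \<omega>) q *
            (pochhammer (real l - real N) r * pochhammer (- real l - real N - \<omega>) r) /
            (fact (l - q) * fact (N - l) * (pochhammer (\<omega> + l) l * pochhammer (\<omega> + 2 * real l + 1) (N - l)))) =
         (if r = N - q then (-1) ^ q else 0)"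
    (is "(\<Sum>l=q..N. ?t l) = _")
proof (cases "r \<le> N - q")
  case False
  have "?t l = 0" if "l \<in> {q..N}" for l
  proof -
    have "pochhammer (real l - real N) r = 0"
      by (rule pochhammer_diff_eq_0) (use that False in auto)
    then show ?thesis by simp
  qed
  then have "(\<Sum>l=q..N. ?t l) = 0" by (intro sum.neutral ballI)
  then show ?thesis using False by simp
next
  case True
  define M where "M = N - q - r"
  define \<theta> where "\<theta> = \<omega> + 2 * real q"
  have N: "N = q + r + M" using True q by (simp add: M_def)
  have "(\<Sum>l=q..N. ?t l) = (\<Sum>l=q..q+M. ?t l)"
  proof (rule sum.mono_neutral_right)
    show "\<forall>l\<in>{q..N} - {q..q + M}. ?t l = 0"
    proof
      fix l assume l: "l \<in> {q..N} - {q..q + M}"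
      have "pochhammer (real l - real N) r = 0"
        by (rule pochhammer_diff_eq_0) (use l in \<open>auto simp: N\<close>)
      then show "?t l = 0" by simp
    qed
  qed (auto simp: N)
  also have "\<dots> = (\<Sum>i\<le>M. ?t (q + i))"
    by (rule sum.reindex_bij_witness[where i = "\<lambda>i. q + i" and j = "\<lambda>l. l - q"]) auto
  also have "\<dots> = (\<Sum>i\<le>M. (-1) ^ q * ((-1) ^ i / (fact i * fact (M - i) *
            (pochhammer (\<theta> + i) i * pochhammer (\<theta> + 2 * real i + 1) (M - i)))))"
  proof (rule sum.cong[OF refl])
    fix i assume i: "i \<in> {..M}"
    define d where "d = M - i"
    define l where "l = q + i"
    have M: "M = i + d" using i by (simp add: d_def)
    have Nl: "N = l + (d + r)" by (simp add: N M l_def)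
    have "real l - real N = - real (d + r)" by (simp add: Nl)
    then have 1: "pochhammer (real l - real N) r = (-1) ^ r * (fact (N - l) / fact d)"
      using pochhammer_neg_of_nat[of r "d + r"] by (simp add: Nl)
    have "- real l - real N - \<omega> = - (real l + real N + \<omega>)" by simp
    moreover have "real l + real N + \<omega> - real r + 1 = \<theta> + 2 * real i + 1 + real d"
      by (simp add: N \<theta>_def l_def M)
    ultimately have 2: "pochhammer (- real l - real N - \<omega>) r = (-1) ^ r * pochhammer (\<theta> + 2 * real i + 1 + real d) r"
      by (simp only: pochhammer_reflect)
    have 3: "pochhammer (\<omega> + 2 * real l + 1) (N - l) = pochhammer (\<theta> + 2 * real i + 1) d * pochhammer (\<theta> + 2 * real i + 1 + real d) r"
    proof -
      have "N - l = d + r" "\<omega> + 2 * real l + 1 = \<theta> + 2 * real i + 1" by (simp_all add: Nl \<theta>_def l_def)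
      then show ?thesis by (simp only: pochhammer_product')
    qed
    have 4: "pochhammer (\<omega> + real l) l = pochhammer (real l + \<omega>) q * pochhammer (\<theta> + real i) i"
    proof -
      have "\<omega> + real l + real q = \<theta> + real i" "\<omega> + real l = real l + \<omega>" by (simp_all add: \<theta>_def l_def)
      then show ?thesis using pochhammer_product'[of "\<omega> + real l" q i] by (simp only: l_def[symmetric])
    qed
    have 5: "pochhammer (real l + \<omega>) q \<noteq> 0"
    proof (cases q)
      case (Suc q')
      then have "real l + \<omega> > 0" using \<omega> by (simp add: l_def)
      then show ?thesis using pochhammer_pos[of "real l + \<omega>" q] by simp
    qed simp
    have 6: "pochhammer (\<theta> + 2 * real i + 1 + real d) r \<noteq> 0"
      using \<omega> pochhammer_pos[of "\<theta> + 2 * real i + 1 + real d" r] by (simp add: \<theta>_def)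
    have 7: "((-1::real) ^ r) * (-1) ^ r = 1" by (simp add: power_mult_distrib[symmetric])
    have "?t l = (-1) ^ l * (((-1) ^ r) * (-1) ^ r) * pochhammer (real l + \<omega>) q * (fact (N - l) / fact d) * pochhammer (\<theta> + 2 * real i + 1 + real d) r
       / (fact i * fact (N - l) * ((pochhammer (real l + \<omega>) q * pochhammer (\<theta> + real i) i) * (pochhammer (\<theta> + 2 * real i + 1) d * pochhammer (\<theta> + 2 * real i + 1 + real d) r)))"
      unfolding 1 2 3 4 by (simp add: l_def mult_ac)
    also have "\<dots> = (-1) ^ l / (fact i * fact d * (pochhammer (\<theta> + i) i * pochhammer (\<theta> + 2 * real i + 1) d))"
      unfolding 7 using 5 6 by simp
    finally show "?t (q + i) = (-1) ^ q * ((-1) ^ i / (fact i * fact (M - i) *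
            (pochhammer (\<theta> + i) i * pochhammer (\<theta> + 2 * real i + 1) (M - i))))"
      by (simp add: l_def d_def power_add)
  qed
  also have "\<dots> = (-1) ^ q * (if M = 0 then 1 else 0)"
    unfolding sum_distrib_left[symmetric]
    by (subst alternating_sum) (use \<omega> in \<open>auto simp: \<theta>_def\<close>)
  finally show ?thesis using True by (auto simp: M_def)
qed

text \<open>
  The restriction of \<open>swap_expansion\<close> to the plane \<open>x + y + z = 0\<close>, as an identity between the
  coefficients of \<open>x\<^sup>N\<^sup>-\<^sup>q y\<^sup>q\<close>. By \<open>sears_cleared\<close> the coefficient for \<open>l\<close> is a polynomial in
  \<open>l (l + \<omega>)\<close> in the Newton basis from above; the sum over \<open>l\<close> is its divided difference at
  the nodes \<open>l (l + \<omega>)\<close>, \<open>q \<le> l \<le> N\<close>, which retains the term of degree \<open>N - q\<close> only.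
\<close>

lemma antidiagonal_identity:
  fixes a b c :: real
  defines "\<sigma> \<equiv> a + b + c + 2"
  assumes abc: "a > -1" "b > -1" "c > -1" and j: "j \<le> N" and q: "q \<le> N"
  shows "(\<Sum>l\<le>N. swap_coeff N j a b c l * (pochhammer (real N + l + \<sigma>) (N - l) / fact (N - l)) *
            ((-1) ^ (l + q) * jacobi_coeff l c b q)) =
         pochhammer (real N + j + \<sigma>) (N - j) / fact (N - j) * ((-1) ^ (j + (N - q)) * jacobi_coeff j c a (N - q))"
proof -
  define \<omega> where "\<omega> = b + c + 1"
  define v where "v = real N + \<omega> + a + 1"
  have v\<sigma>: "v = real N + \<sigma>" by (simp add: v_def \<omega>_def \<sigma>_def)
  have nzb: "pochhammer (b + 1) k \<noteq> 0" "pochhammer (c + 1) k \<noteq> 0" for k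
    using abc by (auto intro!: pochhammer_nonzero)
  have nzv: "pochhammer v k \<noteq> 0" if "k \<le> N" for k
  proof (cases "N = 0")
    case False
    then have "v > 0" using abc by (simp add: v_def \<omega>_def)
    then show ?thesis by (rule pochhammer_nonzero)
  qed (use that in simp)
  have nz\<omega>: "pochhammer (\<omega> + real l) l \<noteq> 0" "pochhammer (\<omega> + 2 * real l + 1) (N - l) \<noteq> 0" for l
  proof -
    show "pochhammer (\<omega> + real l) l \<noteq> 0"
      using abc by (cases l) (auto simp: \<omega>_def intro!: pochhammer_nonzero)
    show "pochhammer (\<omega> + 2 * real l + 1) (N - l) \<noteq> 0"
      using abc by (auto simp: \<omega>_def intro!: pochhammer_nonzero)
  qed
  define X where "X r = (-1) ^ r * real (j choose r) * pochhammer (real j + a + c + 1) r *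
            pochhammer (a + 1 + real r) (j - r) * pochhammer (real r - real N - b) (j - r) / pochhammer (- real N) r" for r
  define D where "D l = (\<Sum>r\<le>j. X r * (pochhammer (real l - real N) r * pochhammer (- real l - real N - \<omega>) r))" for l :: nat
  define K where "K = (-1) ^ (N + j) * pochhammer (b + 1) (N - j) * fact N / fact j"
  \<comment> \<open>The symbols \<open>(v)\<^sub>l\<close> in the coefficient combine with the leading coefficient
  \<open>(N + l + \<sigma>)\<^sub>N\<^sub>-\<^sub>l\<close> to \<open>(v)\<^sub>N\<close>, which does not depend on \<open>l\<close>.\<close>
  define \<Lambda> where "\<Lambda> = pochhammer (real N + j + \<sigma>) (N - j) / fact (N - j)"
  have \<Lambda>: "pochhammer v N / (pochhammer v j * fact (N - j)) = \<Lambda>"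
    using pochhammer_product[of j N v] j nzv[of j] by (simp add: \<Lambda>_def v\<sigma> add_ac)
  have C: "swap_coeff N j a b c l * (pochhammer (real N + l + \<sigma>) (N - l) / fact (N - l)) =
      \<Lambda> * K * ((-1) ^ l * D l / (fact (N - l) * (pochhammer (b + 1) l * (pochhammer (\<omega> + l) l * pochhammer (\<omega> + 2 * real l + 1) (N - l)))))"
    if l: "l \<le> N" for l
  proof -
    have D: "(\<Sum>k\<le>j. (-1) ^ k * real (j choose k) * pochhammer (real j + a + c + 1) k *
            pochhammer (c + 1 + real k) (j - k) * pochhammer (v + real k) (j - k) *
            (pochhammer (- real l) k * pochhammer (real l + \<omega>) k / pochhammer (- real N) k)) = D l"
      using sears_cleared[OF j, of a c b "real l"] unfolding D_def X_def v_def \<omega>_def by (simp add: mult_ac)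
    define R where "R = cleared_4F3 l (real l + \<omega>) (- real j) (real j + a + c + 1) (c + 1) v (- real N)"
    have R: "pochhammer (c + 1) j * pochhammer v j * R = pochhammer (c + 1) l * pochhammer v l * pochhammer (- real N) l * D l"
      unfolding R_def by (subst cleared_4F3_change_clearing[OF j l nzb(2) nzv]) (simp_all only: D)
    have p: "pochhammer (real N + l + \<sigma>) (N - l) = pochhammer v N / pochhammer v l"
      using pochhammer_product[of l N v] l nzv[of l] by (simp add: v\<sigma> add_ac)
    define W where "W = pochhammer (\<omega> + l) l * pochhammer (\<omega> + 2 * real l + 1) (N - l)"
    have W: "W \<noteq> 0" using nz\<omega> by (simp add: W_def)
    have "swap_coeff N j a b c l * (pochhammer (real N + l + \<sigma>) (N - l) / fact (N - l)) =
       (-1) ^ (N + j) * pochhammer (b + 1) (N - j) / (fact (N - j) * fact j) *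
       (1 / (pochhammer (b + 1) l * pochhammer (c + 1) l * W)) * (pochhammer v N / (pochhammer v l * pochhammer v j)) *
       (pochhammer (c + 1) j * pochhammer v j * R)"
      using nzv[OF j] nzv[OF l] unfolding p
      by (simp add: swap_coeff_def Let_def \<omega>_def[symmetric] R_def v_def W_def mult_ac)
    also have "\<dots> = (-1) ^ (N + j) * pochhammer (b + 1) (N - j) / fact j *
       (1 / (pochhammer (b + 1) l * W)) * (pochhammer v N / (pochhammer v j * fact (N - j))) * pochhammer (- real N) l * D l"
      unfolding R using nzv[OF j] nzv[OF l] nzb(2)[of l] W by (simp add: mult_ac)
    also have "\<dots> = \<Lambda> * K * ((-1) ^ l * D l / (fact (N - l) * (pochhammer (b + 1) l * W)))"
      unfolding \<Lambda> using l by (simp add: pochhammer_neg_of_nat K_def mult_ac)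
    finally show ?thesis by (simp add: W_def)
  qed
  have "(\<Sum>l\<le>N. swap_coeff N j a b c l * (pochhammer (real N + l + \<sigma>) (N - l) / fact (N - l)) *
            ((-1) ^ (l + q) * jacobi_coeff l c b q)) =
     (\<Sum>l=q..N. swap_coeff N j a b c l * (pochhammer (real N + l + \<sigma>) (N - l) / fact (N - l)) *
            ((-1) ^ (l + q) * jacobi_coeff l c b q))"
    by (rule sum.mono_neutral_right) (auto simp: jacobi_coeff_def)
  also have "\<dots> = (\<Sum>l=q..N. \<Lambda> * K / (fact q * pochhammer (b + 1) q) * ((-1) ^ l * pochhammer (real l + \<omega>) q * D l /
       (fact (l - q) * fact (N - l) * (pochhammer (\<omega> + l) l * pochhammer (\<omega> + 2 * real l + 1) (N - l)))))"
  proof (rule sum.cong[OF refl])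
    fix l assume l: "l \<in> {q..N}"
    have "(-1) ^ (l + q) * jacobi_coeff l c b q = pochhammer (real l + \<omega>) q * pochhammer (b + 1 + real q) (l - q) / (fact q * fact (l - q))"
      using l by (simp add: jacobi_coeff_def \<omega>_def add_ac power_mult_distrib[symmetric])
    also have "pochhammer (b + 1 + real q) (l - q) = pochhammer (b + 1) l / pochhammer (b + 1) q"
      using l pochhammer_product[of q l "b + 1"] nzb(1)[of q] by simp
    finally show "swap_coeff N j a b c l * (pochhammer (real N + l + \<sigma>) (N - l) / fact (N - l)) *
            ((-1) ^ (l + q) * jacobi_coeff l c b q) = \<Lambda> * K / (fact q * pochhammer (b + 1) q) * ((-1) ^ l * pochhammer (real l + \<omega>) q * D l /
       (fact (l - q) * fact (N - l) * (pochhammer (\<omega> + l) l * pochhammer (\<omega> + 2 * real l + 1) (N - l))))"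
      using l nzb[of l] by (subst C) (simp_all add: mult_ac)
  qed
  also have "\<dots> = \<Lambda> * K / (fact q * pochhammer (b + 1) q) * (\<Sum>l=q..N. \<Sum>r\<le>j. X r * ((-1) ^ l * pochhammer (real l + \<omega>) q *
        (pochhammer (real l - real N) r * pochhammer (- real l - real N - \<omega>) r) /
       (fact (l - q) * fact (N - l) * (pochhammer (\<omega> + l) l * pochhammer (\<omega> + 2 * real l + 1) (N - l)))))"
    unfolding sum_distrib_left[symmetric]
    by (intro arg_cong2[of _ _ _ _ "(*)"] refl sum.cong) (simp_all add: D_def sum_distrib_left sum_divide_distrib mult_ac)
  also have "\<dots> = \<Lambda> * K / (fact q * pochhammer (b + 1) q) * (\<Sum>r\<le>j. X r * (if r = N - q then (-1) ^ q else 0))"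
    unfolding sum.swap[of _ "{..j}"] sum_distrib_left[symmetric]
  proof (rule arg_cong[of _ _ "(*) _"], rule sum.cong[OF refl], rule arg_cong[of _ _ "(*) _"])
    fix r assume "r \<in> {..j}"
    then have "r \<le> N" using j by simp
    moreover have "\<omega> > -1" using abc by (simp add: \<omega>_def)
    ultimately show "(\<Sum>l=q..N. (-1) ^ l * pochhammer (real l + \<omega>) q *
        (pochhammer (real l - real N) r * pochhammer (- real l - real N - \<omega>) r) /
       (fact (l - q) * fact (N - l) * (pochhammer (\<omega> + l) l * pochhammer (\<omega> + 2 * real l + 1) (N - l)))) =
       (if r = N - q then (-1) ^ q else 0)"
      using q by (intro divided_difference_sum)
  qed
  also have "(\<Sum>r\<le>j. X r * (if r = N - q then (-1) ^ q else 0)) = (if N - q \<le> j then X (N - q) * (-1) ^ q else 0)"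
    by (simp add: if_distrib[of "(*) _"] sum.delta cong: if_cong)
  also have "\<Lambda> * K / (fact q * pochhammer (b + 1) q) * \<dots> = \<Lambda> * ((-1) ^ (j + (N - q)) * jacobi_coeff j c a (N - q))"
  proof (cases "N - q \<le> j")
    case True
    define p where "p = N - q"
    have p: "p \<le> j" "N = q + p" using True q by (auto simp: p_def)
    define d where "d = j - p"
    have jd: "j = p + d" using p by (simp add: d_def)
    define e where "e = N - j"
    have qe: "q = e + d" using p j by (simp add: d_def e_def)
    have neg: "real p - real N - b = - (real N - p + b)" by simp
    have 1: "pochhammer (real p - real N - b) (j - p) = (-1) ^ d * pochhammer (b + 1 + real e) d"
    proof -
      have "real N - p + b - real (j - p) + 1 = b + 1 + real e" by (simp add: jd qe p(2))
      moreover have "j - p = d" by (simp add: jd)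
      ultimately show ?thesis unfolding neg by (simp only: pochhammer_reflect)
    qed
    have 2: "pochhammer (b + 1) q = pochhammer (b + 1) e * pochhammer (b + 1 + real e) d"
      by (simp add: qe pochhammer_product')
    have 3: "pochhammer (- real N) p = (-1) ^ p * fact N / fact q"
      by (subst pochhammer_neg_of_nat) (simp_all add: p(2))
    have 4: "real (j choose p) = fact j / (fact p * fact (j - p))" by (rule binomial_fact[OF p(1)])
    have 5: "pochhammer (b + 1) e \<noteq> 0" "pochhammer (b + 1 + real e) d \<noteq> 0"
      using abc by (auto intro!: pochhammer_nonzero)
    have "\<Lambda> * K / (fact q * pochhammer (b + 1) q) * (X p * (-1) ^ q)
       = \<Lambda> * ((-1) ^ (N + j) * (-1) ^ d * (-1) ^ q) * pochhammer (real j + a + c + 1) p *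
            pochhammer (a + 1 + real p) (j - p) / (fact p * fact (j - p))"
      unfolding K_def X_def 1 2 3 4 e_def[symmetric] using 5 by simp
    also have "((-1::real) ^ (N + j) * (-1) ^ d * (-1) ^ q) = 1"
    proof -
      have "N + j + d + q = 2 * (e + p + 2 * d)" by (simp add: jd p(2) qe)
      then show ?thesis unfolding power_add[symmetric] by (simp only: power_mult) simp
    qed
    also have "\<Lambda> * 1 * pochhammer (real j + a + c + 1) p *
            pochhammer (a + 1 + real p) (j - p) / (fact p * fact (j - p)) = \<Lambda> * ((-1) ^ (j + p) * jacobi_coeff j c a p)"
      using p by (simp add: jacobi_coeff_def power_mult_distrib[symmetric] add_ac)
    finally show ?thesis using True by (simp add: p_def)
  qed (simp add: jacobi_coeff_def)
  finally show ?thesis by (simp add: \<Lambda>_def)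
qed

section \<open>Homogeneous Jacobi polynomials\<close>

text \<open>
  The polynomial \<open>q\<^sup>m P\<^sub>m\<^sup>\<alpha>\<^sup>,\<^sup>\<beta> (2 y / q - 1)\<close>, written so that \<open>q = 0\<close> is allowed.
\<close>

definition jacobi_hom :: "nat \<Rightarrow> real \<Rightarrow> real \<Rightarrow> real \<Rightarrow> real \<Rightarrow> real" where
  "jacobi_hom m \<alpha> \<beta> y q =
     (\<Sum>k\<le>m. pochhammer (real m + \<alpha> + \<beta> + 1) k * pochhammer (\<alpha> + real k + 1) (m - k)
              / (fact k * fact (m - k)) * (y - q) ^ k * q ^ (m - k))"

text \<open>
  The Chu-Vandermonde identity after reflecting the second Pochhammer symbol.
\<close>

lemma chu_vandermonde_shifted:
  fixes x y :: real
  shows "(\<Sum>i\<le>M. (-1) ^ i * real (M choose i) * pochhammer x i * pochhammer (y + real i) (M - i)) = pochhammer (y - x) M"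
proof -
  have "(\<Sum>i\<le>M. (-1) ^ i * real (M choose i) * pochhammer x i * pochhammer (y + real i) (M - i)) =
     (\<Sum>i\<le>M. (-1) ^ M * (real (M choose i) * pochhammer x i * pochhammer (- (y + real M - 1)) (M - i)))"
  proof (rule sum.cong[OF refl])
    fix i assume i: "i \<in> {..M}"
    then have "y + real M - 1 - real (M - i) + 1 = y + real i" by (simp add: of_nat_diff)
    then have "pochhammer (- (y + real M - 1)) (M - i) = (-1) ^ (M - i) * pochhammer (y + real i) (M - i)"
      by (simp only: pochhammer_reflect)
    moreover have "(-1::real) ^ M * (-1) ^ (M - i) = (-1) ^ i" using i by (auto simp: uminus_power_if)
    ultimately show "(-1) ^ i * real (M choose i) * pochhammer x i * pochhammer (y + real i) (M - i) =
      (-1) ^ M * (real (M choose i) * pochhammer x i * pochhammer (- (y + real M - 1)) (M - i))"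
      by (simp add: mult_ac)
  qed
  also have "\<dots> = (-1) ^ M * pochhammer (x + - (y + real M - 1)) M"
    unfolding sum_distrib_left[symmetric] pochhammer_binomial_sum ..
  also have "x + - (y + real M - 1) = - (y - x + real M - 1)" by simp
  also have "(-1) ^ M * pochhammer (- (y - x + real M - 1)) M = pochhammer (y - x) M"
    unfolding pochhammer_reflect by (simp add: algebra_simps power_mult_distrib[symmetric])
  finally show ?thesis .
qed

text \<open>
  The expansion of the Jacobi polynomial at the other end point of the interval: expand
  \<open>(y - q)\<^sup>k\<close> and sum over \<open>k\<close> by Chu-Vandermonde.
\<close>

lemma jacobi_hom_monomials:
  "jacobi_hom m \<alpha> \<beta> y q = (\<Sum>r\<le>m. jacobi_coeff m \<alpha> \<beta> r * y ^ r * q ^ (m - r))"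
proof -
  define A where "A k = pochhammer (real m + \<alpha> + \<beta> + 1) k * pochhammer (\<alpha> + real k + 1) (m - k) / (fact k * fact (m - k))" for k
  have "jacobi_hom m \<alpha> \<beta> y q = (\<Sum>k\<le>m. \<Sum>r\<le>k. A k * real (k choose r) * y ^ r * (-1) ^ (k - r) * q ^ (m - r))"
    unfolding jacobi_hom_def
  proof (rule sum.cong[OF refl])
    fix k assume k: "k \<in> {..m}"
    have "(y - q) ^ k = (\<Sum>r\<le>k. real (k choose r) * y ^ r * (- q) ^ (k - r))"
      using binomial_ring[of y "- q" k] by simp
    then have "A k * (y - q) ^ k * q ^ (m - k) = (\<Sum>r\<le>k. A k * (real (k choose r) * y ^ r * (- q) ^ (k - r)) * q ^ (m - k))"
      by (simp add: sum_distrib_left sum_distrib_right)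
    also have "\<dots> = (\<Sum>r\<le>k. A k * real (k choose r) * y ^ r * (-1) ^ (k - r) * q ^ (m - r))"
    proof (rule sum.cong[OF refl])
      fix r assume r: "r \<in> {..k}"
      have "m - r = (k - r) + (m - k)" using k r by auto
      then show "A k * (real (k choose r) * y ^ r * (- q) ^ (k - r)) * q ^ (m - k)
        = A k * real (k choose r) * y ^ r * (-1) ^ (k - r) * q ^ (m - r)"
        by (simp add: power_add power_minus[of q])
    qed
    finally show "pochhammer (real m + \<alpha> + \<beta> + 1) k * pochhammer (\<alpha> + real k + 1) (m - k)
              / (fact k * fact (m - k)) * (y - q) ^ k * q ^ (m - k) =
       (\<Sum>r\<le>k. A k * real (k choose r) * y ^ r * (-1) ^ (k - r) * q ^ (m - r))"
      by (simp add: A_def)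
  qed
  also have "\<dots> = (\<Sum>r\<le>m. (\<Sum>i\<le>m - r. (-1) ^ i * A (r + i) * real ((r + i) choose r)) * y ^ r * q ^ (m - r))"
    unfolding sum_triangle_swap by (simp add: sum_distrib_left sum_distrib_right mult_ac)
  also have "\<dots> = (\<Sum>r\<le>m. jacobi_coeff m \<alpha> \<beta> r * y ^ r * q ^ (m - r))"
  proof (rule sum.cong[OF refl])
    fix r assume r: "r \<in> {..m}"
    define M where "M = m - r"
    have m: "m = r + M" using r by (simp add: M_def)
    define \<gamma> where "\<gamma> = real m + \<alpha> + \<beta> + 1"
    have "(\<Sum>i\<le>M. (-1) ^ i * A (r + i) * real ((r + i) choose r)) =
       (\<Sum>i\<le>M. pochhammer \<gamma> r / (fact r * fact M) * ((-1) ^ i * real (M choose i) * pochhammer (\<gamma> + r) i * pochhammer (\<alpha> + real r + 1 + real i) (M - i)))"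
    proof (rule sum.cong[OF refl])
      fix i assume i: "i \<in> {..M}"
      have 1: "real ((r + i) choose r) = fact (r + i) / (fact r * fact i)"
        by (subst binomial_fact) auto
      have 2: "real (M choose i) = fact M / (fact i * fact (M - i))"
        using i by (subst binomial_fact) auto
      show "(-1) ^ i * A (r + i) * real ((r + i) choose r) = pochhammer \<gamma> r / (fact r * fact M) * ((-1) ^ i * real (M choose i) * pochhammer (\<gamma> + r) i * pochhammer (\<alpha> + real r + 1 + real i) (M - i))"
        unfolding 1 2 A_def \<gamma>_def[symmetric] pochhammer_product'[of \<gamma> r i] by (simp add: m add_ac mult_ac)
    qed
    also have "\<dots> = pochhammer \<gamma> r / (fact r * fact M) * pochhammer (\<alpha> + real r + 1 - (\<gamma> + r)) M"
      unfolding sum_distrib_left[symmetric] chu_vandermonde_shifted ..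
    also have "\<alpha> + real r + 1 - (\<gamma> + r) = - (real m + \<beta>)" by (simp add: \<gamma>_def)
    also have "pochhammer (- (real m + \<beta>)) M = (-1) ^ M * pochhammer (\<beta> + 1 + real r) M"
    proof -
      have "real m + \<beta> - real M + 1 = \<beta> + 1 + real r" by (simp add: m)
      then show ?thesis by (simp only: pochhammer_reflect)
    qed
    also have "pochhammer \<gamma> r / (fact r * fact M) * \<dots> = jacobi_coeff m \<alpha> \<beta> r"
      using r by (simp add: jacobi_coeff_def \<gamma>_def m power_add power_mult_distrib[symmetric] mult_ac)
    finally show "(\<Sum>i\<le>m - r. (-1) ^ i * A (r + i) * real ((r + i) choose r)) * y ^ r * q ^ (m - r) = jacobi_coeff m \<alpha> \<beta> r * y ^ r * q ^ (m - r)"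
      by (simp add: M_def)
  qed
  finally show ?thesis .
qed

section \<open>Exchange of two variables\<close>

text \<open>
  The coefficient sequence of \<open>(1 - X)\<^sup>m g(X)\<close>, for \<open>g\<close> given by its coefficient sequence.
\<close>

primrec times_one_minus :: "nat \<Rightarrow> (nat \<Rightarrow> real) \<Rightarrow> nat \<Rightarrow> real" where
  "times_one_minus 0 g = g"
| "times_one_minus (Suc m) g = (\<lambda>p. times_one_minus m g p - (case p of 0 \<Rightarrow> 0 | Suc p' \<Rightarrow> times_one_minus m g p'))"

lemma times_one_minus_eq_0:
  assumes "\<And>p. p > k \<Longrightarrow> g p = 0" and "p > m + k"
  shows "times_one_minus m g p = 0"
  using assms(2) by (induction m arbitrary: p) (auto simp: assms(1) split: nat.split)

lemma times_one_minus_top: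
  assumes "\<And>p. p > k \<Longrightarrow> g p = 0"
  shows "times_one_minus m g (m + k) = (-1) ^ m * g k"
proof (induction m)
  case (Suc m)
  then show ?case using times_one_minus_eq_0[where m = m and k = k and g = g, OF assms] by simp
qed simp

lemma times_one_minus_eval:
  fixes x s :: real
  assumes "\<And>p. p > k \<Longrightarrow> g p = 0"
  shows "(\<Sum>p\<le>m + k. times_one_minus m g p * x ^ p * s ^ (m + k - p)) =
         (s - x) ^ m * (\<Sum>t\<le>k. g t * x ^ t * s ^ (k - t))"
proof (induction m)
  case (Suc m)
  define G where "G = times_one_minus m g"
  define n where "n = m + k"
  have z: "G (Suc n) = 0"
    unfolding G_def n_def by (rule times_one_minus_eq_0[OF assms]) auto
  have "(\<Sum>p\<le>Suc m + k. times_one_minus (Suc m) g p * x ^ p * s ^ (Suc m + k - p)) =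
    (\<Sum>p\<le>Suc n. G p * x ^ p * s ^ (Suc n - p)) - (\<Sum>p\<le>Suc n. (case p of 0 \<Rightarrow> 0 | Suc p' \<Rightarrow> G p') * x ^ p * s ^ (Suc n - p))"
    unfolding sum_subtractf[symmetric] n_def G_def
    by (rule sum.cong) (auto simp: left_diff_distrib split: nat.split)
  also have "(\<Sum>p\<le>Suc n. G p * x ^ p * s ^ (Suc n - p)) = s * (\<Sum>p\<le>n. G p * x ^ p * s ^ (n - p))"
    by (simp add: z sum_distrib_left Suc_diff_le mult_ac)
  also have "(\<Sum>p\<le>Suc n. (case p of 0 \<Rightarrow> 0 | Suc p' \<Rightarrow> G p') * x ^ p * s ^ (Suc n - p)) = x * (\<Sum>p\<le>n. G p * x ^ p * s ^ (n - p))"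
    by (subst sum.atMost_Suc_shift) (simp add: sum_distrib_left mult_ac)
  finally show ?case using Suc by (simp add: G_def n_def algebra_simps)
qed simp

lemma jacobi_coeff_rec:
  "(real r + 1) * (real r + 1 + \<beta>) * jacobi_coeff m \<alpha> \<beta> (Suc r) =
   - (real m - real r) * (real m + real r + \<alpha> + \<beta> + 1) * jacobi_coeff m \<alpha> \<beta> r"
proof (cases "r < m")
  case True
  then obtain d where m: "m = r + Suc d" using less_imp_Suc_add by auto
  have 1: "pochhammer (\<beta> + 1 + real r) (m - r) = (real r + 1 + \<beta>) * pochhammer (\<beta> + 1 + real (Suc r)) (m - Suc r)"
    by (simp add: m pochhammer_rec add_ac)
  have 2: "fact (m - r) = (real m - real r) * fact (m - Suc r)" by (simp add: m)
  have 3: "real m - real r \<noteq> 0" using True by simp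
  have alg: "(\<rho> + 1) * \<gamma> * (- S * (A * (\<kappa> + \<rho>)) * B / ((\<rho> + 1) * f * f')) = - e * (\<kappa> + \<rho>) * (S * A * (\<gamma> * B) / (f * (e * f')))"
    if "e \<noteq> 0" "\<rho> + 1 \<noteq> 0" for \<rho> \<gamma> \<kappa> S A B e f f' :: real
    using that by simp
  show ?thesis
    using alg[OF 3, of "real r" "real r + 1 + \<beta>" "(-1) ^ (m + r)" "pochhammer (real m + \<alpha> + \<beta> + 1) r" "real m + \<alpha> + \<beta> + 1"
      "pochhammer (\<beta> + 1 + real (Suc r)) (m - Suc r)" "fact r" "fact (m - Suc r)"] True
    unfolding jacobi_coeff_def 1 2 pochhammer_Suc[of _ r] fact_Suc by (simp add: add_ac)
next
  case False
  then show ?thesis by (cases "r = m") (auto simp: jacobi_coeff_def)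
qed

text \<open>
  The differential equation of \<open>(1 - X)\<^sup>m P(X)\<close>, where \<open>P\<close> satisfies the Jacobi equation, in terms of
  coefficients. Multiplication by one more factor \<open>1 - X\<close> turns the relation at \<open>p\<close> into the
  difference of the relations at \<open>p\<close> and \<open>p - 1\<close>.
\<close>

lemma times_one_minus_rec:
  fixes \<alpha> a :: real and k :: nat
  defines "g \<equiv> jacobi_coeff k \<alpha> a"
  shows "(real p + 1) * (real p + 1 + a) * times_one_minus m g (Suc p) -
         real m * (\<alpha> - real m) * times_one_minus (m - 1) g p +
         (real k + real m - real p) * (real k + real p - real m + \<alpha> + a + 1) * times_one_minus m g p = 0"
proof (induction m arbitrary: p)
  case 0
  show ?case using jacobi_coeff_rec[of p a k \<alpha>] by (simp add: g_def algebra_simps)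
next
  case (Suc m)
  define G where "G = times_one_minus m g"
  have IH: "(real p + 1) * (real p + 1 + a) * G (Suc p) - real m * (\<alpha> - real m) * times_one_minus (m - 1) g p +
         (real k + real m - real p) * (real k + real p - real m + \<alpha> + a + 1) * G p = 0" for p
    using Suc by (simp add: G_def)
  show ?case
  proof (cases p)
    case 0
    have "real m * times_one_minus (m - 1) g 0 = real m * G 0"
      by (cases m) (simp_all add: G_def)
    then have e: "real m * (\<alpha> - real m) * times_one_minus (m - 1) g 0 = real m * (\<alpha> - real m) * G 0"
      by (metis mult.assoc mult.commute)
    show ?thesis using IH[of 0] unfolding e
      by (simp add: 0 G_def[symmetric] algebra_simps)
  next
    case (Suc p')
    have "real m * (times_one_minus (m - 1) g (Suc p') - times_one_minus (m - 1) g p') = real m * G (Suc p')"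
      by (cases m) (simp_all add: G_def)
    then have e: "real m * (\<alpha> - real m) * times_one_minus (m - 1) g (Suc p') = real m * (\<alpha> - real m) * times_one_minus (m - 1) g p' + real m * (\<alpha> - real m) * G (Suc p')"
      by (simp add: algebra_simps)
    show ?thesis using IH[of p'] IH[of "Suc p'"] unfolding e
      by (simp add: Suc G_def[symmetric] algebra_simps)
  qed
qed

text \<open>
  Let \<open>F p q\<close> be the coefficient of \<open>x\<^sup>p y\<^sup>q s\<^sup>N\<^sup>-\<^sup>p\<^sup>-\<^sup>q\<close> in a homogeneous polynomial of degree \<open>N\<close> in
  \<open>x, y, z\<close>, where \<open>s = x + y + z\<close>. The residual is then the coefficient of \<open>x\<^sup>p y\<^sup>q s\<^sup>N\<^sup>-\<^sup>1\<^sup>-\<^sup>p\<^sup>-\<^sup>q\<close>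
  in the image of this polynomial under the sum of the operators \<open>x \<partial>\<^sub>x\<^sup>2 + (a + 1) \<partial>\<^sub>x\<close>,
  \<open>y \<partial>\<^sub>y\<^sup>2 + (b + 1) \<partial>\<^sub>y\<close> and \<open>z \<partial>\<^sub>z\<^sup>2 + (c + 1) \<partial>\<^sub>z\<close>.
\<close>

definition harmonic_residual :: "nat \<Rightarrow> real \<Rightarrow> real \<Rightarrow> real \<Rightarrow> (nat \<Rightarrow> nat \<Rightarrow> real) \<Rightarrow> nat \<Rightarrow> nat \<Rightarrow> real" where
  "harmonic_residual N a b c F p q =
     (real p + 1) * (real p + 1 + a) * F (Suc p) q + (real q + 1) * (real q + 1 + b) * F p (Suc q) +
     (real N - real p - real q) * (real N + real p + real q + a + b + c + 2) * F p q"

definition harmonic_coeffs :: "nat \<Rightarrow> real \<Rightarrow> real \<Rightarrow> real \<Rightarrow> (nat \<Rightarrow> nat \<Rightarrow> real) \<Rightarrow> bool" where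
  "harmonic_coeffs N a b c F \<longleftrightarrow> (\<forall>p q. p + q < N \<longrightarrow> harmonic_residual N a b c F p q = 0)"

text \<open>
  The factor of \<open>F p q\<close> in the residual is not zero for \<open>p + q < N\<close>, so the coefficients follow from
  those with \<open>p + q = N\<close>, which are the restriction of the polynomial to \<open>x + y + z = 0\<close>.
\<close>

lemma harmonic_coeffs_unique:
  assumes "harmonic_coeffs N a b c F" "harmonic_coeffs N a b c G"
    and "a + b + c > -3" and "\<And>q. q \<le> N \<Longrightarrow> F (N - q) q = G (N - q) q" and "p + q \<le> N"
  shows "F p q = G p q"
  using assms(5)
proof (induction "N - (p + q)" arbitrary: p q)
  case 0
  then have "p = N - q" "q \<le> N" by auto
  then show ?case using assms(4) by simp
next
  case (Suc d)
  then have less: "p + q < N" by auto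
  have IH: "F (Suc p) q = G (Suc p) q" "F p (Suc q) = G p (Suc q)"
    using Suc by auto
  have "(real N - real p - real q) * (real N + real p + real q + a + b + c + 2) * F p q =
        (real N - real p - real q) * (real N + real p + real q + a + b + c + 2) * G p q"
    using assms(1,2) less IH unfolding harmonic_coeffs_def harmonic_residual_def by smt
  moreover have "real N - real p - real q \<noteq> 0" "real N + real p + real q + a + b + c + 2 \<noteq> 0"
    using less assms(3) by auto
  ultimately show ?case by simp
qed

lemma harmonic_coeffs_sum:
  assumes "\<And>l. l \<in> A \<Longrightarrow> harmonic_coeffs N a b c (F l)"
  shows "harmonic_coeffs N a b c (\<lambda>p q. \<Sum>l\<in>A. C l * F l p q)"
  unfolding harmonic_coeffs_def
proof (intro allI impI)
  fix p q assume pq: "p + q < N"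
  have "harmonic_residual N a b c (\<lambda>p q. \<Sum>l\<in>A. C l * F l p q) p q = (\<Sum>l\<in>A. C l * harmonic_residual N a b c (F l) p q)"
    unfolding harmonic_residual_def sum_distrib_left sum.distrib[symmetric]
    by (rule sum.cong) (simp_all only: ring_distribs mult_ac)
  also have "\<dots> = 0" using assms pq by (simp add: harmonic_coeffs_def)
  finally show "harmonic_residual N a b c (\<lambda>p q. \<Sum>l\<in>A. C l * F l p q) p q = 0" .
qed

text \<open>
  The coefficients, in the sense of \<open>harmonic_residual\<close>, of the \<open>l\<close>-th product on the right-hand side
  of \<open>swap_expansion\<close> (see \<open>triangle_coeffs_eval\<close>).
\<close>

definition triangle_coeffs :: "nat \<Rightarrow> nat \<Rightarrow> real \<Rightarrow> real \<Rightarrow> real \<Rightarrow> nat \<Rightarrow> nat \<Rightarrow> real" where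
  "triangle_coeffs N l a b c p q =
     jacobi_coeff l c b q * times_one_minus (l - q) (jacobi_coeff (N - l) (b + c + 2 * real l + 1) a) p"

text \<open>
  The recurrence of \<open>jacobi_coeff\<close> in \<open>q\<close> turns the term with \<open>F p (q + 1)\<close> into a multiple of the
  coefficient for \<open>q\<close>; what is left is \<open>times_one_minus_rec\<close> with \<open>m = l - q\<close>.
\<close>

lemma triangle_coeffs_harmonic:
  assumes "l \<le> N"
  shows "harmonic_coeffs N a b c (triangle_coeffs N l a b c)"
  unfolding harmonic_coeffs_def
proof (intro allI impI)
  fix p q assume "p + q < N"
  define \<alpha> where "\<alpha> = b + c + 2 * real l + 1"
  define g where "g = jacobi_coeff (N - l) \<alpha> a"
  define J where "J = jacobi_coeff l c b"
  have R: "harmonic_residual N a b c (triangle_coeffs N l a b c) p q =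
     (real p + 1) * (real p + 1 + a) * (J q * times_one_minus (l - q) g (Suc p))
     + (real q + 1) * (real q + 1 + b) * (J (Suc q) * times_one_minus (l - Suc q) g p) +
     (real N - real p - real q) * (real N + real p + real q + a + b + c + 2) * (J q * times_one_minus (l - q) g p)"
    by (simp only: harmonic_residual_def triangle_coeffs_def J_def g_def \<alpha>_def)
  show "harmonic_residual N a b c (triangle_coeffs N l a b c) p q = 0"
  proof (cases "q \<le> l")
    case True
    define m where "m = l - q"
    have m: "real m = real l - real q" "l - Suc q = m - 1" using True by (auto simp: m_def)
    have J: "(real q + 1) * (real q + 1 + b) * J (Suc q) = - (real l - real q) * (real l + real q + c + b + 1) * J q"
      unfolding J_def by (rule jacobi_coeff_rec)
    have "harmonic_residual N a b c (triangle_coeffs N l a b c) p q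
     = (real p + 1) * (real p + 1 + a) * (J q * times_one_minus m g (Suc p))
     + ((real q + 1) * (real q + 1 + b) * J (Suc q)) * times_one_minus (m - 1) g p +
     (real N - real p - real q) * (real N + real p + real q + a + b + c + 2) * (J q * times_one_minus m g p)"
      unfolding R m(2) m_def[symmetric] by (simp add: mult_ac)
    also have "\<dots> = J q * ((real p + 1) * (real p + 1 + a) * times_one_minus m g (Suc p) -
         real m * (\<alpha> - real m) * times_one_minus (m - 1) g p +
         (real (N - l) + real m - real p) * (real (N - l) + real p - real m + \<alpha> + a + 1) * times_one_minus m g p)"
      unfolding J using assms by (simp add: m(1) \<alpha>_def of_nat_diff) (simp add: algebra_simps)
    also have "\<dots> = 0" unfolding g_def by (subst times_one_minus_rec) simp
    finally show ?thesis .
  qed (simp add: R J_def jacobi_coeff_def)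
qed

lemma triangle_coeffs_top:
  assumes "l \<le> N" "q \<le> N"
  shows "triangle_coeffs N l a b c (N - q) q =
    pochhammer (real N + real l + (a + b + c + 2)) (N - l) / fact (N - l) * ((-1) ^ (l + q) * jacobi_coeff l c b q)"
proof (cases "q \<le> l")
  case True
  have e: "N - q = (l - q) + (N - l)" using True assms by simp
  define \<alpha> where "\<alpha> = b + c + 2 * real l + 1"
  have "times_one_minus (l - q) (jacobi_coeff (N - l) \<alpha> a) (N - q) = (-1) ^ (l - q) * jacobi_coeff (N - l) \<alpha> a (N - l)"
    unfolding e by (rule times_one_minus_top) (simp add: jacobi_coeff_def)
  moreover have "jacobi_coeff (N - l) \<alpha> a (N - l) = pochhammer (real N + real l + (a + b + c + 2)) (N - l) / fact (N - l)"
    using assms by (simp add: jacobi_coeff_def \<alpha>_def of_nat_diff power_mult_distrib[symmetric] flip: mult_2) (simp add: algebra_simps)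
  moreover have "(-1::real) ^ (l - q) = (-1) ^ (l + q)" using True by (auto simp: uminus_power_if)
  ultimately show ?thesis by (simp add: triangle_coeffs_def \<alpha>_def)
qed (simp add: triangle_coeffs_def jacobi_coeff_def)

lemma triangle_coeffs_eval:
  assumes "l \<le> N"
  shows "jacobi_hom l c b y (s - x) * jacobi_hom (N - l) (b + c + 2 * real l + 1) a x s =
    (\<Sum>q\<le>N. \<Sum>p\<le>N - q. triangle_coeffs N l a b c p q * x ^ p * y ^ q * s ^ (N - q - p))"
proof -
  define g where "g = jacobi_coeff (N - l) (b + c + 2 * real l + 1) a"
  have "(\<Sum>q\<le>N. \<Sum>p\<le>N - q. triangle_coeffs N l a b c p q * x ^ p * y ^ q * s ^ (N - q - p)) =
        (\<Sum>q\<le>l. \<Sum>p\<le>N - q. triangle_coeffs N l a b c p q * x ^ p * y ^ q * s ^ (N - q - p))"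
    by (rule sum.mono_neutral_right) (use assms in \<open>auto simp: triangle_coeffs_def jacobi_coeff_def\<close>)
  also have "\<dots> = (\<Sum>q\<le>l. jacobi_coeff l c b q * y ^ q * (s - x) ^ (l - q) * jacobi_hom (N - l) (b + c + 2 * real l + 1) a x s)"
  proof (rule sum.cong[OF refl])
    fix q assume q: "q \<in> {..l}"
    have e: "N - q = (l - q) + (N - l)" using q assms by auto
    have "(\<Sum>p\<le>N - q. times_one_minus (l - q) g p * x ^ p * s ^ (N - q - p)) =
       (s - x) ^ (l - q) * (\<Sum>t\<le>N - l. g t * x ^ t * s ^ (N - l - t))"
      unfolding e by (rule times_one_minus_eval) (simp add: g_def jacobi_coeff_def)
    moreover have "(\<Sum>p\<le>N - q. triangle_coeffs N l a b c p q * x ^ p * y ^ q * s ^ (N - q - p)) =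
      jacobi_coeff l c b q * y ^ q * (\<Sum>p\<le>N - q. times_one_minus (l - q) g p * x ^ p * s ^ (N - q - p))"
      unfolding sum_distrib_left by (rule sum.cong) (simp_all add: triangle_coeffs_def g_def mult_ac)
    ultimately show "(\<Sum>p\<le>N - q. triangle_coeffs N l a b c p q * x ^ p * y ^ q * s ^ (N - q - p)) =
      jacobi_coeff l c b q * y ^ q * (s - x) ^ (l - q) * jacobi_hom (N - l) (b + c + 2 * real l + 1) a x s"
      unfolding jacobi_hom_monomials g_def[symmetric] by (simp only: mult.assoc)
  qed
  also have "\<dots> = jacobi_hom l c b y (s - x) * jacobi_hom (N - l) (b + c + 2 * real l + 1) a x s"
    by (simp add: jacobi_hom_monomials[of l] sum_distrib_right)
  finally show ?thesis by simp
qed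

text \<open>
  Exchange of the variables \<open>x\<close> and \<open>y\<close>, with their parameters, in a product of two homogeneous
  Jacobi polynomials attached to the chain \<open>{x,z} \<subset> {x,y,z}\<close>. The condition \<open>harmonic_coeffs\<close> is
  symmetric under the exchange, so both sides satisfy it, and by \<open>harmonic_coeffs_unique\<close> they need
  to be compared on \<open>x + y + z = 0\<close> only, where the claim is \<open>antidiagonal_identity\<close>.
\<close>

theorem swap_expansion:
  fixes a b c x y z :: real
  assumes abc: "a > -1" "b > -1" "c > -1" and j: "j \<le> N"
  shows "jacobi_hom j c a x (x + z) * jacobi_hom (N - j) (a + c + 2 * real j + 1) b y (x + y + z) =
    (\<Sum>l\<le>N. swap_coeff N j a b c l *
       (jacobi_hom l c b y (y + z) * jacobi_hom (N - l) (b + c + 2 * real l + 1) a x (x + y + z)))"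
proof -
  define s where "s = x + y + z"
  define F where "F p q = (\<Sum>l\<le>N. swap_coeff N j a b c l * triangle_coeffs N l a b c p q)" for p q
  define G where "G p q = triangle_coeffs N j b a c q p" for p q
  have F: "harmonic_coeffs N a b c F"
    unfolding F_def by (rule harmonic_coeffs_sum) (auto intro: triangle_coeffs_harmonic)
  \<comment> \<open>The left-hand side has the coefficients of the right-hand kind with \<open>a\<close>, \<open>b\<close> and the two
  indices exchanged.\<close>
  have "harmonic_coeffs N b a c (triangle_coeffs N j b a c)" by (rule triangle_coeffs_harmonic[OF j])
  then have G: "harmonic_coeffs N a b c G"
    unfolding G_def harmonic_coeffs_def harmonic_residual_def
    by (smt (verit) add.commute add.left_commute add.assoc diff_diff_eq)
  have top: "F (N - q) q = G (N - q) q" if q: "q \<le> N" for q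
  proof -
    have "F (N - q) q = (\<Sum>l\<le>N. swap_coeff N j a b c l * (pochhammer (real N + l + (a + b + c + 2)) (N - l) / fact (N - l)) *
            ((-1) ^ (l + q) * jacobi_coeff l c b q))"
      unfolding F_def by (rule sum.cong) (simp_all add: triangle_coeffs_top q mult_ac)
    also have "\<dots> = pochhammer (real N + j + (a + b + c + 2)) (N - j) / fact (N - j) * ((-1) ^ (j + (N - q)) * jacobi_coeff j c a (N - q))"
      by (rule antidiagonal_identity[OF abc j q])
    also have "\<dots> = G (N - q) q"
      using triangle_coeffs_top[OF j, of "N - q" b a c] q by (simp add: G_def add_ac)
    finally show ?thesis .
  qed
  have eq: "F p q = G p q" if "p + q \<le> N" for p q
    by (rule harmonic_coeffs_unique[OF F G _ top that]) (use abc in simp)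
  have "jacobi_hom j c a x (x + z) * jacobi_hom (N - j) (a + c + 2 * real j + 1) b y s =
     (\<Sum>p\<le>N. \<Sum>q\<le>N - p. G p q * y ^ q * x ^ p * s ^ (N - p - q))"
    using triangle_coeffs_eval[OF j, of c a x s y b] by (simp add: G_def s_def add_ac)
  also have "\<dots> = (\<Sum>q\<le>N. \<Sum>p\<le>N - q. G p q * y ^ q * x ^ p * s ^ (N - p - q))"
    unfolding sum.Sigma[OF finite_atMost ballI[OF finite_atMost]]
    by (rule sum.reindex_bij_witness[where i = "\<lambda>(p, q). (q, p)" and j = "\<lambda>(p, q). (q, p)"]) auto
  also have "\<dots> = (\<Sum>q\<le>N. \<Sum>p\<le>N - q. \<Sum>l\<le>N. swap_coeff N j a b c l * (triangle_coeffs N l a b c p q * x ^ p * y ^ q * s ^ (N - q - p)))"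
    by (intro sum.cong refl) (auto simp: eq[symmetric] F_def sum_distrib_left sum_distrib_right mult_ac add.commute)
  also have "\<dots> = (\<Sum>l\<le>N. \<Sum>q\<le>N. \<Sum>p\<le>N - q. swap_coeff N j a b c l * (triangle_coeffs N l a b c p q * x ^ p * y ^ q * s ^ (N - q - p)))"
    by (subst sum.swap[of _ "{..N}" "{..N}"], rule sum.cong[OF refl], rule sum.swap)
  also have "\<dots> = (\<Sum>l\<le>N. swap_coeff N j a b c l *
       (jacobi_hom l c b y (s - x) * jacobi_hom (N - l) (b + c + 2 * real l + 1) a x s))"
    by (intro sum.cong refl) (simp add: triangle_coeffs_eval sum_distrib_left)
  finally show ?thesis by (simp add: s_def)
qed

section \<open>Cyclic permutation of three variables\<close>

text \<open>
  The Jacobi polynomial on the simplex as a homogeneous polynomial in \<open>x\<^sub>1, \<dots>, x\<^sub>4\<close>; permutations of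
  the variables then act without the relation \<open>x\<^sub>4 = 1 - |x|\<close>.
\<close>

definition simplex_hom :: "(nat \<Rightarrow> nat) \<Rightarrow> (nat \<Rightarrow> real) \<Rightarrow> (nat \<Rightarrow> real) \<Rightarrow> real" where
  "simplex_hom \<nu> \<kappa> x =
     jacobi_hom (\<nu> 3) (\<kappa> 4) (\<kappa> 3) (x 3) (x 3 + x 4) *
     jacobi_hom (\<nu> 2) (\<kappa> 3 + \<kappa> 4 + 2 * real (\<nu> 3) + 1) (\<kappa> 2) (x 2) (x 2 + x 3 + x 4) *
     jacobi_hom (\<nu> 1) (\<kappa> 2 + \<kappa> 3 + \<kappa> 4 + 2 * real (\<nu> 2) + 2 * real (\<nu> 3) + 2) (\<kappa> 1) (x 1) (x 1 + x 2 + x 3 + x 4)"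

text \<open>
  For \<open>q = y = 0\<close> both sides are \<open>0\<close> if \<open>m > 0\<close> and \<open>1\<close> if \<open>m = 0\<close>.
\<close>

lemma jacobi_hom_eq_jacobi:
  assumes "q = 0 \<Longrightarrow> y = 0"
  shows "q ^ m * jacobi m \<alpha> \<beta> (2 * y / q - 1) = jacobi_hom m \<alpha> \<beta> y q"
proof (cases "q = 0")
  case True
  with assms have "y = 0" by simp
  have "pochhammer (real m + \<alpha> + \<beta> + 1) k * pochhammer (\<alpha> + real k + 1) (m - k) / (fact k * fact (m - k)) * (0::real) ^ k * 0 ^ (m - k) = 0"
    if "m > 0" for k
    using that by (cases "k = 0") auto
  then have "jacobi_hom m \<alpha> \<beta> 0 0 = 0" if "m > 0"
    using that unfolding jacobi_hom_def by (intro sum.neutral ballI) simp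
  with True \<open>y = 0\<close> show ?thesis
    by (cases "m = 0") (simp_all add: jacobi_def jacobi_hom_def)
next
  case False
  have e: "(2 * y / q - 1 - 1) / 2 = (y - q) / q" using False by (simp add: field_simps)
  show ?thesis
    unfolding jacobi_def e unfolding jacobi_hom_def sum_distrib_left
    by (intro sum.cong refl) (use False in \<open>simp add: power_divide power_diff\<close>)
qed

lemma sum_nat_3: "(\<Sum>i=1..3. f i) = f 1 + f 2 + f (3::nat)" "(\<Sum>i=Suc 0..3. f i) = f 1 + f 2 + f (3::nat)"
  by (simp_all add: numeral_3_eq_3 add_ac numeral_2_eq_2)

lemma prod_nat_3: "(\<Prod>i=1..3. f i) = f 1 * f 2 * f (3::nat)"
  by (simp add: numeral_3_eq_3 mult_ac numeral_2_eq_2)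

lemma sum_nat_intervals:
  "(\<Sum>i=1..4. f i) = f 1 + f 2 + f 3 + f (4::nat)" "(\<Sum>i=1..<1. f i) = 0" "(\<Sum>i=1..<2. f i) = f 1" "(\<Sum>i=1..<3. f i) = f 1 + f 2"
  "(\<Sum>i=2..3. f i) = f 2 + f 3" "(\<Sum>i=2..4. f i) = f 2 + f 3 + f 4" "(\<Sum>i=3..3. f i) = f 3" "(\<Sum>i=3..4. f i) = f 3 + f 4"
  "(\<Sum>i=4..4. f i) = f 4" "(\<Sum>i=4..3. f i) = 0"
  by (simp_all add: numeral_eq_Suc atLeastLessThanSuc add_ac)

lemma simplex_jacobi_hom:
  assumes "x \<in> simplex_set 3"
  shows "simplex_jacobi 3 \<nu> \<kappa> x = simplex_hom \<nu> \<kappa> (x(4 := 1 - (\<Sum>i=1..3. x i)))"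
proof -
  have x: "x 1 \<ge> 0" "x 2 \<ge> 0" "x 3 \<ge> 0" "x 1 + x 2 + x 3 \<le> 1"
    using assms by (auto simp: simplex_set_def sum_nat_3)
  have 1: "1 ^ \<nu> 1 * jacobi (\<nu> 1) \<alpha> \<beta> (2 * x 1 / 1 - 1) = jacobi_hom (\<nu> 1) \<alpha> \<beta> (x 1) 1" for \<alpha> \<beta>
    by (rule jacobi_hom_eq_jacobi) simp
  have 2: "(1 - x 1) ^ \<nu> 2 * jacobi (\<nu> 2) \<alpha> \<beta> (2 * x 2 / (1 - x 1) - 1) = jacobi_hom (\<nu> 2) \<alpha> \<beta> (x 2) (1 - x 1)" for \<alpha> \<beta>
    by (rule jacobi_hom_eq_jacobi) (use x in simp)
  have 3: "(1 - (x 1 + x 2)) ^ \<nu> 3 * jacobi (\<nu> 3) \<alpha> \<beta> (2 * x 3 / (1 - (x 1 + x 2)) - 1) = jacobi_hom (\<nu> 3) \<alpha> \<beta> (x 3) (1 - (x 1 + x 2))" for \<alpha> \<beta>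
    by (rule jacobi_hom_eq_jacobi) (use x in simp)
  show ?thesis
    using 1 2 3
    by (simp add: simplex_jacobi_def prod_nat_3 sum_nat_intervals sum_nat_3 simplex_hom_def algebra_simps del: One_nat_def)
qed

lemma atLeastAtMost_3_cases: "i \<in> {1..3} \<Longrightarrow> i = 1 \<or> i = 2 \<or> i = (3::nat)"
  unfolding atLeastAtMost_iff by presburger

lemma prod_nat_4: "(\<Prod>i=1..4. f i) = f 1 * f 2 * f 3 * f (4::nat)"
  by (simp add: numeral_eq_Suc mult_ac)

definition index3 :: "nat \<Rightarrow> nat \<Rightarrow> nat \<Rightarrow> nat \<Rightarrow> nat" where
  "index3 a b c = (\<lambda>_. 0)(1 := a, 2 := b, 3 := c)"

lemma index3_simps [simp]: "index3 a b c 1 = a" "index3 a b c (Suc 0) = a" "index3 a b c 2 = b" "index3 a b c 3 = c"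
  by (simp_all add: index3_def)

lemma index3_in [simp]: "index3 a b c \<in> multi_index 3 n \<longleftrightarrow> a + b + c = n"
proof -
  have "index3 a b c i = 0" if "i \<notin> {1..3}" for i
    using that by (auto simp: index3_def)
  then show ?thesis by (auto simp: multi_index_def sum_nat_3)
qed

lemma multi_index_eq_index3:
  assumes "\<mu> \<in> multi_index 3 n"
  shows "\<mu> = index3 (\<mu> 1) (\<mu> 2) (\<mu> 3)"
proof
  fix i
  show "\<mu> i = index3 (\<mu> 1) (\<mu> 2) (\<mu> 3) i"
  proof (cases "i \<in> {1..3}")
    case True
    then have "i = 1 \<or> i = 2 \<or> i = 3" by (rule atLeastAtMost_3_cases)
    then show ?thesis by auto
  next
    case False
    then show ?thesis using assms by (auto simp: multi_index_def index3_def)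
  qed
qed

lemma multi_index3_sum: "\<nu> \<in> multi_index 3 n \<Longrightarrow> \<nu> 1 + \<nu> 2 + \<nu> 3 = n"
  by (auto simp: multi_index_def sum_nat_3)

lemma sum_multi_index3:
  "(\<Sum>\<mu>\<in>multi_index 3 n. f \<mu>) = (\<Sum>s\<le>n. \<Sum>l\<le>n - s. f (index3 (n - s - l) l s))"
  unfolding sum.Sigma[OF finite_atMost ballI[OF finite_atMost]]
proof (rule sum.reindex_bij_witness[where i = "\<lambda>(s, l). index3 (n - s - l) l s" and j = "\<lambda>\<mu>. (\<mu> 3, \<mu> 2)"])
  fix \<mu> assume \<mu>: "\<mu> \<in> multi_index 3 n"
  then have n: "\<mu> 1 + \<mu> 2 + \<mu> 3 = n" by (rule multi_index3_sum)
  then have "n - \<mu> 3 - \<mu> 2 = \<mu> 1" by simp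
  then have e: "index3 (n - \<mu> 3 - \<mu> 2) (\<mu> 2) (\<mu> 3) = \<mu>"
    using multi_index_eq_index3[OF \<mu>] by metis
  show "(case (\<mu> 3, \<mu> 2) of (s, l) \<Rightarrow> index3 (n - s - l) l s) = \<mu>" using e by simp
  show "(case (\<mu> 3, \<mu> 2) of (s, l) \<Rightarrow> f (index3 (n - s - l) l s)) = f \<mu>" using e by simp
  show "(\<mu> 3, \<mu> 2) \<in> (SIGMA s:{..n}. {..n - s})" using n by auto
qed auto

lemma finite_multi_index3: "finite (multi_index 3 n)"
proof (rule finite_subset)
  show "multi_index 3 n \<subseteq> (\<lambda>(a, b, c). index3 a b c) ` ({..n} \<times> {..n} \<times> {..n})"
  proof
    fix \<mu> assume \<mu>: "\<mu> \<in> multi_index 3 n"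
    then have "\<mu> 1 + \<mu> 2 + \<mu> 3 = n" by (rule multi_index3_sum)
    then show "\<mu> \<in> (\<lambda>(a, b, c). index3 a b c) ` ({..n} \<times> {..n} \<times> {..n})"
      using multi_index_eq_index3[OF \<mu>] by (intro image_eqI[of _ _ "(\<mu> 1, \<mu> 2, \<mu> 3)"]) auto
  qed
qed simp

definition cyc123 :: "nat \<Rightarrow> nat" where "cyc123 = cycle_of_list [1, 2, 3]"
definition cyc132 :: "nat \<Rightarrow> nat" where "cyc132 = cycle_of_list [1, 3, 2]"

lemma cyc123_simps [simp]: "cyc123 1 = 2" "cyc123 (Suc 0) = 2" "cyc123 2 = 3" "cyc123 3 = 1" "cyc123 4 = 4"
  by (auto simp: cyc123_def transpose_def)

lemma cyc132_simps [simp]: "cyc132 1 = 3" "cyc132 (Suc 0) = 3" "cyc132 2 = 1" "cyc132 3 = 2" "cyc132 4 = 4"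
  by (auto simp: cyc132_def transpose_def)

definition admissible :: "(nat \<Rightarrow> real) \<Rightarrow> bool" where
  "admissible \<kappa> \<longleftrightarrow> \<kappa> 1 > -1 \<and> \<kappa> 2 > -1 \<and> \<kappa> 3 > -1 \<and> \<kappa> 4 > -1"

lemma admissibleD:
  assumes "admissible \<kappa>"
  shows "\<kappa> 1 > -1" "\<kappa> 2 > -1" "\<kappa> 3 > -1" "\<kappa> 4 > -1"
  using assms by (simp_all add: admissible_def)

lemma admissible_cyc [simp]:
  "admissible (\<kappa> \<circ> cyc123) \<longleftrightarrow> admissible \<kappa>" "admissible (\<kappa> \<circ> cyc132) \<longleftrightarrow> admissible \<kappa>"
  by (auto simp: admissible_def)

text \<open>
  The connection coefficient as the product of the coefficients of two exchanges. The middle chain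
  \<open>{3,4} \<subset> {1,3,4} \<subset> {1,2,3,4}\<close> carries the degrees \<open>\<mu>\<^sub>3\<close>, \<open>\<nu>\<^sub>2 + \<nu>\<^sub>3 - \<mu>\<^sub>3\<close>, \<open>\<nu>\<^sub>1\<close> from
  its smallest set to its largest. The second exchange treats \<open>x\<^sub>3\<close> and \<open>x\<^sub>4\<close>
  as one variable with the parameter \<open>\<kappa>\<^sub>3 + \<kappa>\<^sub>4 + 2 \<mu>\<^sub>3 + 1\<close>.
\<close>

definition cyc_coeff :: "(nat \<Rightarrow> real) \<Rightarrow> (nat \<Rightarrow> nat) \<Rightarrow> (nat \<Rightarrow> nat) \<Rightarrow> real" where
  "cyc_coeff \<kappa> \<nu> \<mu> = (if \<mu> 3 \<le> \<nu> 2 + \<nu> 3 then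
     swap_coeff (\<nu> 2 + \<nu> 3) (\<nu> 3) (\<kappa> 1) (\<kappa> 3) (\<kappa> 4) (\<mu> 3) *
     swap_coeff (\<nu> 1 + (\<nu> 2 + \<nu> 3 - \<mu> 3)) (\<nu> 2 + \<nu> 3 - \<mu> 3) (\<kappa> 1) (\<kappa> 2) (\<kappa> 3 + \<kappa> 4 + 2 * real (\<mu> 3) + 1) (\<mu> 2) else 0)"

lemma simplex_hom_cyc123:
  "simplex_hom \<nu> (\<kappa> \<circ> cyc123) (x \<circ> cyc123) =
     jacobi_hom (\<nu> 3) (\<kappa> 4) (\<kappa> 1) (x 1) (x 1 + x 4) *
     jacobi_hom (\<nu> 2) (\<kappa> 1 + \<kappa> 4 + 2 * real (\<nu> 3) + 1) (\<kappa> 3) (x 3) (x 1 + x 3 + x 4) *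
     jacobi_hom (\<nu> 1) (\<kappa> 1 + \<kappa> 3 + \<kappa> 4 + 2 * real (\<nu> 2) + 2 * real (\<nu> 3) + 2) (\<kappa> 2) (x 2) (x 1 + x 2 + x 3 + x 4)"
  by (simp add: simplex_hom_def add_ac)

text \<open>
  First exchange \<open>x\<^sub>1\<close> and \<open>x\<^sub>3\<close> next to \<open>x\<^sub>4\<close>, then \<open>x\<^sub>1\<close> and \<open>x\<^sub>2\<close> next to \<open>x\<^sub>3 + x\<^sub>4\<close>.
\<close>

theorem cyc_expansion:
  assumes adm: "admissible \<kappa>" and \<nu>: "\<nu> \<in> multi_index 3 n"
  shows "simplex_hom \<nu> (\<kappa> \<circ> cyc123) (x \<circ> cyc123) = (\<Sum>\<mu>\<in>multi_index 3 n. cyc_coeff \<kappa> \<nu> \<mu> * simplex_hom \<mu> \<kappa> x)"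
proof -
  note \<kappa> = admissibleD[OF adm]
  have n: "\<nu> 1 + \<nu> 2 + \<nu> 3 = n" by (rule multi_index3_sum[OF \<nu>])
  define M where "M = \<nu> 2 + \<nu> 3"
  define J where "J = jacobi_hom (\<nu> 1) (\<kappa> 1 + \<kappa> 3 + \<kappa> 4 + 2 * real (\<nu> 2) + 2 * real (\<nu> 3) + 2) (\<kappa> 2) (x 2) (x 1 + x 2 + x 3 + x 4)"
  have "simplex_hom \<nu> (\<kappa> \<circ> cyc123) (x \<circ> cyc123) =
    (jacobi_hom (\<nu> 3) (\<kappa> 4) (\<kappa> 1) (x 1) (x 1 + x 4) *
     jacobi_hom (M - \<nu> 3) (\<kappa> 1 + \<kappa> 4 + 2 * real (\<nu> 3) + 1) (\<kappa> 3) (x 3) (x 1 + x 3 + x 4)) * J"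
    unfolding simplex_hom_cyc123 J_def by (simp add: M_def)
  also have "\<dots> = (\<Sum>s\<le>M. swap_coeff M (\<nu> 3) (\<kappa> 1) (\<kappa> 3) (\<kappa> 4) s *
       jacobi_hom s (\<kappa> 4) (\<kappa> 3) (x 3) (x 3 + x 4) *
       (jacobi_hom (M - s) (\<kappa> 3 + \<kappa> 4 + 2 * real s + 1) (\<kappa> 1) (x 1) (x 1 + x 3 + x 4) * J))"
    by (subst swap_expansion) (use \<kappa> in \<open>auto simp: M_def sum_distrib_right sum_distrib_left mult_ac\<close>)
  also have "\<dots> = (\<Sum>s\<le>M. \<Sum>l\<le>n - s. swap_coeff M (\<nu> 3) (\<kappa> 1) (\<kappa> 3) (\<kappa> 4) s *
       swap_coeff (n - s) (M - s) (\<kappa> 1) (\<kappa> 2) (\<kappa> 3 + \<kappa> 4 + 2 * real s + 1) l * simplex_hom (index3 (n - s - l) l s) \<kappa> x)"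
  proof (rule sum.cong[OF refl])
    fix s assume s: "s \<in> {..M}"
    define c where "c = \<kappa> 3 + \<kappa> 4 + 2 * real s + 1"
    have c: "c > -1" using \<kappa> by (simp add: c_def)
    have e1: "n - s - (M - s) = \<nu> 1" using n s by (auto simp: M_def)
    have e2: "\<kappa> 1 + \<kappa> 3 + \<kappa> 4 + 2 * real (\<nu> 2) + 2 * real (\<nu> 3) + 2 = \<kappa> 1 + c + 2 * real (M - s) + 1"
      using s by (simp add: c_def M_def of_nat_diff)
    have e3: "\<kappa> 2 + \<kappa> 3 + \<kappa> 4 + 2 * real l + 2 * real s + 2 = \<kappa> 2 + c + 2 * real l + 1" for l
      by (simp add: c_def)
    have "jacobi_hom (M - s) c (\<kappa> 1) (x 1) (x 1 + (x 3 + x 4)) *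
       jacobi_hom (n - s - (M - s)) (\<kappa> 1 + c + 2 * real (M - s) + 1) (\<kappa> 2) (x 2) (x 1 + x 2 + (x 3 + x 4)) =
       (\<Sum>l\<le>n - s. swap_coeff (n - s) (M - s) (\<kappa> 1) (\<kappa> 2) c l * (jacobi_hom l c (\<kappa> 2) (x 2) (x 2 + (x 3 + x 4)) *
        jacobi_hom (n - s - l) (\<kappa> 2 + c + 2 * real l + 1) (\<kappa> 1) (x 1) (x 1 + x 2 + (x 3 + x 4))))"
      by (rule swap_expansion) (use \<kappa> c n in \<open>auto simp: M_def\<close>)
    then have *: "jacobi_hom (M - s) c (\<kappa> 1) (x 1) (x 1 + x 3 + x 4) * J =
       (\<Sum>l\<le>n - s. swap_coeff (n - s) (M - s) (\<kappa> 1) (\<kappa> 2) c l * (jacobi_hom l c (\<kappa> 2) (x 2) (x 2 + x 3 + x 4) *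
        jacobi_hom (n - s - l) (\<kappa> 2 + c + 2 * real l + 1) (\<kappa> 1) (x 1) (x 1 + x 2 + x 3 + x 4)))"
      unfolding J_def e2 e1 by (simp add: add.assoc)
    show "swap_coeff M (\<nu> 3) (\<kappa> 1) (\<kappa> 3) (\<kappa> 4) s *
       jacobi_hom s (\<kappa> 4) (\<kappa> 3) (x 3) (x 3 + x 4) *
       (jacobi_hom (M - s) (\<kappa> 3 + \<kappa> 4 + 2 * real s + 1) (\<kappa> 1) (x 1) (x 1 + x 3 + x 4) * J) =
      (\<Sum>l\<le>n - s. swap_coeff M (\<nu> 3) (\<kappa> 1) (\<kappa> 3) (\<kappa> 4) s *
       swap_coeff (n - s) (M - s) (\<kappa> 1) (\<kappa> 2) (\<kappa> 3 + \<kappa> 4 + 2 * real s + 1) l * simplex_hom (index3 (n - s - l) l s) \<kappa> x)"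
      unfolding c_def[symmetric] * simplex_hom_def index3_simps e3 by (simp add: sum_distrib_left mult_ac)
  qed
  also have "\<dots> = (\<Sum>s\<le>M. \<Sum>l\<le>n - s. cyc_coeff \<kappa> \<nu> (index3 (n - s - l) l s) * simplex_hom (index3 (n - s - l) l s) \<kappa> x)"
  proof (intro sum.cong refl)
    fix s l assume "s \<in> {..M}"
    then have "n - s = \<nu> 1 + (M - s)" using n by (auto simp: M_def)
    then show "swap_coeff M (\<nu> 3) (\<kappa> 1) (\<kappa> 3) (\<kappa> 4) s *
       swap_coeff (n - s) (M - s) (\<kappa> 1) (\<kappa> 2) (\<kappa> 3 + \<kappa> 4 + 2 * real s + 1) l * simplex_hom (index3 (n - s - l) l s) \<kappa> x =
       cyc_coeff \<kappa> \<nu> (index3 (n - s - l) l s) * simplex_hom (index3 (n - s - l) l s) \<kappa> x"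
      using \<open>s \<in> {..M}\<close> by (simp add: cyc_coeff_def M_def)
  qed
  also have "\<dots> = (\<Sum>s\<le>n. \<Sum>l\<le>n - s. cyc_coeff \<kappa> \<nu> (index3 (n - s - l) l s) * simplex_hom (index3 (n - s - l) l s) \<kappa> x)"
  proof (rule sum.mono_neutral_left)
    show "\<forall>s\<in>{..n} - {..M}. (\<Sum>l\<le>n - s. cyc_coeff \<kappa> \<nu> (index3 (n - s - l) l s) * simplex_hom (index3 (n - s - l) l s) \<kappa> x) = 0"
      by (auto simp: cyc_coeff_def M_def)
  qed (use n in \<open>auto simp: M_def\<close>)
  finally show ?thesis by (simp add: sum_multi_index3)
qed

definition combination_of :: "'i set \<Rightarrow> ('i \<Rightarrow> 'x \<Rightarrow> real) \<Rightarrow> ('x \<Rightarrow> real) \<Rightarrow> bool" where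
  "combination_of I g f \<longleftrightarrow> (\<exists>c. \<forall>x. f x = (\<Sum>i\<in>I. c i * g i x))"

lemma combination_of_base:
  assumes "finite I" "i \<in> I" 
  shows "combination_of I g (g i)"
  unfolding combination_of_def
  by (rule exI[of _ "\<lambda>j. if j = i then 1 else 0"]) (use assms in \<open>auto simp: if_distrib[of "\<lambda>c. c * _"] cong: if_cong\<close>)

lemma combination_of_sum:
  assumes "\<And>l. l \<in> A \<Longrightarrow> combination_of I g (f l)"
  shows "combination_of I g (\<lambda>x. \<Sum>l\<in>A. C l * f l x)"
proof -
  obtain c where c: "\<And>l x. l \<in> A \<Longrightarrow> f l x = (\<Sum>i\<in>I. c l i * g i x)"
    using assms unfolding combination_of_def by metis
  have "(\<Sum>l\<in>A. C l * f l x) = (\<Sum>i\<in>I. (\<Sum>l\<in>A. C l * c l i) * g i x)" for x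
    using c by (simp add: sum_distrib_left sum_distrib_right mult.assoc) (rule sum.swap)
  then show ?thesis
    unfolding combination_of_def by (intro exI[of _ "\<lambda>i. \<Sum>l\<in>A. C l * c l i"] allI)
qed

text \<open>
  The same two exchanges in the opposite order. By orthogonality its coefficients are those of
  \<open>cyc_expansion\<close> up to norms (\<open>connection_coeff_adjoint\<close>).
\<close>

theorem cyc_expansion_inverse:
  assumes adm: "admissible \<kappa>" and \<mu>: "\<mu> \<in> multi_index 3 n"
  shows "combination_of (multi_index 3 n) (\<lambda>\<nu> x. simplex_hom \<nu> (\<kappa> \<circ> cyc123) (x \<circ> cyc123)) (simplex_hom \<mu> \<kappa>)"
    (is "combination_of ?I ?g _")
proof -
  note \<kappa> = admissibleD[OF adm]
  have n: "\<mu> 1 + \<mu> 2 + \<mu> 3 = n" by (rule multi_index3_sum[OF \<mu>])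
  define M where "M = \<mu> 1 + \<mu> 2"
  define c where "c = \<kappa> 3 + \<kappa> 4 + 2 * real (\<mu> 3) + 1"
  have c: "c > -1" using \<kappa> by (simp add: c_def)
  have inner: "jacobi_hom (\<mu> 3) (\<kappa> 4) (\<kappa> 3) (x 3) (x 3 + x 4) * (jacobi_hom q c (\<kappa> 1) (x 1) (x 1 + x 3 + x 4) *
     jacobi_hom (M - q) (\<kappa> 1 + c + 2 * real q + 1) (\<kappa> 2) (x 2) (x 1 + x 2 + x 3 + x 4)) =
    (\<Sum>l\<le>q + \<mu> 3. swap_coeff (q + \<mu> 3) (\<mu> 3) (\<kappa> 3) (\<kappa> 1) (\<kappa> 4) l * ?g (index3 (M - q) (q + \<mu> 3 - l) l) x)" for q x
  proof -
    have e: "\<kappa> 1 + \<kappa> 3 + \<kappa> 4 + 2 * real (q + \<mu> 3 - l) + 2 * real l + 2 = \<kappa> 1 + c + 2 * real q + 1" if "l \<le> q + \<mu> 3" for l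
      using that by (simp add: c_def of_nat_diff)
    have "jacobi_hom (\<mu> 3) (\<kappa> 4) (\<kappa> 3) (x 3) (x 3 + x 4) * jacobi_hom (q + \<mu> 3 - \<mu> 3) (\<kappa> 3 + \<kappa> 4 + 2 * real (\<mu> 3) + 1) (\<kappa> 1) (x 1) (x 3 + x 1 + x 4)
      = (\<Sum>l\<le>q + \<mu> 3. swap_coeff (q + \<mu> 3) (\<mu> 3) (\<kappa> 3) (\<kappa> 1) (\<kappa> 4) l *
         (jacobi_hom l (\<kappa> 4) (\<kappa> 1) (x 1) (x 1 + x 4) * jacobi_hom (q + \<mu> 3 - l) (\<kappa> 1 + \<kappa> 4 + 2 * real l + 1) (\<kappa> 3) (x 3) (x 3 + x 1 + x 4)))"
      by (rule swap_expansion) (use \<kappa> in auto)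
    then have "jacobi_hom (\<mu> 3) (\<kappa> 4) (\<kappa> 3) (x 3) (x 3 + x 4) * jacobi_hom q c (\<kappa> 1) (x 1) (x 1 + x 3 + x 4)
      = (\<Sum>l\<le>q + \<mu> 3. swap_coeff (q + \<mu> 3) (\<mu> 3) (\<kappa> 3) (\<kappa> 1) (\<kappa> 4) l *
         (jacobi_hom l (\<kappa> 4) (\<kappa> 1) (x 1) (x 1 + x 4) * jacobi_hom (q + \<mu> 3 - l) (\<kappa> 1 + \<kappa> 4 + 2 * real l + 1) (\<kappa> 3) (x 3) (x 1 + x 3 + x 4)))"
      by (simp add: c_def add_ac)
    moreover have "?g (index3 (M - q) (q + \<mu> 3 - l) l) x = jacobi_hom l (\<kappa> 4) (\<kappa> 1) (x 1) (x 1 + x 4) *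
        jacobi_hom (q + \<mu> 3 - l) (\<kappa> 1 + \<kappa> 4 + 2 * real l + 1) (\<kappa> 3) (x 3) (x 1 + x 3 + x 4) *
        jacobi_hom (M - q) (\<kappa> 1 + c + 2 * real q + 1) (\<kappa> 2) (x 2) (x 1 + x 2 + x 3 + x 4)" if "l \<le> q + \<mu> 3" for l
      using e[OF that] by (simp only: simplex_hom_cyc123 index3_simps)
    ultimately show ?thesis
      unfolding mult.assoc[symmetric] by (simp add: sum_distrib_right mult.assoc)
  qed
  have "simplex_hom \<mu> \<kappa> x = (\<Sum>q\<le>M. swap_coeff M (\<mu> 2) (\<kappa> 2) (\<kappa> 1) c q * 
     (\<Sum>l\<le>q + \<mu> 3. swap_coeff (q + \<mu> 3) (\<mu> 3) (\<kappa> 3) (\<kappa> 1) (\<kappa> 4) l * ?g (index3 (M - q) (q + \<mu> 3 - l) l) x))" for x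
  proof -
    have e: "\<kappa> 2 + \<kappa> 3 + \<kappa> 4 + 2 * real (\<mu> 2) + 2 * real (\<mu> 3) + 2 = \<kappa> 2 + c + 2 * real (\<mu> 2) + 1"
      by (simp add: c_def)
    have "jacobi_hom (\<mu> 2) c (\<kappa> 2) (x 2) (x 2 + (x 3 + x 4)) * jacobi_hom (M - \<mu> 2) (\<kappa> 2 + c + 2 * real (\<mu> 2) + 1) (\<kappa> 1) (x 1) (x 2 + x 1 + (x 3 + x 4)) =
      (\<Sum>q\<le>M. swap_coeff M (\<mu> 2) (\<kappa> 2) (\<kappa> 1) c q * (jacobi_hom q c (\<kappa> 1) (x 1) (x 1 + (x 3 + x 4)) *
         jacobi_hom (M - q) (\<kappa> 1 + c + 2 * real q + 1) (\<kappa> 2) (x 2) (x 2 + x 1 + (x 3 + x 4))))"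
      by (rule swap_expansion) (use \<kappa> c in \<open>auto simp: M_def\<close>)
    then have "jacobi_hom (\<mu> 2) c (\<kappa> 2) (x 2) (x 2 + x 3 + x 4) * jacobi_hom (\<mu> 1) (\<kappa> 2 + c + 2 * real (\<mu> 2) + 1) (\<kappa> 1) (x 1) (x 1 + x 2 + x 3 + x 4) =
      (\<Sum>q\<le>M. swap_coeff M (\<mu> 2) (\<kappa> 2) (\<kappa> 1) c q * (jacobi_hom q c (\<kappa> 1) (x 1) (x 1 + x 3 + x 4) *
         jacobi_hom (M - q) (\<kappa> 1 + c + 2 * real q + 1) (\<kappa> 2) (x 2) (x 1 + x 2 + x 3 + x 4)))"
      by (simp add: M_def add_ac)
    then have "simplex_hom \<mu> \<kappa> x = (\<Sum>q\<le>M. swap_coeff M (\<mu> 2) (\<kappa> 2) (\<kappa> 1) c q * (jacobi_hom (\<mu> 3) (\<kappa> 4) (\<kappa> 3) (x 3) (x 3 + x 4) * (jacobi_hom q c (\<kappa> 1) (x 1) (x 1 + x 3 + x 4) *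
     jacobi_hom (M - q) (\<kappa> 1 + c + 2 * real q + 1) (\<kappa> 2) (x 2) (x 1 + x 2 + x 3 + x 4))))"
      unfolding simplex_hom_def e c_def[symmetric] mult.assoc by (simp add: sum_distrib_left mult_ac)
    then show ?thesis unfolding inner .
  qed
  moreover have "combination_of ?I ?g (\<lambda>x. \<Sum>q\<le>M. swap_coeff M (\<mu> 2) (\<kappa> 2) (\<kappa> 1) c q * 
     (\<Sum>l\<le>q + \<mu> 3. swap_coeff (q + \<mu> 3) (\<mu> 3) (\<kappa> 3) (\<kappa> 1) (\<kappa> 4) l * ?g (index3 (M - q) (q + \<mu> 3 - l) l) x))"
    by (intro combination_of_sum combination_of_base[where g = ?g] finite_multi_index3) (use n in \<open>auto simp: M_def\<close>)
  ultimately show ?thesis by (simp only: fun_eq_iff[symmetric] combination_of_def)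
qed

section \<open>Racah weights and normalisation factors\<close>

definition racah_params :: "(nat \<Rightarrow> real) \<Rightarrow> nat \<Rightarrow> real" where
  "racah_params \<kappa> = (\<lambda>_. 0)(0 := \<kappa> 1, 1 := \<kappa> 1 + \<kappa> 4 + 1, 2 := \<kappa> 1 + \<kappa> 3 + \<kappa> 4 + 2, 3 := (\<Sum>i=1..4. \<kappa> i) + 3)"

definition racah_point :: "(nat \<Rightarrow> nat) \<Rightarrow> nat \<Rightarrow> nat" where
  "racah_point \<nu> = (\<lambda>_. 0)(1 := \<nu> 3, 2 := \<nu> 2 + \<nu> 3)"

definition racah_index :: "(nat \<Rightarrow> nat) \<Rightarrow> nat \<Rightarrow> nat" where
  "racah_index \<mu> = (\<lambda>_. 0)(1 := \<mu> 3, 2 := \<mu> 2)"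

lemma racah_params_simps [simp]:
  "racah_params \<kappa> 0 = \<kappa> 1" "racah_params \<kappa> (Suc 0) = \<kappa> 1 + \<kappa> 4 + 1"
  "racah_params \<kappa> 2 = \<kappa> 1 + \<kappa> 3 + \<kappa> 4 + 2" "racah_params \<kappa> 3 = \<kappa> 1 + \<kappa> 2 + \<kappa> 3 + \<kappa> 4 + 3"
  using sum_nat_intervals(1)[of \<kappa>] by (simp_all add: racah_params_def)

lemma racah_point_simps [simp]:
  "racah_point \<nu> (Suc 0) = \<nu> 3" "racah_point \<nu> 2 = \<nu> 2 + \<nu> 3"
  "racah_index \<nu> (Suc 0) = \<nu> 3" "racah_index \<nu> 2 = \<nu> 2"
  by (simp_all add: racah_point_def racah_index_def)

text \<open>
  The part of \<open>cyc_coeff\<close> that depends on \<open>\<nu>\<close> only, apart from the sign and the Racah polynomial.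
\<close>

definition node_factor :: "(nat \<Rightarrow> real) \<Rightarrow> (nat \<Rightarrow> nat) \<Rightarrow> real" where
  "node_factor \<kappa> \<nu> = pochhammer (\<kappa> 2 + 1) (\<nu> 1) * pochhammer (\<kappa> 3 + 1) (\<nu> 2) * pochhammer (\<kappa> 4 + 1) (\<nu> 3) /
     (fact (\<nu> 1) * fact (\<nu> 2) * fact (\<nu> 3))"

text \<open>
  The part of \<open>cyc_coeff\<close> that depends on \<open>\<mu>\<close> only, apart from the Racah polynomial.
\<close>

definition index_factor :: "(nat \<Rightarrow> real) \<Rightarrow> (nat \<Rightarrow> nat) \<Rightarrow> real" where
  "index_factor \<kappa> \<mu> = (let \<omega> = \<kappa> 3 + \<kappa> 4 + 1; \<omega>' = \<kappa> 2 + \<kappa> 3 + \<kappa> 4 + 2 * real (\<mu> 3) + 2 in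
     fact (\<mu> 1) /
     (pochhammer (\<kappa> 3 + 1) (\<mu> 3) * pochhammer (\<kappa> 4 + 1) (\<mu> 3) * pochhammer (\<omega> + real (\<mu> 3)) (\<mu> 3) *
      (pochhammer (\<kappa> 2 + 1) (\<mu> 2) * pochhammer (\<omega> + 2 * real (\<mu> 3) + 1) (\<mu> 2) *
       pochhammer (\<omega>' + real (\<mu> 2)) (\<mu> 2) * pochhammer (\<omega>' + 2 * real (\<mu> 2) + 1) (\<mu> 1))))"

lemma node_factor_pos:
  assumes adm: "admissible \<kappa>"
  shows "node_factor \<kappa> \<nu> > 0"
  using admissibleD[OF adm] by (auto simp: node_factor_def intro!: divide_pos_pos mult_pos_pos pochhammer_pos)

lemma index_factor_pos:
  assumes adm: "admissible \<kappa>"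
  shows "index_factor \<kappa> \<mu> > 0"
  unfolding index_factor_def Let_def
  using admissibleD[OF adm] by (intro divide_pos_pos mult_pos_pos pochhammer_self_shift_pos pochhammer_pos) auto

lemma racah_poly_two:
  "racah_poly 2 m x \<beta> N =
     cleared_4F3 (m 1) (real (m 1) + \<beta> 2 - \<beta> 0 - 1) (- real (x 1)) (\<beta> 1 + real (x 1))
       (\<beta> 1 - \<beta> 0) (\<beta> 2 + real (x 2)) (- real (x 2)) *
     cleared_4F3 (m 2) (real (m 2) + 2 * real (m 1) + \<beta> 3 - \<beta> 0 - 1) (real (m 1) - real (x 2)) (real (m 1) + \<beta> 2 + real (x 2))
       (2 * real (m 1) + \<beta> 2 - \<beta> 0) (real (m 1) + \<beta> 3 + real N) (real (m 1) - real N)"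
proof -
  have "{1..2::nat} = {1, 2}" by auto
  then show ?thesis
    by (simp add: numeral_2_eq_2[symmetric] racah_poly_def racah_node_def Let_def sum_nat_intervals[unfolded One_nat_def])
qed

lemma cleared_4F3_eq_0:
  assumes "j \<le> N" "N < l"
  shows "cleared_4F3 l a (- real j) b c v (- real N) = 0"
  unfolding cleared_4F3_def
proof (intro sum.neutral ballI)
  fix k
  consider "k > j" | "k \<le> N" using assms by linarith
  then show "pochhammer (- real l) k * pochhammer a k * pochhammer (- real j) k * pochhammer b k / fact k *
         (pochhammer (c + real k) (l - k) * pochhammer (v + real k) (l - k) * pochhammer (- real N + real k) (l - k)) = 0"
  proof cases
    case 1
    then show ?thesis by (simp add: pochhammer_of_nat_eq_0_iff)
  next
    case 2
    then have "pochhammer (real k - real N) (l - k) = 0"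
      using assms by (intro pochhammer_diff_eq_0) auto
    then show ?thesis by simp
  qed
qed

text \<open>
  The two \<open>\<^sub>4F\<^sub>3\<close> sums are the two factors of the Racah polynomial. The remaining factors depend on \<open>\<nu>\<close>
  or on \<open>\<mu>\<close> alone, because the mixed ones, which involve \<open>d = \<nu>\<^sub>2 + \<nu>\<^sub>3 - \<mu>\<^sub>3\<close>, cancel between the two
  exchanges. For \<open>\<mu>\<^sub>3 > \<nu>\<^sub>2 + \<nu>\<^sub>3\<close> the first factor of the Racah polynomial vanishes.
\<close>

lemma cyc_coeff_racah:
  assumes adm: "admissible \<kappa>" and \<nu>: "\<nu> \<in> multi_index 3 n" and \<mu>: "\<mu> \<in> multi_index 3 n"
  shows "cyc_coeff \<kappa> \<nu> \<mu> = (-1) ^ (n + \<nu> 3) * node_factor \<kappa> \<nu> * index_factor \<kappa> \<mu> *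
           racah_poly 2 (racah_index \<mu>) (racah_point \<nu>) (racah_params \<kappa>) n"
proof (cases "\<mu> 3 \<le> \<nu> 2 + \<nu> 3")
  case False
  then have "racah_poly 2 (racah_index \<mu>) (racah_point \<nu>) (racah_params \<kappa>) n = 0"
    using cleared_4F3_eq_0[of "\<nu> 3" "\<nu> 2 + \<nu> 3" "\<mu> 3"] by (simp add: racah_poly_two)
  with False show ?thesis by (simp add: cyc_coeff_def)
next
  case True
  obtain d where d: "\<nu> 2 + \<nu> 3 = \<mu> 3 + d" using True le_Suc_ex by blast
  have n: "n = \<nu> 1 + d + \<mu> 3" "\<mu> 1 + \<mu> 2 = \<nu> 1 + d"
    using multi_index3_sum[OF \<nu>] multi_index3_sum[OF \<mu>] d by auto
  define k where "k = \<nu> 1 + d"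
  define \<omega> where "\<omega> = \<kappa> 3 + \<kappa> 4 + 1"
  define c where "c = \<kappa> 3 + \<kappa> 4 + 2 * real (\<mu> 3) + 1"
  define R1 where "R1 = cleared_4F3 (\<mu> 3) (real (\<mu> 3) + \<omega>) (- real (\<nu> 3)) (real (\<nu> 3) + \<kappa> 1 + \<kappa> 4 + 1) (\<kappa> 4 + 1)
     (real (\<mu> 3 + d) + \<omega> + \<kappa> 1 + 1) (- real (\<mu> 3 + d))"
  define R2 where "R2 = cleared_4F3 (\<mu> 2) (real (\<mu> 2) + (\<kappa> 2 + c + 1)) (- real d) (real d + \<kappa> 1 + c + 1) (c + 1)
     (real k + (\<kappa> 2 + c + 1) + \<kappa> 1 + 1) (- real k)"
  have e: "\<mu> 3 + d - \<nu> 3 = \<nu> 2" "k - \<mu> 2 = \<mu> 1" "k - d = \<nu> 1" using d n by (auto simp: k_def)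
  have S1: "swap_coeff (\<mu> 3 + d) (\<nu> 3) (\<kappa> 1) (\<kappa> 3) (\<kappa> 4) (\<mu> 3) = (-1) ^ (\<mu> 3 + d + \<nu> 3) *
      (pochhammer (\<kappa> 3 + 1) (\<nu> 2) * pochhammer (\<kappa> 4 + 1) (\<nu> 3) / (fact (\<nu> 2) * fact (\<nu> 3))) *
      (fact d / (pochhammer (\<kappa> 3 + 1) (\<mu> 3) * pochhammer (\<kappa> 4 + 1) (\<mu> 3) * (pochhammer (\<omega> + \<mu> 3) (\<mu> 3) * pochhammer (c + 1) d))) * R1"
  proof -
    have "\<omega> + 2 * real (\<mu> 3) + 1 = c + 1" "\<mu> 3 + d - \<mu> 3 = d" by (simp_all add: \<omega>_def c_def)
    then show ?thesis by (simp only: swap_coeff_def Let_def e R1_def \<omega>_def[symmetric])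
  qed
  have S2: "swap_coeff k d (\<kappa> 1) (\<kappa> 2) c (\<mu> 2) = (-1) ^ (k + d) *
      (pochhammer (\<kappa> 2 + 1) (\<nu> 1) * pochhammer (c + 1) d / (fact (\<nu> 1) * fact d)) *
      (fact (\<mu> 1) / (pochhammer (\<kappa> 2 + 1) (\<mu> 2) * pochhammer (c + 1) (\<mu> 2) *
        (pochhammer (\<kappa> 2 + c + 1 + \<mu> 2) (\<mu> 2) * pochhammer (\<kappa> 2 + c + 1 + 2 * real (\<mu> 2) + 1) (\<mu> 1)))) * R2"
    by (simp only: swap_coeff_def Let_def e R2_def)
  have f: "index_factor \<kappa> \<mu> = fact (\<mu> 1) /
     (pochhammer (\<kappa> 3 + 1) (\<mu> 3) * pochhammer (\<kappa> 4 + 1) (\<mu> 3) * pochhammer (\<omega> + \<mu> 3) (\<mu> 3) *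
      (pochhammer (\<kappa> 2 + 1) (\<mu> 2) * pochhammer (c + 1) (\<mu> 2) *
       pochhammer (\<kappa> 2 + c + 1 + \<mu> 2) (\<mu> 2) * pochhammer (\<kappa> 2 + c + 1 + 2 * real (\<mu> 2) + 1) (\<mu> 1)))"
  proof -
    have "\<kappa> 3 + \<kappa> 4 + 1 + 2 * real (\<mu> 3) + 1 = c + 1" "\<kappa> 2 + \<kappa> 3 + \<kappa> 4 + 2 * real (\<mu> 3) + 2 = \<kappa> 2 + c + 1"
      by (simp_all add: c_def)
    then show ?thesis by (simp only: index_factor_def Let_def \<omega>_def)
  qed
  have R: "racah_poly 2 (racah_index \<mu>) (racah_point \<nu>) (racah_params \<kappa>) n = R1 * R2"
  proof -
    have "real (\<nu> 2) + real (\<nu> 3) = real (\<mu> 3) + real d" using d by linarith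
    then show ?thesis
      unfolding racah_poly_two R1_def R2_def
      by (intro arg_cong2[of _ _ _ _ "(*)"] arg_cong2[of _ _ _ _ "cleared_4F3 _ _"] arg_cong2[of _ _ _ _ "cleared_4F3 _"])
        (simp_all add: \<omega>_def c_def n(1) k_def add_ac d)
  qed
  have sgn: "((-1::real) ^ (\<mu> 3 + d + \<nu> 3)) * (-1) ^ (k + d) = (-1) ^ (n + \<nu> 3)"
  proof -
    have "\<mu> 3 + d + \<nu> 3 + (k + d) = (n + \<nu> 3) + 2 * d" by (simp add: n k_def)
    then have "((-1::real) ^ (\<mu> 3 + d + \<nu> 3)) * (-1) ^ (k + d) = (-1) ^ (n + \<nu> 3) * ((-1) ^ 2) ^ d"
      by (simp only: power_add[symmetric] power_mult[symmetric])
    then show ?thesis by simp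
  qed
  have nz: "pochhammer (c + 1) d \<noteq> 0"
    using admissibleD[OF adm] by (intro pochhammer_nonzero) (simp add: c_def)
  have "cyc_coeff \<kappa> \<nu> \<mu> = swap_coeff (\<mu> 3 + d) (\<nu> 3) (\<kappa> 1) (\<kappa> 3) (\<kappa> 4) (\<mu> 3) * swap_coeff k d (\<kappa> 1) (\<kappa> 2) c (\<mu> 2)"
    using True d by (simp add: cyc_coeff_def c_def k_def)
  also have "\<dots> = (((-1) ^ (\<mu> 3 + d + \<nu> 3)) * (-1) ^ (k + d)) * node_factor \<kappa> \<nu> * index_factor \<kappa> \<mu> * (R1 * R2)"
    unfolding S1 S2 f node_factor_def using nz by (simp add: mult_ac)
  finally show ?thesis unfolding sgn R .
qed

text \<open>
  The norm \<open>A\<^sub>\<nu>(\<kappa>)\<close> in closed form (see \<open>simplex_sqnorm_eq\<close>).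
\<close>

definition norm_formula :: "(nat \<Rightarrow> nat) \<Rightarrow> (nat \<Rightarrow> real) \<Rightarrow> real" where
  "norm_formula \<nu> \<kappa> =
     (pochhammer (\<kappa> 4 + 1) (\<nu> 3) * pochhammer (\<kappa> 3 + 1) (\<nu> 3) * pochhammer (\<kappa> 3 + \<kappa> 4 + 1 + real (\<nu> 3)) (\<nu> 3) / fact (\<nu> 3)) *
     (pochhammer (\<kappa> 3 + \<kappa> 4 + 2 * real (\<nu> 3) + 2) (\<nu> 2) * pochhammer (\<kappa> 2 + 1) (\<nu> 2) *
      pochhammer (\<kappa> 2 + \<kappa> 3 + \<kappa> 4 + 2 * real (\<nu> 3) + 2 + real (\<nu> 2)) (\<nu> 2) / fact (\<nu> 2)) *
     (pochhammer (\<kappa> 2 + \<kappa> 3 + \<kappa> 4 + 2 * real (\<nu> 2) + 2 * real (\<nu> 3) + 3) (\<nu> 1) * pochhammer (\<kappa> 1 + 1) (\<nu> 1) *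
      pochhammer (\<kappa> 1 + \<kappa> 2 + \<kappa> 3 + \<kappa> 4 + 2 * real (\<nu> 2) + 2 * real (\<nu> 3) + 3 + real (\<nu> 1)) (\<nu> 1) / fact (\<nu> 1)) /
     pochhammer (\<kappa> 1 + \<kappa> 2 + \<kappa> 3 + \<kappa> 4 + 4) (2 * (\<nu> 1 + \<nu> 2 + \<nu> 3))"

lemma norm_formula_pos:
  assumes adm: "admissible \<kappa>"
  shows "norm_formula \<nu> \<kappa> > 0"
  unfolding norm_formula_def
  using admissibleD[OF adm] by (intro divide_pos_pos mult_pos_pos pochhammer_self_shift_pos pochhammer_pos) auto

lemma racah_weight_two:
  "racah_weight 2 x \<beta> N =
     pochhammer (\<beta> 1 - \<beta> 0) (x 1) * pochhammer (\<beta> 1) (x 1) / (fact (x 1) * pochhammer (\<beta> 0 + 1) (x 1)) *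
     (pochhammer (\<beta> 2 - \<beta> 1) (x 2 - x 1) * pochhammer (\<beta> 2) (x 2 + x 1) / (fact (x 2 - x 1) * pochhammer (\<beta> 1 + 1) (x 2 + x 1))) *
     (pochhammer (\<beta> 3 - \<beta> 2) (N - x 2) * pochhammer (\<beta> 3) (N + x 2) / (fact (N - x 2) * pochhammer (\<beta> 2 + 1) (N + x 2))) *
     (pochhammer ((\<beta> 1 + 2) / 2) (x 1) / pochhammer (\<beta> 1 / 2) (x 1) * (pochhammer ((\<beta> 2 + 2) / 2) (x 2) / pochhammer (\<beta> 2 / 2) (x 2)))"
proof -
  have "{1..2::nat} = {1, 2}" "{0..2::nat} = {0, 1, 2}" by auto
  then show ?thesis
    by (simp add: numeral_2_eq_2[symmetric] racah_weight_def racah_node_def Let_def)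
qed

lemma pochhammer_half_quotient:
  fixes b :: real
  assumes "b > -1" "b \<noteq> 0"
  shows "pochhammer ((b + 2) / 2) m / pochhammer (b / 2) m = (b + 2 * real m) / b"
proof -
  define P where "P = pochhammer (b / 2) m"
  define Q where "Q = pochhammer (b / 2 + 1) m"
  have "P * (b / 2 + m) = b / 2 * Q"
    unfolding P_def Q_def by (metis pochhammer_Suc pochhammer_rec)
  then have Q: "Q = P * ((b + 2 * real m) / b)" using assms by (simp add: field_simps)
  have "P \<noteq> 0"
  proof
    assume "P = 0"
    then obtain k where "b / 2 = - real k" by (auto simp: P_def pochhammer_eq_0_iff)
    then show False using assms by (cases k) auto
  qed
  moreover have "(b + 2) / 2 = b / 2 + 1" by simp
  ultimately show ?thesis by (simp only: P_def[symmetric] Q_def[symmetric] Q) simp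
qed

lemma racah_weight_algebra:
  fixes P :: real
  assumes "P \<noteq> 0" "Q \<noteq> 0" "R \<noteq> 0" "E \<noteq> 0" "B1 \<noteq> 0" "B1' \<noteq> 0" "B1'' \<noteq> 0" "B2 \<noteq> 0" "B2' \<noteq> 0" "B2'' \<noteq> 0" "Z \<noteq> 0" "B3' \<noteq> 0"
    and "t1 \<noteq> 0" "t2 \<noteq> 0" "b1 \<noteq> 0" "b2 \<noteq> 0" "p \<noteq> 0" "q \<noteq> 0" "r \<noteq> 0"
  shows "P * B1 / (p * E) * (Q * B2 / (q * (B1 * B1' * t1 * B1'' / b1))) *
     (R * B3 / (r * (B2 * B2' * t2 * B2'' / b2))) * (t1 / b1 * (t2 / b2)) =
    B3 * B3' / Z * ((R * Q * P / (r * q * p))\<^sup>2 / ((P * E * B1' / p) * (B1'' * Q * B2' / q) * (B2'' * R * B3' / r) / Z))"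
proof -
  have "P * B1 / (p * E) * (Q * B2 / (q * (B1 * B1' * t1 * B1'' / b1))) *
     (R * B3 / (r * (B2 * B2' * t2 * B2'' / b2))) * (t1 / b1 * (t2 / b2)) = P * Q * R * B3 / (p * q * r * E * B1' * B1'' * B2' * B2'')"
    using assms by (simp add: divide_simps)
  also have "\<dots> = B3 * B3' / Z * ((R * Q * P / (r * q * p))\<^sup>2 / ((P * E * B1' / p) * (B1'' * Q * B2' / q) * (B2'' * R * B3' / r) / Z))"
    using assms by (simp add: divide_simps power2_eq_square)
  finally show ?thesis .
qed

text \<open>
  The identity that makes the normalisation work. It is an identity between Pochhammer symbols:
  \<open>pochhammer_half_quotient\<close> removes the halves, and \<open>pochhammer_four_split\<close> splits the denominators.
  For \<open>n > 0\<close> the nonvanishing of \<open>\<beta>\<^sub>1\<close> and \<open>\<beta>\<^sub>2\<close> is what gives the quotients in the weight their meaning.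
\<close>

lemma racah_weight_eq:
  assumes adm: "admissible \<kappa>" and \<nu>: "\<nu> \<in> multi_index 3 n"
    and reg: "n = 0 \<or> (racah_params \<kappa> 1 \<noteq> 0 \<and> racah_params \<kappa> 2 \<noteq> 0)"
  shows "racah_weight 2 (racah_point \<nu>) (racah_params \<kappa>) n =
    pochhammer (racah_params \<kappa> 3) (2 * n) / pochhammer (racah_params \<kappa> 3 + 1) (2 * n) *
    ((node_factor \<kappa> \<nu>)\<^sup>2 / norm_formula \<nu> (\<kappa> \<circ> cyc123))"
proof (cases "n = 0")
  case True
  then have "\<nu> 1 = 0" "\<nu> 2 = 0" "\<nu> 3 = 0" using multi_index3_sum[OF \<nu>] by auto
  with True show ?thesis by (simp add: racah_weight_two node_factor_def norm_formula_def)
next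
  case False
  note \<kappa> = admissibleD[OF adm]
  define p where "p = \<nu> 3"
  define q where "q = \<nu> 2"
  define r where "r = \<nu> 1"
  \<comment> \<open>The point is \<open>(p, p + q)\<close>, and \<open>n = p + q + r\<close>.\<close>
  define b1 where "b1 = racah_params \<kappa> 1"
  define b2 where "b2 = racah_params \<kappa> 2"
  define b3 where "b3 = racah_params \<kappa> 3"
  have n: "n = p + q + r" using multi_index3_sum[OF \<nu>] by (simp add: p_def q_def r_def)
  have b: "b1 \<noteq> 0" "b2 \<noteq> 0" "b1 > -1" "b2 > -1" "b3 > -1"
    using reg False \<kappa> by (simp_all add: b1_def b2_def b3_def)
  define P where "P = pochhammer (\<kappa> 4 + 1) p"
  define Q where "Q = pochhammer (\<kappa> 3 + 1) q"
  define R where "R = pochhammer (\<kappa> 2 + 1) r"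
  define E where "E = pochhammer (\<kappa> 1 + 1) p"
  define B1 where "B1 = pochhammer b1 p"
  define B1' where "B1' = pochhammer (b1 + p) p"
  define B1'' where "B1'' = pochhammer (b1 + 2 * real p + 1) q"
  define B2 where "B2 = pochhammer b2 (p + (p + q))"
  define B2' where "B2' = pochhammer (b2 + 2 * real p + real q) q"
  define B2'' where "B2'' = pochhammer (b2 + 2 * real p + 2 * real q + 1) r"
  define B3 where "B3 = pochhammer b3 (n + (p + q))"
  define B3' where "B3' = pochhammer (b3 + real (n + (p + q))) r"
  define Z where "Z = pochhammer (b3 + 1) (2 * n)"
  have nz: "P \<noteq> 0" "Q \<noteq> 0" "R \<noteq> 0" "E \<noteq> 0" "B1 \<noteq> 0" "B1' \<noteq> 0" "B1'' \<noteq> 0" "B2 \<noteq> 0" "B2' \<noteq> 0" "B2'' \<noteq> 0" "Z \<noteq> 0"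
  proof -
    show "P \<noteq> 0" "Q \<noteq> 0" "R \<noteq> 0" "E \<noteq> 0" "B1'' \<noteq> 0" "B2'' \<noteq> 0" "Z \<noteq> 0"
      using \<kappa> b by (simp_all add: P_def Q_def R_def E_def B1''_def B2''_def Z_def pochhammer_nonzero)
    show "B1 \<noteq> 0" "B2 \<noteq> 0" unfolding B1_def B2_def by (intro pochhammer_nonzero_gt_minus_one b)+
    show "B1' \<noteq> 0" using pochhammer_self_shift_pos[OF b(3), of p] by (simp add: B1'_def)
    show "B2' \<noteq> 0" using pochhammer_self_shift_pos[of "b2 + 2 * real p" q] b by (simp add: B2'_def)
  qed
  have t: "b1 + 2 * real p \<noteq> 0" "b2 + 2 * real (p + q) \<noteq> 0"
  proof -
    show "b1 + 2 * real p \<noteq> 0" using b by (cases p) auto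
    show "b2 + 2 * real (p + q) \<noteq> 0" using b by (cases "p + q") auto
  qed
  have 1: "b1 * pochhammer (b1 + 1) (p + (p + q)) = B1 * B1' * (b1 + 2 * real p) * B1''"
  proof -
    have "b1 + real (p + p) = b1 + 2 * real p" "p + p + q = p + (p + q)" by simp_all
    then show ?thesis using pochhammer_four_split[of b1 p p q] by (simp only: B1_def B1'_def B1''_def)
  qed
  have 2: "b2 * pochhammer (b2 + 1) (n + (p + q)) = B2 * B2' * (b2 + 2 * real (p + q)) * B2''"
  proof -
    have "b2 + real (p + (p + q) + q) = b2 + 2 * real (p + q)" "p + (p + q) + q + r = n + (p + q)"
      "b2 + 2 * real p + real q = b2 + real (p + (p + q))" "b2 + 2 * real p + 2 * real q + 1 = b2 + 2 * real (p + q) + 1"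
      by (simp_all add: n)
    then show ?thesis using pochhammer_four_split[of b2 "p + (p + q)" q r] by (simp only: B2_def B2'_def B2''_def)
  qed
  have 3: "pochhammer b3 (2 * n) = B3 * B3'"
  proof -
    have "2 * n = n + (p + q) + r" by (simp add: n)
    then show ?thesis by (simp only: pochhammer_product' B3_def B3'_def)
  qed
  have s1: "pochhammer (b1 + 1) (p + (p + q)) = B1 * B1' * (b1 + 2 * real p) * B1'' / b1"
    by (simp only: 1[symmetric] nonzero_mult_div_cancel_left[OF b(1)])
  have s2: "pochhammer (b2 + 1) (n + (p + q)) = B2 * B2' * (b2 + 2 * real (p + q)) * B2'' / b2"
    by (simp only: 2[symmetric] nonzero_mult_div_cancel_left[OF b(2)])
  have W: "racah_weight 2 (racah_point \<nu>) (racah_params \<kappa>) n =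
     P * B1 / (fact p * E) * (Q * B2 / (fact q * (B1 * B1' * (b1 + 2 * real p) * B1'' / b1))) *
     (R * B3 / (fact r * (B2 * B2' * (b2 + 2 * real (p + q)) * B2'' / b2))) *
     ((b1 + 2 * real p) / b1 * ((b2 + 2 * real (p + q)) / b2))"
  proof -
    have x: "racah_point \<nu> 1 = p" "racah_point \<nu> 2 = p + q" by (simp_all add: p_def q_def)
    have d: "racah_params \<kappa> 1 - racah_params \<kappa> 0 = \<kappa> 4 + 1" "racah_params \<kappa> 2 - racah_params \<kappa> 1 = \<kappa> 3 + 1"
        "racah_params \<kappa> 3 - racah_params \<kappa> 2 = \<kappa> 2 + 1" "racah_params \<kappa> 0 + 1 = \<kappa> 1 + 1" "p + q - p = q" "n - (p + q) = r"
      by (simp_all add: n)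
    have c: "p + q + p = p + (p + q)" by simp
    show ?thesis
      unfolding racah_weight_two x d c unfolding b1_def[symmetric] b2_def[symmetric] b3_def[symmetric]
        pochhammer_half_quotient[OF b(3,1)] pochhammer_half_quotient[OF b(4,2)] s1 s2
      by (simp only: P_def Q_def R_def E_def B1_def B2_def B3_def)
  qed
  have A: "norm_formula \<nu> (\<kappa> \<circ> cyc123) = (P * E * B1' / fact p) * (B1'' * Q * B2' / fact q) * (B2'' * R * B3' / fact r) / Z"
  proof -
    have "\<kappa> 1 + \<kappa> 4 + 1 + real p = b1 + real p" "\<kappa> 1 + \<kappa> 4 + 2 * real p + 2 = b1 + 2 * real p + 1"
      "\<kappa> 3 + \<kappa> 1 + \<kappa> 4 + 2 * real p + 2 + real q = b2 + 2 * real p + real q"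
      "\<kappa> 3 + \<kappa> 1 + \<kappa> 4 + 2 * real q + 2 * real p + 3 = b2 + 2 * real p + 2 * real q + 1"
      "\<kappa> 2 + \<kappa> 3 + \<kappa> 1 + \<kappa> 4 + 2 * real q + 2 * real p + 3 + real r = b3 + real (n + (p + q))"
      "\<kappa> 2 + \<kappa> 3 + \<kappa> 1 + \<kappa> 4 + 4 = b3 + 1" "r + q + p = n"
      by (simp_all add: b1_def b2_def b3_def n)
    then show ?thesis
      unfolding norm_formula_def comp_apply cyc123_simps p_def[symmetric] q_def[symmetric] r_def[symmetric]
      by (simp only: P_def E_def B1'_def B1''_def Q_def B2'_def B2''_def R_def B3'_def Z_def)
  qed
  have F: "node_factor \<kappa> \<nu> = R * Q * P / (fact r * fact q * fact p)"
    by (simp add: node_factor_def P_def Q_def R_def p_def q_def r_def)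
  have B3': "B3' \<noteq> 0"
    using pochhammer_self_shift_pos[of "b3 + 2 * real (p + q)" r] b by (simp add: B3'_def n add_ac)
  show ?thesis
    unfolding W A F b3_def[symmetric] 3 Z_def[symmetric]
    by (rule racah_weight_algebra) (use nz t b B3' in simp_all)
qed

lemma racah_point_in:
  assumes \<nu>: "\<nu> \<in> multi_index 3 n"
  shows "racah_point \<nu> \<in> racah_points 2 n"
  unfolding racah_points_def
proof (intro CollectI conjI allI impI)
  fix i :: nat assume "i \<notin> {1..2}"
  then show "racah_point \<nu> i = 0" by (auto simp: racah_point_def)
next
  fix j :: nat assume "j \<le> 2"
  then consider "j = 0" | "j = 1" | "j = 2" by linarith
  then show "racah_node 2 n (racah_point \<nu>) j \<le> racah_node 2 n (racah_point \<nu>) (j + 1)"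
    using multi_index3_sum[OF \<nu>] by cases (simp_all add: racah_node_def numeral_2_eq_2[symmetric])
qed

text \<open>
  The points of \<open>V\<^sub>n\<close> are the partial sums \<open>(\<nu>\<^sub>3, \<nu>\<^sub>2 + \<nu>\<^sub>3)\<close> of the multi-indices of degree \<open>n\<close>.
\<close>

lemma racah_points_sum:
  "(\<Sum>y\<in>racah_points 2 n. g y) = (\<Sum>\<nu>\<in>multi_index 3 n. g (racah_point \<nu>))"
proof (rule sum.reindex_bij_witness[where i = racah_point and j = "\<lambda>y. index3 (n - y 2) (y 2 - y 1) (y 1)"])
  fix y assume "y \<in> racah_points 2 n"
  then have y: "\<And>i. i \<notin> {1..2} \<Longrightarrow> y i = 0" "\<forall>j\<le>2. racah_node 2 n y j \<le> racah_node 2 n y (j + 1)"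
    by (auto simp: racah_points_def)
  have 1: "y 1 \<le> y 2" using y(2)[rule_format, of 1] by (simp add: racah_node_def numeral_2_eq_2)
  have 2: "y 2 \<le> n" using y(2)[rule_format, of 2] by (simp add: racah_node_def)
  show "racah_point (index3 (n - y 2) (y 2 - y 1) (y 1)) = y"
  proof
    fix i
    show "racah_point (index3 (n - y 2) (y 2 - y 1) (y 1)) i = y i"
      using 1 y(1)[of i] by (cases "i = 1"; cases "i = 2") (auto simp: racah_point_def)
  qed
  then show "g (racah_point (index3 (n - y 2) (y 2 - y 1) (y 1))) = g y" by simp
  show "index3 (n - y 2) (y 2 - y 1) (y 1) \<in> multi_index 3 n" using 1 2 by simp
next
  fix \<nu> assume \<nu>: "\<nu> \<in> multi_index 3 n"
  have n: "n = \<nu> 1 + \<nu> 2 + \<nu> 3" using multi_index3_sum[OF \<nu>] by simp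
  have "index3 (\<nu> 1) (\<nu> 2) (\<nu> 3) = \<nu>" using multi_index_eq_index3[OF \<nu>] by metis
  then show "index3 (n - racah_point \<nu> 2) (racah_point \<nu> 2 - racah_point \<nu> 1) (racah_point \<nu> 1) = \<nu>"
    by (simp add: n)
  show "racah_point \<nu> \<in> racah_points 2 n" by (rule racah_point_in[OF \<nu>])
qed

section \<open>Jacobi polynomials on the interval\<close>

definition beta_density :: "real \<Rightarrow> real \<Rightarrow> real \<Rightarrow> real" where
  "beta_density \<alpha> \<beta> u = indicator {0<..<1} u * (u powr \<beta> * (1 - u) powr \<alpha>)"

lemma beta_density_measurable [measurable]: "beta_density \<alpha> \<beta> \<in> borel_measurable borel"
  unfolding beta_density_def by measurable

lemma beta_density_integral:
  assumes "\<alpha> > -1" "\<beta> > -1"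
  shows "has_bochner_integral lborel (beta_density \<alpha> \<beta>) (Beta (\<beta> + 1) (\<alpha> + 1))"
proof -
  define f where "f = (\<lambda>t::real. t powr (\<beta> + 1 - 1) * (1 - t) powr (\<alpha> + 1 - 1))"
  have i: "set_integrable lborel {0..1} f"
    unfolding f_def by (rule integrable_Beta) (use assms in auto)
  have "(f has_integral Beta (\<beta> + 1) (\<alpha> + 1)) {0..1}"
    unfolding f_def by (rule has_integral_Beta_real) (use assms in auto)
  then have "set_lebesgue_integral lborel {0..1} f = Beta (\<beta> + 1) (\<alpha> + 1)"
    using set_borel_integral_eq_integral(2)[OF i] by (simp add: integral_unique)
  moreover have "(\<lambda>x. indicator {0..1} x *\<^sub>R f x) = beta_density \<alpha> \<beta>"
    by (auto simp: fun_eq_iff beta_density_def f_def indicator_def)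
  ultimately show ?thesis
    using i by (simp add: has_bochner_integral_iff set_integrable_def set_lebesgue_integral_def)
qed

lemma beta_density_times_continuous_integrable:
  assumes "\<alpha> > -1" "\<beta> > -1" "continuous_on UNIV g"
  shows "integrable lborel (\<lambda>u. beta_density \<alpha> \<beta> u * g u)"
proof -
  have "compact (g ` {0..1})"
    by (rule compact_continuous_image) (use assms(3) continuous_on_subset in auto)
  then obtain C where C: "\<And>u. u \<in> {0..1} \<Longrightarrow> \<bar>g u\<bar> \<le> C"
    by (metis compact_imp_bounded bounded_real image_eqI)
  have [measurable]: "g \<in> borel_measurable borel"
    by (rule borel_measurable_continuous_onI[OF assms(3)])
  have "integrable lborel (\<lambda>u. C * beta_density \<alpha> \<beta> u)"
    using beta_density_integral[OF assms(1,2)] by (simp add: has_bochner_integral_iff)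
  then show ?thesis
  proof (rule Bochner_Integration.integrable_bound)
    show "AE u in lborel. norm (beta_density \<alpha> \<beta> u * g u) \<le> norm (C * beta_density \<alpha> \<beta> u)"
    proof (rule AE_I2)
      fix u :: real
      show "norm (beta_density \<alpha> \<beta> u * g u) \<le> norm (C * beta_density \<alpha> \<beta> u)"
      proof (cases "u \<in> {0<..<1}")
        case True
        then have "\<bar>g u\<bar> \<le> \<bar>C\<bar>" using C[of u] by auto
        then show ?thesis by (simp add: abs_mult mult.commute mult_right_mono)
      qed (simp add: beta_density_def)
    qed
  qed simp
qed

lemma beta_density_shift: "beta_density \<alpha> \<beta> u * (1 - u) ^ r = beta_density (\<alpha> + real r) \<beta> u"
  by (auto simp: beta_density_def indicator_def powr_add powr_realpow)

lemma Beta_shift: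
  fixes \<alpha> \<beta> :: real
  assumes "\<alpha> > 0" "\<beta> > 0"
  shows "Beta \<beta> (\<alpha> + real r) = Beta \<beta> \<alpha> * (pochhammer \<alpha> r / pochhammer (\<alpha> + \<beta>) r)"
proof -
  have "\<alpha> \<notin> \<int>\<^sub>\<le>\<^sub>0" "\<alpha> + \<beta> \<notin> \<int>\<^sub>\<le>\<^sub>0" using assms by auto
  then have "Gamma (\<alpha> + real r) = Gamma \<alpha> * pochhammer \<alpha> r" "Gamma (\<alpha> + \<beta> + real r) = Gamma (\<alpha> + \<beta>) * pochhammer (\<alpha> + \<beta>) r"
    using assms by (simp_all add: pochhammer_Gamma Gamma_eq_zero_iff)
  then show ?thesis by (simp add: Beta_def add_ac)
qed

lemma jacobi_shifted:
  "jacobi m \<alpha> \<beta> (2 * u - 1) = (\<Sum>k\<le>m. (-1) ^ k * (pochhammer (real m + \<alpha> + \<beta> + 1) k * pochhammer (\<alpha> + real k + 1) (m - k) / (fact k * fact (m - k))) * (1 - u) ^ k)"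
proof -
  have e: "(2 * u - 1 - 1) / 2 = (-1) * (1 - u)" by (simp add: field_simps)
  show ?thesis unfolding jacobi_def e power_mult_distrib by (simp add: mult_ac)
qed

lemma continuous_on_jacobi: "continuous_on UNIV (\<lambda>u. jacobi m \<alpha> \<beta> (2 * u - 1))"
  unfolding jacobi_def by (intro continuous_intros) simp

definition jacobi_norm :: "nat \<Rightarrow> real \<Rightarrow> real \<Rightarrow> real" where
  "jacobi_norm m \<alpha> \<beta> = pochhammer (\<alpha> + 1) m * pochhammer (\<beta> + 1) m * pochhammer (real m + \<alpha> + \<beta> + 1) m /
     (fact m * pochhammer (\<alpha> + \<beta> + 2) (2 * m))"

text \<open>
  Another Saalschuetz sum, for the moments \<open>(\<alpha> + 1)\<^sub>p / (\<alpha> + \<beta> + 2)\<^sub>p\<close> of the beta distribution. The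
  factor \<open>(-r)\<^sub>m\<close> on the right expresses the orthogonality to all powers \<open>r < m\<close>.
\<close>

lemma jacobi_moment_sum:
  fixes \<alpha> \<beta> :: real
  assumes "\<alpha> > -1" "\<beta> > -1"
  shows "(\<Sum>k\<le>m. (-1) ^ k * (pochhammer (real m + \<alpha> + \<beta> + 1) k * pochhammer (\<alpha> + real k + 1) (m - k) / (fact k * fact (m - k))) *
            (pochhammer (\<alpha> + 1) (r + k) / pochhammer (\<alpha> + \<beta> + 2) (r + k))) =
         pochhammer (\<alpha> + 1) r * pochhammer (\<beta> + 1) m * pochhammer (- real r) m / (pochhammer (\<alpha> + \<beta> + 2) (r + m) * fact m)"
proof -
  \<comment> \<open>With this choice \<open>C - A - B = - (\<alpha> + \<beta> + m + r + 1)\<close>; reflecting its Pochhammer symbol gives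
  the complement of \<open>(\<alpha> + \<beta> + 2)\<^sub>r\<^sub>+\<^sub>k\<close> in \<open>(\<alpha> + \<beta> + 2)\<^sub>r\<^sub>+\<^sub>m\<close>.\<close>
  define A where "A = real m + \<alpha> + \<beta> + 1"
  define B where "B = \<alpha> + real r + 1"
  define C where "C = \<alpha> + 1"
  define s where "s = \<alpha> + \<beta> + 2"
  have s: "s > 0" using assms by (simp add: s_def)
  have "(\<Sum>k\<le>m. (-1) ^ k * (pochhammer (real m + \<alpha> + \<beta> + 1) k * pochhammer (\<alpha> + real k + 1) (m - k) / (fact k * fact (m - k))) *
            (pochhammer (\<alpha> + 1) (r + k) / pochhammer (\<alpha> + \<beta> + 2) (r + k)))
    = (\<Sum>k\<le>m. (-1) ^ m * pochhammer C r / (pochhammer s (r + m) * fact m) *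
        (real (m choose k) * (pochhammer A k * pochhammer B k * pochhammer (C + real k) (m - k) * pochhammer (C - A - B) (m - k))))"
  proof (rule sum.cong[OF refl])
    fix k assume "k \<in> {..m}"
    then obtain d where m: "m = k + d" using le_Suc_ex by auto
    have 1: "pochhammer (\<alpha> + 1) (r + k) = pochhammer C r * pochhammer B k"
    proof -
      have "\<alpha> + 1 + real r = \<alpha> + real r + 1" by simp
      then show ?thesis by (simp only: pochhammer_product' C_def B_def)
    qed
    have 2: "pochhammer s (r + m) = pochhammer s (r + k) * pochhammer (s + real (r + k)) d"
      by (simp only: m add.assoc[symmetric] pochhammer_product')
    have "C - A - B = - (s + real m + real r - 1)" by (simp add: A_def B_def C_def s_def)
    moreover have "s + real m + real r - 1 - real d + 1 = s + real (r + k)" by (simp add: m)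
    ultimately have 3: "pochhammer (C - A - B) d = (-1) ^ d * pochhammer (s + real (r + k)) d"
      by (simp only: pochhammer_reflect)
    have 4: "real (m choose k) = fact m / (fact k * fact d)"
      by (subst binomial_fact) (auto simp: m)
    have md: "m - k = d" by (simp add: m)
    have c: "C + real k = \<alpha> + real k + 1" by (simp add: C_def)
    have sg: "(-1::real) ^ m * (-1) ^ d = (-1) ^ k" by (simp add: m power_add power_mult_distrib[symmetric])
    have nz: "pochhammer s (r + k) \<noteq> 0" "pochhammer (s + real (r + k)) d \<noteq> 0"
      using s by (auto intro!: pochhammer_nonzero)
    have "(-1) ^ m * pochhammer C r / (pochhammer s (r + m) * fact m) *
        (real (m choose k) * (pochhammer A k * pochhammer B k * pochhammer (C + real k) (m - k) * pochhammer (C - A - B) (m - k)))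
      = ((-1) ^ m * (-1) ^ d) * pochhammer C r * pochhammer A k * pochhammer B k * pochhammer (\<alpha> + real k + 1) d /
         (pochhammer s (r + k) * (fact k * fact d))"
      unfolding md 2 3 4 c using nz by simp
    then show "(-1) ^ k * (pochhammer (real m + \<alpha> + \<beta> + 1) k * pochhammer (\<alpha> + real k + 1) (m - k) / (fact k * fact (m - k))) *
            (pochhammer (\<alpha> + 1) (r + k) / pochhammer (\<alpha> + \<beta> + 2) (r + k)) = (-1) ^ m * pochhammer C r / (pochhammer s (r + m) * fact m) *
        (real (m choose k) * (pochhammer A k * pochhammer B k * pochhammer (C + real k) (m - k) * pochhammer (C - A - B) (m - k)))"
      unfolding sg md 1 A_def[symmetric] s_def[symmetric] by (simp add: mult_ac)
  qed
  also have "\<dots> = (-1) ^ m * pochhammer C r / (pochhammer s (r + m) * fact m) * (pochhammer (C - A) m * pochhammer (C - B) m)"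
    unfolding sum_distrib_left[symmetric] saalschuetz ..
  also have "pochhammer (C - A) m = (-1) ^ m * pochhammer (\<beta> + 1) m"
  proof -
    have "C - A = - (real m + \<beta>)" "real m + \<beta> - real m + 1 = \<beta> + 1" by (simp_all add: C_def A_def)
    then show ?thesis by (simp only: pochhammer_reflect)
  qed
  also have "C - B = - real r" by (simp add: C_def B_def)
  also have "(-1) ^ m * pochhammer C r / (pochhammer s (r + m) * fact m) * ((-1) ^ m * pochhammer (\<beta> + 1) m * pochhammer (- real r) m)
     = pochhammer C r * pochhammer (\<beta> + 1) m * pochhammer (- real r) m / (pochhammer s (r + m) * fact m)"
  proof -
    have "((-1::real) ^ m) * ((-1) ^ m * x) = x" for x by (simp add: mult.assoc[symmetric] power_mult_distrib[symmetric])
    then show ?thesis by (simp add: mult_ac)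
  qed
  finally show ?thesis by (simp only: C_def s_def)
qed

lemma jacobi_moment:
  assumes "\<alpha> > -1" "\<beta> > -1"
  shows "has_bochner_integral lborel (\<lambda>u. beta_density \<alpha> \<beta> u * ((1 - u) ^ r * jacobi m \<alpha> \<beta> (2 * u - 1)))
     (Beta (\<beta> + 1) (\<alpha> + 1) * (pochhammer (\<alpha> + 1) r * pochhammer (\<beta> + 1) m * pochhammer (- real r) m / (pochhammer (\<alpha> + \<beta> + 2) (r + m) * fact m)))"
proof -
  define c where "c k = (-1) ^ k * (pochhammer (real m + \<alpha> + \<beta> + 1) k * pochhammer (\<alpha> + real k + 1) (m - k) / (fact k * fact (m - k)))" for k
  have "has_bochner_integral lborel (\<lambda>u. \<Sum>k\<le>m. c k * beta_density (\<alpha> + real (r + k)) \<beta> u)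
     (\<Sum>k\<le>m. c k * Beta (\<beta> + 1) (\<alpha> + real (r + k) + 1))"
    by (intro has_bochner_integral_sum has_bochner_integral_mult_right beta_density_integral) (use assms in auto)
  moreover have "(\<lambda>u. beta_density \<alpha> \<beta> u * ((1 - u) ^ r * jacobi m \<alpha> \<beta> (2 * u - 1))) = (\<lambda>u. \<Sum>k\<le>m. c k * beta_density (\<alpha> + real (r + k)) \<beta> u)"
    unfolding jacobi_shifted c_def[symmetric] beta_density_shift[symmetric]
    by (simp add: fun_eq_iff sum_distrib_left power_add mult_ac)
  moreover have "(\<Sum>k\<le>m. c k * Beta (\<beta> + 1) (\<alpha> + real (r + k) + 1)) =
     Beta (\<beta> + 1) (\<alpha> + 1) * (\<Sum>k\<le>m. c k * (pochhammer (\<alpha> + 1) (r + k) / pochhammer (\<alpha> + \<beta> + 2) (r + k)))"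
    unfolding sum_distrib_left
  proof (rule sum.cong[OF refl])
    fix k
    have e: "\<alpha> + real (r + k) + 1 = \<alpha> + 1 + real (r + k)" "\<alpha> + \<beta> + 2 = \<alpha> + 1 + (\<beta> + 1)" by simp_all
    show "c k * Beta (\<beta> + 1) (\<alpha> + real (r + k) + 1) = Beta (\<beta> + 1) (\<alpha> + 1) * (c k * (pochhammer (\<alpha> + 1) (r + k) / pochhammer (\<alpha> + \<beta> + 2) (r + k)))"
      unfolding e by (subst Beta_shift) (use assms in auto)
  qed
  ultimately show ?thesis
    using jacobi_moment_sum[OF assms] by (simp only: c_def)
qed

text \<open>
  Expand the polynomial of smaller degree in powers of \<open>1 - u\<close>; by \<open>jacobi_moment\<close> at most its
  leading term contributes.
\<close>

lemma jacobi_orthogonal_le: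
  assumes "\<alpha> > -1" "\<beta> > -1" "m' \<le> m"
  shows "has_bochner_integral lborel (\<lambda>u. beta_density \<alpha> \<beta> u * (jacobi m \<alpha> \<beta> (2 * u - 1) * jacobi m' \<alpha> \<beta> (2 * u - 1)))
     (if m = m' then Beta (\<beta> + 1) (\<alpha> + 1) * jacobi_norm m \<alpha> \<beta> else 0)"
proof -
  define c where "c k = (-1) ^ k * (pochhammer (real m' + \<alpha> + \<beta> + 1) k * pochhammer (\<alpha> + real k + 1) (m' - k) / (fact k * fact (m' - k)))" for k
  define M where "M k = Beta (\<beta> + 1) (\<alpha> + 1) * (pochhammer (\<alpha> + 1) k * pochhammer (\<beta> + 1) m * pochhammer (- real k) m / (pochhammer (\<alpha> + \<beta> + 2) (k + m) * fact m))" for k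
  have "has_bochner_integral lborel (\<lambda>u. \<Sum>k\<le>m'. c k * (beta_density \<alpha> \<beta> u * ((1 - u) ^ k * jacobi m \<alpha> \<beta> (2 * u - 1)))) (\<Sum>k\<le>m'. c k * M k)"
    unfolding M_def by (intro has_bochner_integral_sum has_bochner_integral_mult_right jacobi_moment assms(1,2))
  moreover have "(\<lambda>u. \<Sum>k\<le>m'. c k * (beta_density \<alpha> \<beta> u * ((1 - u) ^ k * jacobi m \<alpha> \<beta> (2 * u - 1)))) =
     (\<lambda>u. beta_density \<alpha> \<beta> u * (jacobi m \<alpha> \<beta> (2 * u - 1) * jacobi m' \<alpha> \<beta> (2 * u - 1)))"
    unfolding jacobi_shifted[of m'] c_def[symmetric] by (simp add: fun_eq_iff sum_distrib_left mult_ac)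
  moreover have "(\<Sum>k\<le>m'. c k * M k) = (if m = m' then Beta (\<beta> + 1) (\<alpha> + 1) * jacobi_norm m \<alpha> \<beta> else 0)"
  proof -
    have z: "M k = 0" if "k < m" for k using that by (simp add: M_def pochhammer_of_nat_eq_0_iff)
    show ?thesis
    proof (cases "m = m'")
      case False
      then have "(\<Sum>k\<le>m'. c k * M k) = 0" using assms(3) by (intro sum.neutral ballI) (simp add: z)
      then show ?thesis using False by simp
    next
      case True
      have "(\<Sum>k\<le>m'. c k * M k) = (\<Sum>k\<in>{m}. c k * M k)"
        by (rule sum.mono_neutral_right) (use True z in auto)
      also have "\<dots> = Beta (\<beta> + 1) (\<alpha> + 1) * jacobi_norm m \<alpha> \<beta>"
        using True by (simp add: c_def M_def jacobi_norm_def pochhammer_same mult_2 power_mult_distrib[symmetric])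
      finally show ?thesis using True by simp
    qed
  qed
  ultimately show ?thesis by simp
qed

lemma jacobi_orthogonal:
  assumes "\<alpha> > -1" "\<beta> > -1"
  shows "has_bochner_integral lborel (\<lambda>u. beta_density \<alpha> \<beta> u * (jacobi m \<alpha> \<beta> (2 * u - 1) * jacobi m' \<alpha> \<beta> (2 * u - 1)))
     (if m = m' then Beta (\<beta> + 1) (\<alpha> + 1) * jacobi_norm m \<alpha> \<beta> else 0)"
proof (cases "m' \<le> m")
  case False
  then have "m \<le> m'" "m \<noteq> m'" by auto
  then show ?thesis using jacobi_orthogonal_le[OF assms, of m m'] by (simp add: mult.commute)
qed (rule jacobi_orthogonal_le[OF assms])

section \<open>The simplex as the image of a cube\<close>

lemma measurable_jacobi [measurable (raw)]:
  assumes "f \<in> borel_measurable M"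
  shows "(\<lambda>x. jacobi m \<alpha> \<beta> (f x)) \<in> borel_measurable M"
proof -
  have "continuous_on UNIV (jacobi m \<alpha> \<beta>)"
    unfolding jacobi_def[abs_def] by (intro continuous_intros) simp
  then show ?thesis
    by (intro measurable_compose[OF assms] borel_measurable_continuous_onI)
qed

definition lborel3 :: "(nat \<Rightarrow> real) measure" where
  "lborel3 = Pi\<^sub>M {1..3} (\<lambda>_. lborel)"

definition triple :: "real \<Rightarrow> real \<Rightarrow> real \<Rightarrow> nat \<Rightarrow> real" where
  "triple a b c = (\<lambda>i\<in>{1..3}. if i = 1 then a else if i = 2 then b else c)"

lemma triple_simps [simp]: "triple a b c 1 = a" "triple a b c (Suc 0) = a" "triple a b c 2 = b" "triple a b c 3 = c"
  by (simp_all add: triple_def)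

lemma triple_measurable [measurable (raw)]:
  assumes "f \<in> borel_measurable M" "g \<in> borel_measurable M" "h \<in> borel_measurable M"
  shows "(\<lambda>x. triple (f x) (g x) (h x)) \<in> measurable M lborel3"
  unfolding triple_def lborel3_def by (rule measurable_restrict) (use assms in \<open>auto\<close>)

lemma triple_upd: "(\<lambda>_. undefined)(1 := a, 2 := b, 3 := c) = triple a b c"
proof
  fix i :: nat
  consider "i = 1" | "i = 2" | "i = 3" | "i \<notin> {1..3}" unfolding atLeastAtMost_iff by linarith
  then show "((\<lambda>_. undefined)(1 := a, 2 := b, 3 := c)) i = triple a b c i"
    by cases (auto simp: triple_def)
qed

lemma component_measurable [measurable]:
  "(\<lambda>x. x 1) \<in> borel_measurable lborel3" "(\<lambda>x. x (Suc 0)) \<in> borel_measurable lborel3"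
  "(\<lambda>x. x 2) \<in> borel_measurable lborel3" "(\<lambda>x. x 3) \<in> borel_measurable lborel3"
proof -
  have "(\<lambda>x. x i) \<in> borel_measurable lborel3" if "i \<in> {1..3}" for i
    using measurable_component_singleton[OF that, of "\<lambda>_. lborel"] by (simp add: lborel3_def)
  then show "(\<lambda>x. x 1) \<in> borel_measurable lborel3" "(\<lambda>x. x (Suc 0)) \<in> borel_measurable lborel3"
  "(\<lambda>x. x 2) \<in> borel_measurable lborel3" "(\<lambda>x. x 3) \<in> borel_measurable lborel3"
    by auto
qed

lemma nn_integral_lborel3:
  assumes F[measurable]: "F \<in> borel_measurable lborel3"
  shows "(\<integral>\<^sup>+ x. F x \<partial>lborel3) = (\<integral>\<^sup>+ a. \<integral>\<^sup>+ b. \<integral>\<^sup>+ c. F (triple a b c) \<partial>lborel \<partial>lborel \<partial>lborel)"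
proof -
  interpret product_sigma_finite "\<lambda>_::nat. lborel :: real measure" by standard
  have I: "{1..3} = insert 3 (insert 2 (insert (1::nat) {}))" by auto
  have F3: "F \<in> borel_measurable (Pi\<^sub>M (insert 3 (insert 2 (insert 1 {}))) (\<lambda>_. lborel))"
    using F unfolding lborel3_def I .
  define G where "G x = (\<integral>\<^sup>+ c. F (x(3 := c)) \<partial>lborel)" for x
  define H where "H x = (\<integral>\<^sup>+ b. G (x(2 := b)) \<partial>lborel)" for x
  have G: "G \<in> borel_measurable (Pi\<^sub>M (insert 2 (insert 1 {})) (\<lambda>_. lborel))"
    unfolding G_def
    by (rule lborel.borel_measurable_nn_integral)
      (use measurable_comp[OF measurable_add_dim F3] in \<open>simp add: comp_def case_prod_beta'\<close>)
  have H: "H \<in> borel_measurable (Pi\<^sub>M (insert 1 {}) (\<lambda>_. lborel))"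
    unfolding H_def
    by (rule lborel.borel_measurable_nn_integral)
      (use measurable_comp[OF measurable_add_dim G] in \<open>simp add: comp_def case_prod_beta'\<close>)
  have "(\<integral>\<^sup>+ x. F x \<partial>lborel3) = (\<integral>\<^sup>+ x. G x \<partial>Pi\<^sub>M (insert 2 (insert 1 {})) (\<lambda>_. lborel))"
    unfolding lborel3_def I G_def by (rule product_nn_integral_insert[OF _ _ F3]) auto
  also have "\<dots> = (\<integral>\<^sup>+ x. H x \<partial>Pi\<^sub>M (insert 1 {}) (\<lambda>_. lborel))"
    unfolding H_def by (rule product_nn_integral_insert[OF _ _ G]) auto
  also have "\<dots> = (\<integral>\<^sup>+ x. \<integral>\<^sup>+ a. H (x(1 := a)) \<partial>lborel \<partial>Pi\<^sub>M {} (\<lambda>_. lborel))"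
    by (rule product_nn_integral_insert[OF _ _ H]) auto
  also have "\<dots> = (\<integral>\<^sup>+ a. H ((\<lambda>_. undefined)(1 := a)) \<partial>lborel)"
    by (rule nn_integral_empty) simp
  finally show ?thesis by (simp only: G_def H_def triple_upd)
qed

definition open_simplex :: "(nat \<Rightarrow> real) \<Rightarrow> bool" where
  "open_simplex x \<longleftrightarrow> 0 < x 1 \<and> 0 < x 2 \<and> 0 < x 3 \<and> x 1 + x 2 + x 3 < 1"

definition open_cube :: "(nat \<Rightarrow> real) \<Rightarrow> bool" where
  "open_cube u \<longleftrightarrow> 0 < u 1 \<and> u 1 < 1 \<and> 0 < u 2 \<and> u 2 < 1 \<and> 0 < u 3 \<and> u 3 < 1"

text \<open>
  In these coordinates the arguments \<open>2 x\<^sub>j / (1 - |x\<^sub>j\<^sub>-\<^sub>1|) - 1\<close> of the Jacobi polynomials become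
  \<open>2 u\<^sub>j - 1\<close>, and the integrals over the simplex become products of three integrals.
\<close>

definition cube_to_simplex :: "(nat \<Rightarrow> real) \<Rightarrow> nat \<Rightarrow> real" where
  "cube_to_simplex u = triple (u 1) ((1 - u 1) * u 2) ((1 - u 1) * (1 - u 2) * u 3)"

definition cube_jacobian :: "(nat \<Rightarrow> real) \<Rightarrow> real" where
  "cube_jacobian u = (1 - u 1)\<^sup>2 * (1 - u 2)"

lemma [measurable]: "Measurable.pred lborel3 open_simplex" "Measurable.pred lborel3 open_cube"
  unfolding open_simplex_def[abs_def] open_cube_def[abs_def] by measurable

lemma [measurable]: "cube_to_simplex \<in> measurable lborel3 lborel3" "cube_jacobian \<in> borel_measurable lborel3"
  unfolding cube_to_simplex_def[abs_def] cube_jacobian_def[abs_def] by measurable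

text \<open>
  Two affine substitutions in the iterated integral: \<open>x\<^sub>2 = (1 - a) v\<close> for fixed \<open>x\<^sub>1 = a\<close>, and
  \<open>x\<^sub>3 = (1 - a) (1 - v) w\<close> for fixed \<open>x\<^sub>1, x\<^sub>2\<close>.
\<close>

lemma nn_integral_simplex:
  assumes F[measurable]: "F \<in> borel_measurable lborel3"
  shows "(\<integral>\<^sup>+ x. (if open_simplex x then F x else 0) \<partial>lborel3) =
         (\<integral>\<^sup>+ u. (if open_cube u then ennreal (cube_jacobian u) * F (cube_to_simplex u) else 0) \<partial>lborel3)"
proof -
  have inner: "(\<integral>\<^sup>+ b. \<integral>\<^sup>+ c. (if open_simplex (triple a b c) then F (triple a b c) else 0) \<partial>lborel \<partial>lborel) =
     (\<integral>\<^sup>+ v. \<integral>\<^sup>+ w. (if open_cube (triple a v w) then ennreal (cube_jacobian (triple a v w)) * F (cube_to_simplex (triple a v w)) else 0) \<partial>lborel \<partial>lborel)" for a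
  proof (cases "0 < a \<and> a < 1")
    case False
    then have "\<not> open_simplex (triple a b c)" "\<not> open_cube (triple a b c)" for b c
      by (auto simp: open_simplex_def open_cube_def)
    then show ?thesis by simp
  next
    case True
    have 1: "(\<integral>\<^sup>+ c. (if open_simplex (triple a ((1 - a) * v) c) then F (triple a ((1 - a) * v) c) else 0) \<partial>lborel) =
       (\<integral>\<^sup>+ w. (if open_cube (triple a v w) then ennreal ((1 - a) * (1 - v)) * F (cube_to_simplex (triple a v w)) else 0) \<partial>lborel)" for v
    proof (cases "0 < v \<and> v < 1")
      case False
      have "\<not> open_simplex (triple a ((1 - a) * v) c)" "\<not> open_cube (triple a v c)" for c
      proof -
        have "(1 - a) * v \<le> 0 \<or> (1 - a) * v \<ge> 1 - a"
          using True False by (cases "v \<le> 0") (auto simp: mult_le_0_iff)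
        then show "\<not> open_simplex (triple a ((1 - a) * v) c)" "\<not> open_cube (triple a v c)"
          using False by (auto simp: open_simplex_def open_cube_def)
      qed
      then show ?thesis by simp
    next
      case v: True
      define k where "k = (1 - a) * (1 - v)"
      have k: "k > 0" using True v by (simp add: k_def)
      have "(\<integral>\<^sup>+ c. (if open_simplex (triple a ((1 - a) * v) c) then F (triple a ((1 - a) * v) c) else 0) \<partial>lborel) =
        ennreal \<bar>k\<bar> * (\<integral>\<^sup>+ w. (if open_simplex (triple a ((1 - a) * v) (0 + k * w)) then F (triple a ((1 - a) * v) (0 + k * w)) else 0) \<partial>lborel)"
        by (rule nn_integral_real_affine) (use k in auto)
      also have "\<dots> = (\<integral>\<^sup>+ w. ennreal k * (if open_simplex (triple a ((1 - a) * v) (0 + k * w)) then F (triple a ((1 - a) * v) (0 + k * w)) else 0) \<partial>lborel)"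
        using k by (subst nn_integral_cmult) auto
      also have "\<dots> = (\<integral>\<^sup>+ w. (if open_cube (triple a v w) then ennreal ((1 - a) * (1 - v)) * F (cube_to_simplex (triple a v w)) else 0) \<partial>lborel)"
      proof (rule nn_integral_cong)
        fix w
        have "a + (1 - a) * v + k * w < 1 \<longleftrightarrow> k * w < k * 1" by (simp add: k_def algebra_simps)
        also have "\<dots> \<longleftrightarrow> w < 1" using k by (simp only: mult_less_cancel_left_pos)
        finally have "open_simplex (triple a ((1 - a) * v) (0 + k * w)) \<longleftrightarrow> open_cube (triple a v w)"
          using True v k by (auto simp: open_simplex_def open_cube_def zero_less_mult_iff)
        then show "ennreal k * (if open_simplex (triple a ((1 - a) * v) (0 + k * w)) then F (triple a ((1 - a) * v) (0 + k * w)) else 0) =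
          (if open_cube (triple a v w) then ennreal ((1 - a) * (1 - v)) * F (cube_to_simplex (triple a v w)) else 0)"
          by (simp add: k_def cube_to_simplex_def)
      qed
      finally show ?thesis .
    qed
    have "(\<integral>\<^sup>+ b. \<integral>\<^sup>+ c. (if open_simplex (triple a b c) then F (triple a b c) else 0) \<partial>lborel \<partial>lborel) =
      ennreal \<bar>1 - a\<bar> * (\<integral>\<^sup>+ v. \<integral>\<^sup>+ c. (if open_simplex (triple a (0 + (1 - a) * v) c) then F (triple a (0 + (1 - a) * v) c) else 0) \<partial>lborel \<partial>lborel)"
      by (rule nn_integral_real_affine) (use True in auto)
    also have "\<dots> = ennreal (1 - a) * (\<integral>\<^sup>+ v. \<integral>\<^sup>+ w. (if open_cube (triple a v w) then ennreal ((1 - a) * (1 - v)) * F (cube_to_simplex (triple a v w)) else 0) \<partial>lborel \<partial>lborel)"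
      using True by (simp only: add_0_left 1 abs_of_pos diff_gt_0_iff_gt)
    also have "\<dots> = (\<integral>\<^sup>+ v. \<integral>\<^sup>+ w. ennreal (1 - a) * (if open_cube (triple a v w) then ennreal ((1 - a) * (1 - v)) * F (cube_to_simplex (triple a v w)) else 0) \<partial>lborel \<partial>lborel)"
      by (simp add: nn_integral_cmult)
    also have "\<dots> = (\<integral>\<^sup>+ v. \<integral>\<^sup>+ w. (if open_cube (triple a v w) then ennreal (cube_jacobian (triple a v w)) * F (cube_to_simplex (triple a v w)) else 0) \<partial>lborel \<partial>lborel)"
    proof (intro nn_integral_cong)
      fix v w
      have "ennreal (1 - a) * ennreal ((1 - a) * (1 - v)) = ennreal (cube_jacobian (triple a v w))" if "v < 1"
        using True that by (simp add: cube_jacobian_def ennreal_mult'[symmetric] power2_eq_square mult_ac)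
      then show "ennreal (1 - a) * (if open_cube (triple a v w) then ennreal ((1 - a) * (1 - v)) * F (cube_to_simplex (triple a v w)) else 0) =
        (if open_cube (triple a v w) then ennreal (cube_jacobian (triple a v w)) * F (cube_to_simplex (triple a v w)) else 0)"
        by (auto simp: open_cube_def mult.assoc[symmetric])
    qed
    finally show ?thesis .
  qed
  show ?thesis by (simp add: nn_integral_lborel3 inner)
qed

text \<open>
  The substitution as an equality of measures, so that it applies to Bochner integrals as well.
\<close>

lemma density_simplex:
  "density lborel3 (\<lambda>x. ennreal (if open_simplex x then 1 else 0)) =
   distr (density lborel3 (\<lambda>u. ennreal (if open_cube u then cube_jacobian u else 0))) lborel3 cube_to_simplex"
proof (rule measure_eqI)
  fix A assume "A \<in> sets (density lborel3 (\<lambda>x. ennreal (if open_simplex x then 1 else 0)))"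
  then have A[measurable]: "A \<in> sets lborel3" by simp
  have "emeasure (density lborel3 (\<lambda>x. ennreal (if open_simplex x then 1 else 0))) A = (\<integral>\<^sup>+ x. (if open_simplex x then indicator A x else 0) \<partial>lborel3)"
    by (subst emeasure_density) (auto intro!: nn_integral_cong)
  also have "\<dots> = (\<integral>\<^sup>+ u. (if open_cube u then ennreal (cube_jacobian u) * indicator A (cube_to_simplex u) else 0) \<partial>lborel3)"
    by (rule nn_integral_simplex) measurable
  also have "\<dots> = emeasure (density lborel3 (\<lambda>u. ennreal (if open_cube u then cube_jacobian u else 0))) (cube_to_simplex -` A \<inter> space lborel3)"
    by (subst emeasure_density) (auto intro!: nn_integral_cong simp: indicator_def)
  also have "\<dots> = emeasure (distr (density lborel3 (\<lambda>u. ennreal (if open_cube u then cube_jacobian u else 0))) lborel3 cube_to_simplex) A"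
    by (subst emeasure_distr) auto
  finally show "emeasure (density lborel3 (\<lambda>x. ennreal (if open_simplex x then 1 else 0))) A =
    emeasure (distr (density lborel3 (\<lambda>u. ennreal (if open_cube u then cube_jacobian u else 0))) lborel3 cube_to_simplex) A" .
qed simp

lemma has_integral_simplex:
  fixes g :: "(nat \<Rightarrow> real) \<Rightarrow> real"
  assumes [measurable]: "g \<in> borel_measurable lborel3"
    and "has_bochner_integral lborel3 (\<lambda>u. (if open_cube u then cube_jacobian u else 0) * g (cube_to_simplex u)) I"
  shows "has_bochner_integral lborel3 (\<lambda>x. (if open_simplex x then 1 else 0) * g x) I"
proof -
  have J: "0 \<le> (if open_cube u then cube_jacobian u else 0)" for u
    by (simp add: open_cube_def cube_jacobian_def)
  have "has_bochner_integral (density lborel3 (\<lambda>u. ennreal (if open_cube u then cube_jacobian u else 0))) (\<lambda>u. g (cube_to_simplex u)) I"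
    by (rule has_bochner_integral_density) (use assms(2) J in auto)
  then have "has_bochner_integral (distr (density lborel3 (\<lambda>u. ennreal (if open_cube u then cube_jacobian u else 0))) lborel3 cube_to_simplex) g I"
    by (intro has_bochner_integral_distr) auto
  then have h: "has_bochner_integral (density lborel3 (\<lambda>x. ennreal (if open_simplex x then 1 else 0))) g I"
    unfolding density_simplex .
  have "integrable (density lborel3 (\<lambda>x. ennreal (if open_simplex x then 1 else 0))) g \<longleftrightarrow> integrable lborel3 (\<lambda>x. (if open_simplex x then 1 else 0) *\<^sub>R g x)"
    by (rule integrable_density) auto
  moreover have "integral\<^sup>L (density lborel3 (\<lambda>x. ennreal (if open_simplex x then 1 else 0))) g = integral\<^sup>L lborel3 (\<lambda>x. (if open_simplex x then 1 else 0) *\<^sub>R g x)"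
    by (rule integral_density) auto
  ultimately show ?thesis using h by (simp add: has_bochner_integral_iff)
qed

lemma simplex_jacobi_three:
  "simplex_jacobi 3 \<nu> \<kappa> x =
     jacobi (\<nu> 1) (\<kappa> 2 + \<kappa> 3 + \<kappa> 4 + 2 * real (\<nu> 2) + 2 * real (\<nu> 3) + 2) (\<kappa> 1) (2 * x 1 - 1) *
     ((1 - x 1) ^ \<nu> 2 * jacobi (\<nu> 2) (\<kappa> 3 + \<kappa> 4 + 2 * real (\<nu> 3) + 1) (\<kappa> 2) (2 * x 2 / (1 - x 1) - 1)) *
     ((1 - (x 1 + x 2)) ^ \<nu> 3 * jacobi (\<nu> 3) (\<kappa> 4) (\<kappa> 3) (2 * x 3 / (1 - (x 1 + x 2)) - 1))"
  by (simp add: simplex_jacobi_def prod_nat_3 sum_nat_intervals algebra_simps del: One_nat_def)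

lemma simplex_weight_three:
  "simplex_weight 3 \<kappa> x = x 1 powr \<kappa> 1 * x 2 powr \<kappa> 2 * x 3 powr \<kappa> 3 * (1 - (x 1 + x 2 + x 3)) powr \<kappa> 4"
  by (simp add: simplex_weight_def prod_nat_3 sum_nat_3 del: One_nat_def)

lemma simplex_jacobi_measurable [measurable]: "simplex_jacobi 3 \<nu> \<kappa> \<in> borel_measurable lborel3"
  unfolding simplex_jacobi_three[abs_def] by measurable

lemma simplex_weight_measurable [measurable]: "simplex_weight 3 \<kappa> \<in> borel_measurable lborel3"
  unfolding simplex_weight_three[abs_def] by measurable

text \<open>
  The boundary of the simplex can be ignored pointwise: there one of the bases in the weight is
  \<open>0\<close>, and \<open>0 powr a = 0\<close> for every exponent, also for \<open>a \<le> 0\<close>.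
\<close>

lemma simplex_indicator_weight:
  "indicator (simplex_set 3) x *\<^sub>R (h * simplex_weight 3 \<kappa> x) = (if open_simplex x then 1 else 0) * (h * simplex_weight 3 \<kappa> x)"
proof (cases "open_simplex x")
  case True
  then have "x \<in> simplex_set 3"
  proof -
    have "0 \<le> x i" if "i \<in> {1..3}" for i
    proof -
      show ?thesis using atLeastAtMost_3_cases[OF that] True by (auto simp: open_simplex_def)
    qed
    then show ?thesis using True by (auto simp: simplex_set_def open_simplex_def sum_nat_3)
  qed
  with True show ?thesis by simp
next
  case False
  show ?thesis
  proof (cases "x \<in> simplex_set 3")
    case True
    then have "x 1 = 0 \<or> x 2 = 0 \<or> x 3 = 0 \<or> x 1 + x 2 + x 3 = 1"
      using False by (auto simp: simplex_set_def open_simplex_def sum_nat_3 less_le)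
    then have "simplex_weight 3 \<kappa> x = 0" by (auto simp: simplex_weight_three)
    then show ?thesis by simp
  qed (use False in simp)
qed

section \<open>Orthogonality on the simplex\<close>

lemma has_integral_lborel3_product:
  assumes "has_bochner_integral lborel f1 I1" "has_bochner_integral lborel f2 I2" "has_bochner_integral lborel f3 (I3 :: real)"
  shows "has_bochner_integral lborel3 (\<lambda>u. f1 (u 1) * f2 (u 2) * f3 (u 3)) (I1 * I2 * I3)"
proof -
  interpret product_sigma_finite "\<lambda>_::nat. lborel :: real measure" by standard
  define f where "f i = (if i = 1 then f1 else if i = 2 then f2 else f3)" for i :: nat
  have i: "integrable lborel (f i)" for i using assms by (auto simp: f_def has_bochner_integral_iff)
  have e: "(\<lambda>u. f1 (u 1) * f2 (u 2) * f3 (u 3)) = (\<lambda>u. \<Prod>i\<in>{1..3}. f i (u i))"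
    unfolding prod_nat_3 by (simp add: f_def)
  have "integrable lborel3 (\<lambda>u. \<Prod>i\<in>{1..3}. f i (u i))"
    unfolding lborel3_def by (rule product_integrable_prod) (use i in auto)
  moreover have "integral\<^sup>L lborel3 (\<lambda>u. \<Prod>i\<in>{1..3}. f i (u i)) = (\<Prod>i\<in>{1..3}. integral\<^sup>L lborel (f i))"
    unfolding lborel3_def by (rule product_integral_prod) (use i in auto)
  moreover have "(\<Prod>i\<in>{1..3}. integral\<^sup>L lborel (f i)) = I1 * I2 * I3"
    unfolding prod_nat_3 using assms by (simp add: f_def has_bochner_integral_iff)
  ultimately show ?thesis unfolding e by (simp only: has_bochner_integral_iff simp_thms)
qed

text \<open>
  The factors into which the integrand splits in the coordinates of the cube. The parameters \<open>\<alpha>\<close> and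
  \<open>\<alpha>'\<close> of the two polynomials and the exponent \<open>\<gamma>\<close> of the density differ in general; they coincide if
  the indices of the variables behind agree.
\<close>

definition jacobi_factor :: "nat \<Rightarrow> nat \<Rightarrow> real \<Rightarrow> real \<Rightarrow> real \<Rightarrow> real \<Rightarrow> real \<Rightarrow> real" where
  "jacobi_factor m m' \<alpha> \<alpha>' \<gamma> \<beta> u = beta_density \<gamma> \<beta> u * (jacobi m \<alpha> \<beta> (2 * u - 1) * jacobi m' \<alpha>' \<beta> (2 * u - 1))"

text \<open>
  Collecting the powers of \<open>p = 1 - u\<^sub>1\<close>, \<open>q = 1 - u\<^sub>2\<close> and \<open>r = 1 - u\<^sub>3\<close> from the Jacobian, the
  polynomials and the weight.
\<close>

lemma simplex_integrand_factors:
  "(if open_cube u then cube_jacobian u else 0) *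
     (simplex_jacobi 3 \<nu> \<kappa> (cube_to_simplex u) * simplex_jacobi 3 \<nu>' \<kappa> (cube_to_simplex u) * simplex_weight 3 \<kappa> (cube_to_simplex u)) =
   jacobi_factor (\<nu> 1) (\<nu>' 1) (\<kappa> 2 + \<kappa> 3 + \<kappa> 4 + 2 * real (\<nu> 2) + 2 * real (\<nu> 3) + 2) (\<kappa> 2 + \<kappa> 3 + \<kappa> 4 + 2 * real (\<nu>' 2) + 2 * real (\<nu>' 3) + 2)
     (\<kappa> 2 + \<kappa> 3 + \<kappa> 4 + real (\<nu> 2) + real (\<nu>' 2) + real (\<nu> 3) + real (\<nu>' 3) + 2) (\<kappa> 1) (u 1) *
   jacobi_factor (\<nu> 2) (\<nu>' 2) (\<kappa> 3 + \<kappa> 4 + 2 * real (\<nu> 3) + 1) (\<kappa> 3 + \<kappa> 4 + 2 * real (\<nu>' 3) + 1)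
     (\<kappa> 3 + \<kappa> 4 + real (\<nu> 3) + real (\<nu>' 3) + 1) (\<kappa> 2) (u 2) *
   jacobi_factor (\<nu> 3) (\<nu>' 3) (\<kappa> 4) (\<kappa> 4) (\<kappa> 4) (\<kappa> 3) (u 3)"
proof (cases "open_cube u")
  case False
  then show ?thesis by (auto simp: open_cube_def jacobi_factor_def beta_density_def)
next
  case True
  define a where "a = u 1"
  define b where "b = u 2"
  define c where "c = u 3"
  define p where "p = 1 - a"
  define q where "q = 1 - b"
  define r where "r = 1 - c"
  have abc: "0 < a" "0 < b" "0 < c" "0 < p" "0 < q" "0 < r"
    using True by (auto simp: open_cube_def a_def b_def c_def p_def q_def r_def)
  have x: "cube_to_simplex u 1 = a" "cube_to_simplex u 2 = p * b" "cube_to_simplex u 3 = p * q * c"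
    by (simp_all add: cube_to_simplex_def a_def b_def c_def p_def q_def)
  have y: "1 - a = p" "1 - (a + p * b) = p * q" "1 - (a + p * b + p * q * c) = p * q * r"
    by (simp_all add: p_def q_def r_def algebra_simps)
  have z: "2 * (p * b) / p - 1 = 2 * b - 1" "2 * (p * q * c) / (p * q) - 1 = 2 * c - 1"
    using abc by simp_all
  have bd: "beta_density \<alpha> \<beta> a = a powr \<beta> * p powr \<alpha>" "beta_density \<alpha> \<beta> b = b powr \<beta> * q powr \<alpha>"
     "beta_density \<alpha> \<beta> c = c powr \<beta> * r powr \<alpha>" for \<alpha> \<beta>
    using abc by (simp_all add: beta_density_def p_def q_def r_def)
  have P: "p ^ 2 * (p ^ \<nu> 2 * p ^ \<nu> 3) * (p ^ \<nu>' 2 * p ^ \<nu>' 3) * (p powr \<kappa> 2 * p powr \<kappa> 3 * p powr \<kappa> 4) =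
     p powr (\<kappa> 2 + \<kappa> 3 + \<kappa> 4 + real (\<nu> 2) + real (\<nu>' 2) + real (\<nu> 3) + real (\<nu>' 3) + 2)"
    using abc by (simp add: powr_add powr_realpow powr_numeral)
  have Q: "q * q ^ \<nu> 3 * q ^ \<nu>' 3 * (q powr \<kappa> 3 * q powr \<kappa> 4) = q powr (\<kappa> 3 + \<kappa> 4 + real (\<nu> 3) + real (\<nu>' 3) + 1)"
    using abc by (simp add: powr_add powr_realpow)
  have W: "simplex_weight 3 \<kappa> (cube_to_simplex u) =
    (a powr \<kappa> 1 * b powr \<kappa> 2 * c powr \<kappa> 3) * (p powr \<kappa> 2 * p powr \<kappa> 3 * p powr \<kappa> 4) * (q powr \<kappa> 3 * q powr \<kappa> 4) * r powr \<kappa> 4"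
    unfolding simplex_weight_three x y using abc by (simp add: powr_mult)
  have J: "(if open_cube u then cube_jacobian u else 0) = p ^ 2 * q"
    using True by (simp add: cube_jacobian_def p_def q_def a_def b_def)
  show ?thesis
    unfolding J W simplex_jacobi_three x y z jacobi_factor_def a_def[symmetric] b_def[symmetric] c_def[symmetric] bd P[symmetric] Q[symmetric]
    by (simp only: power_mult_distrib mult_ac)
qed

lemma jacobi_factor_integrable:
  assumes "\<gamma> > -1" "\<beta> > -1"
  shows "integrable lborel (jacobi_factor m m' \<alpha> \<alpha>' \<gamma> \<beta>)"
  unfolding jacobi_factor_def[abs_def]
  by (intro beta_density_times_continuous_integrable assms continuous_on_mult continuous_on_jacobi)

lemma jacobi_factor_integral:
  assumes "\<gamma> > -1" "\<beta> > -1" "\<alpha> = \<gamma>" "\<alpha>' = \<gamma>"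
  shows "has_bochner_integral lborel (jacobi_factor m m' \<alpha> \<alpha>' \<gamma> \<beta>) (if m = m' then Beta (\<beta> + 1) (\<gamma> + 1) * jacobi_norm m \<gamma> \<beta> else 0)"
  unfolding jacobi_factor_def[abs_def] assms(3,4) by (rule jacobi_orthogonal[OF assms(1,2)])

text \<open>
  The integral of the weight, that is, the Dirichlet integral.
\<close>

definition simplex_mass :: "(nat \<Rightarrow> real) \<Rightarrow> real" where
  "simplex_mass \<kappa> = (\<Prod>i=1..4. Gamma (\<kappa> i + 1)) / Gamma ((\<Sum>i=1..4. \<kappa> i) + 4)"

lemma norm_formula_Beta:
  fixes \<nu> :: "nat \<Rightarrow> nat"
  assumes adm: "admissible \<kappa>"
  defines "a1 \<equiv> \<kappa> 2 + \<kappa> 3 + \<kappa> 4 + 2 * real (\<nu> 2) + 2 * real (\<nu> 3) + 2" and "a2 \<equiv> \<kappa> 3 + \<kappa> 4 + 2 * real (\<nu> 3) + 1"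
  shows "Beta (\<kappa> 1 + 1) (a1 + 1) * jacobi_norm (\<nu> 1) a1 (\<kappa> 1) * (Beta (\<kappa> 2 + 1) (a2 + 1) * jacobi_norm (\<nu> 2) a2 (\<kappa> 2)) *
     (Beta (\<kappa> 3 + 1) (\<kappa> 4 + 1) * jacobi_norm (\<nu> 3) (\<kappa> 4) (\<kappa> 3)) = simplex_mass \<kappa> * norm_formula \<nu> \<kappa>"
proof -
  note \<kappa> = admissibleD[OF adm]
  define s3 where "s3 = \<kappa> 3 + \<kappa> 4 + 2"
  define s2 where "s2 = \<kappa> 2 + \<kappa> 3 + \<kappa> 4 + 3"
  define s1 where "s1 = \<kappa> 1 + \<kappa> 2 + \<kappa> 3 + \<kappa> 4 + 4"
  define p where "p = 2 * \<nu> 3"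
  define q where "q = 2 * \<nu> 2"
  define r where "r = 2 * \<nu> 1"
  have s: "s1 > 0" "s2 > 0" "s3 > 0" using \<kappa> by (simp_all add: s1_def s2_def s3_def)
  have G: "Gamma (s + real m) = Gamma s * pochhammer s m" "Gamma s > 0" if "s > 0" for s :: real and m
  proof -
    have "s \<notin> \<int>\<^sub>\<le>\<^sub>0" using that by auto
    then show "Gamma (s + real m) = Gamma s * pochhammer s m"
      using that by (simp add: pochhammer_Gamma Gamma_eq_zero_iff)
  qed (use that in \<open>simp add: Gamma_real_pos\<close>)
  have e: "a1 + 1 = s2 + real (p + q)" "\<kappa> 1 + 1 + (s2 + real (p + q)) = s1 + real (p + q)" "a2 + 1 = s3 + real p" "\<kappa> 2 + 1 + (s3 + real p) = s2 + real p"
     "\<kappa> 3 + 1 + (\<kappa> 4 + 1) = s3" "a1 + \<kappa> 1 + 2 = s1 + real (p + q)" "a2 + \<kappa> 2 + 2 = s2 + real p" "\<kappa> 4 + \<kappa> 3 + 2 = s3"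
    by (simp_all add: a1_def a2_def s1_def s2_def s3_def p_def q_def)
  have M: "simplex_mass \<kappa> = Gamma (\<kappa> 1 + 1) * Gamma (\<kappa> 2 + 1) * Gamma (\<kappa> 3 + 1) * Gamma (\<kappa> 4 + 1) / Gamma s1"
    by (simp add: simplex_mass_def prod_nat_4 sum_nat_intervals s1_def add_ac del: One_nat_def)
  have nz: "Gamma s1 > 0" "Gamma s2 > 0" "Gamma s3 > 0" "pochhammer s2 p > 0" "pochhammer s3 p > 0" "pochhammer s2 (p + q) > 0"
    "pochhammer s1 (p + q) > 0" "pochhammer (s2 + real p) q > 0" "pochhammer (s1 + real (p + q)) r > 0"
    using s by (auto intro!: G(2) pochhammer_pos)
  define N1 where "N1 = pochhammer (a1 + 1) (\<nu> 1) * pochhammer (\<kappa> 1 + 1) (\<nu> 1) * pochhammer (real (\<nu> 1) + a1 + \<kappa> 1 + 1) (\<nu> 1) / fact (\<nu> 1)"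
  define N2 where "N2 = pochhammer (a2 + 1) (\<nu> 2) * pochhammer (\<kappa> 2 + 1) (\<nu> 2) * pochhammer (real (\<nu> 2) + a2 + \<kappa> 2 + 1) (\<nu> 2) / fact (\<nu> 2)"
  define N3 where "N3 = pochhammer (\<kappa> 4 + 1) (\<nu> 3) * pochhammer (\<kappa> 3 + 1) (\<nu> 3) * pochhammer (real (\<nu> 3) + \<kappa> 4 + \<kappa> 3 + 1) (\<nu> 3) / fact (\<nu> 3)"
  have J: "jacobi_norm (\<nu> 1) a1 (\<kappa> 1) = N1 / pochhammer (s1 + real (p + q)) r"
     "jacobi_norm (\<nu> 2) a2 (\<kappa> 2) = N2 / pochhammer (s2 + real p) q" "jacobi_norm (\<nu> 3) (\<kappa> 4) (\<kappa> 3) = N3 / pochhammer s3 p"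
    unfolding jacobi_norm_def e N1_def N2_def N3_def p_def q_def r_def by simp_all
  have B: "Beta (\<kappa> 1 + 1) (a1 + 1) = Gamma (\<kappa> 1 + 1) * (Gamma s2 * pochhammer s2 (p + q)) / (Gamma s1 * pochhammer s1 (p + q))"
    "Beta (\<kappa> 2 + 1) (a2 + 1) = Gamma (\<kappa> 2 + 1) * (Gamma s3 * pochhammer s3 p) / (Gamma s2 * pochhammer s2 p)"
    "Beta (\<kappa> 3 + 1) (\<kappa> 4 + 1) = Gamma (\<kappa> 3 + 1) * Gamma (\<kappa> 4 + 1) / Gamma s3"
    unfolding Beta_def e G(1)[OF s(1)] G(1)[OF s(2)] G(1)[OF s(3)] by simp_all
  have F: "norm_formula \<nu> \<kappa> = N3 * N2 * N1 / pochhammer s1 (p + q + r)"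
  proof -
    have "\<kappa> 3 + \<kappa> 4 + 1 + real (\<nu> 3) = real (\<nu> 3) + \<kappa> 4 + \<kappa> 3 + 1" "\<kappa> 3 + \<kappa> 4 + 2 * real (\<nu> 3) + 2 = a2 + 1"
      "\<kappa> 2 + \<kappa> 3 + \<kappa> 4 + 2 * real (\<nu> 3) + 2 + real (\<nu> 2) = real (\<nu> 2) + a2 + \<kappa> 2 + 1"
      "\<kappa> 2 + \<kappa> 3 + \<kappa> 4 + 2 * real (\<nu> 2) + 2 * real (\<nu> 3) + 3 = a1 + 1"
      "\<kappa> 1 + \<kappa> 2 + \<kappa> 3 + \<kappa> 4 + 2 * real (\<nu> 2) + 2 * real (\<nu> 3) + 3 + real (\<nu> 1) = real (\<nu> 1) + a1 + \<kappa> 1 + 1"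
      "2 * (\<nu> 1 + \<nu> 2 + \<nu> 3) = p + q + r"
      by (simp_all add: a1_def a2_def p_def q_def r_def)
    then show ?thesis unfolding norm_formula_def N1_def N2_def N3_def by (simp only: s1_def)
  qed
  have split: "pochhammer s2 (p + q) = pochhammer s2 p * pochhammer (s2 + real p) q"
     "pochhammer s1 (p + q + r) = pochhammer s1 (p + q) * pochhammer (s1 + real (p + q)) r"
    by (rule pochhammer_product')+
  show ?thesis
    unfolding B J F M split using nz by simp
qed

text \<open>
  The three integrals are treated from the last to the first. If the third indices differ, the last
  one vanishes; if they agree, the parameters of the second factor coincide, and so on.
\<close>

theorem simplex_jacobi_orthogonal:
  assumes adm: "admissible \<kappa>"
  shows "has_bochner_integral lborel3
    (\<lambda>x. indicator (simplex_set 3) x *\<^sub>R (simplex_jacobi 3 \<nu> \<kappa> x * simplex_jacobi 3 \<nu>' \<kappa> x * simplex_weight 3 \<kappa> x))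
    (if \<nu> 1 = \<nu>' 1 \<and> \<nu> 2 = \<nu>' 2 \<and> \<nu> 3 = \<nu>' 3 then simplex_mass \<kappa> * norm_formula \<nu> \<kappa> else 0)" (is "has_bochner_integral _ _ ?R")
  unfolding simplex_indicator_weight
proof (rule has_integral_simplex)
  show "(\<lambda>x. simplex_jacobi 3 \<nu> \<kappa> x * simplex_jacobi 3 \<nu>' \<kappa> x * simplex_weight 3 \<kappa> x) \<in> borel_measurable lborel3"
    by measurable
  note \<kappa> = admissibleD[OF adm]
  define f1 where "f1 = jacobi_factor (\<nu> 1) (\<nu>' 1) (\<kappa> 2 + \<kappa> 3 + \<kappa> 4 + 2 * real (\<nu> 2) + 2 * real (\<nu> 3) + 2) (\<kappa> 2 + \<kappa> 3 + \<kappa> 4 + 2 * real (\<nu>' 2) + 2 * real (\<nu>' 3) + 2)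
     (\<kappa> 2 + \<kappa> 3 + \<kappa> 4 + real (\<nu> 2) + real (\<nu>' 2) + real (\<nu> 3) + real (\<nu>' 3) + 2) (\<kappa> 1)"
  define f2 where "f2 = jacobi_factor (\<nu> 2) (\<nu>' 2) (\<kappa> 3 + \<kappa> 4 + 2 * real (\<nu> 3) + 1) (\<kappa> 3 + \<kappa> 4 + 2 * real (\<nu>' 3) + 1)
     (\<kappa> 3 + \<kappa> 4 + real (\<nu> 3) + real (\<nu>' 3) + 1) (\<kappa> 2)"
  define f3 where "f3 = jacobi_factor (\<nu> 3) (\<nu>' 3) (\<kappa> 4) (\<kappa> 4) (\<kappa> 4) (\<kappa> 3)"
  have i1: "has_bochner_integral lborel f1 (integral\<^sup>L lborel f1)"
    unfolding f1_def by (intro has_bochner_integral_integrable jacobi_factor_integrable) (use \<kappa> in auto)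
  have i2: "has_bochner_integral lborel f2 (integral\<^sup>L lborel f2)"
    unfolding f2_def by (intro has_bochner_integral_integrable jacobi_factor_integrable) (use \<kappa> in auto)
  have i3: "has_bochner_integral lborel f3 (if \<nu> 3 = \<nu>' 3 then Beta (\<kappa> 3 + 1) (\<kappa> 4 + 1) * jacobi_norm (\<nu> 3) (\<kappa> 4) (\<kappa> 3) else 0)"
    unfolding f3_def by (rule jacobi_factor_integral) (use \<kappa> in auto)
  have "has_bochner_integral lborel3 (\<lambda>u. f1 (u 1) * f2 (u 2) * f3 (u 3)) ?R"
  proof (cases "\<nu> 3 = \<nu>' 3")
    case False
    then show ?thesis using has_integral_lborel3_product[OF i1 i2 i3] by simp
  next
    case eq3: True
    define a2 where "a2 = \<kappa> 3 + \<kappa> 4 + 2 * real (\<nu> 3) + 1"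
    have i2': "has_bochner_integral lborel f2 (if \<nu> 2 = \<nu>' 2 then Beta (\<kappa> 2 + 1) (a2 + 1) * jacobi_norm (\<nu> 2) a2 (\<kappa> 2) else 0)"
    proof -
      have "\<kappa> 3 + \<kappa> 4 + real (\<nu> 3) + real (\<nu>' 3) + 1 = a2" using eq3 by (simp add: a2_def)
      then show ?thesis unfolding f2_def by (simp only:) (rule jacobi_factor_integral, use \<kappa> eq3 in \<open>auto simp: a2_def\<close>)
    qed
    show ?thesis
    proof (cases "\<nu> 2 = \<nu>' 2")
      case False
      then show ?thesis using has_integral_lborel3_product[OF i1 i2' i3] by simp
    next
      case eq2: True
      define a1 where "a1 = \<kappa> 2 + \<kappa> 3 + \<kappa> 4 + 2 * real (\<nu> 2) + 2 * real (\<nu> 3) + 2"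
      have i1': "has_bochner_integral lborel f1 (if \<nu> 1 = \<nu>' 1 then Beta (\<kappa> 1 + 1) (a1 + 1) * jacobi_norm (\<nu> 1) a1 (\<kappa> 1) else 0)"
      proof -
        have "\<kappa> 2 + \<kappa> 3 + \<kappa> 4 + real (\<nu> 2) + real (\<nu>' 2) + real (\<nu> 3) + real (\<nu>' 3) + 2 = a1" using eq2 eq3 by (simp add: a1_def)
        then show ?thesis unfolding f1_def by (simp only:) (rule jacobi_factor_integral, use \<kappa> eq2 eq3 in \<open>auto simp: a1_def\<close>)
      qed
      show ?thesis
        using has_integral_lborel3_product[OF i1' i2' i3] norm_formula_Beta[OF adm, of \<nu>] eq2 eq3
        by (simp add: a1_def a2_def split: if_splits)
    qed
  qed
  then show "has_bochner_integral lborel3 (\<lambda>u. (if open_cube u then cube_jacobian u else 0) *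
      (simplex_jacobi 3 \<nu> \<kappa> (cube_to_simplex u) * simplex_jacobi 3 \<nu>' \<kappa> (cube_to_simplex u) * simplex_weight 3 \<kappa> (cube_to_simplex u))) ?R"
    unfolding simplex_integrand_factors f1_def f2_def f3_def .
qed

lemma simplex_mass_pos:
  assumes adm: "admissible \<kappa>"
  shows "simplex_mass \<kappa> > 0"
proof -
  note \<kappa> = admissibleD[OF adm]
  have "(\<Prod>i=1..4. Gamma (\<kappa> i + 1)) > 0"
    unfolding prod_nat_4 using \<kappa> by (intro mult_pos_pos Gamma_real_pos) auto
  moreover have "(\<Sum>i=1..4. \<kappa> i) + 4 > 0" using \<kappa> unfolding sum_nat_intervals by simp
  ultimately show ?thesis
    unfolding simplex_mass_def by (intro divide_pos_pos Gamma_real_pos)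
qed

lemma simplex_inner_lborel3:
  "simplex_inner 3 \<kappa> f g = integral\<^sup>L lborel3 (\<lambda>x. indicator (simplex_set 3) x *\<^sub>R (f x * g x * simplex_weight 3 \<kappa> x)) / simplex_mass \<kappa>"
  by (simp add: simplex_inner_def simplex_mass_def set_lebesgue_integral_def lborel3_def add.commute[of 4] del: One_nat_def)

lemma simplex_inner_jacobi:
  assumes adm: "admissible \<kappa>"
  shows "simplex_inner 3 \<kappa> (simplex_jacobi 3 \<nu> \<kappa>) (simplex_jacobi 3 \<nu>' \<kappa>) =
    (if \<nu> 1 = \<nu>' 1 \<and> \<nu> 2 = \<nu>' 2 \<and> \<nu> 3 = \<nu>' 3 then norm_formula \<nu> \<kappa> else 0)"
  using simplex_jacobi_orthogonal[OF adm, of \<nu> \<nu>'] simplex_mass_pos[OF adm]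
  by (auto simp: simplex_inner_lborel3 has_bochner_integral_iff)

lemma simplex_sqnorm_eq:
  assumes "admissible \<kappa>"
  shows "simplex_sqnorm 3 \<nu> \<kappa> = norm_formula \<nu> \<kappa>"
  using simplex_inner_jacobi[OF assms, of \<nu> \<nu>] by (simp add: simplex_sqnorm_def)

text \<open>
  Both measures agree on boxes.
\<close>

lemma lborel3_permute: "distr lborel3 lborel3 (\<lambda>x. triple (x 2) (x 3) (x 1)) = lborel3"
proof -
  interpret product_sigma_finite "\<lambda>_::nat. lborel :: real measure" by standard
  have m: "(\<lambda>x. triple (x 2) (x 3) (x 1)) \<in> measurable lborel3 lborel3" by measurable
  have "distr lborel3 lborel3 (\<lambda>x. triple (x 2) (x 3) (x 1)) = Pi\<^sub>M {1..3} (\<lambda>_. lborel)"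
  proof (rule PiM_eqI)
    fix A :: "nat \<Rightarrow> real set" assume A: "\<And>i. i \<in> {1..3} \<Longrightarrow> A i \<in> sets lborel"
    define B where "B i = (if i = 1 then A 3 else if i = 2 then A 1 else A 2)" for i :: nat
    have PA: "Pi\<^sub>E {1..3} A \<in> sets lborel3" unfolding lborel3_def by (rule sets_PiM_I_finite) (use A in auto)
    have "emeasure (distr lborel3 lborel3 (\<lambda>x. triple (x 2) (x 3) (x 1))) (Pi\<^sub>E {1..3} A) =
      emeasure lborel3 ((\<lambda>x. triple (x 2) (x 3) (x 1)) -` Pi\<^sub>E {1..3} A \<inter> space lborel3)"
      by (rule emeasure_distr[OF m PA])
    also have "(\<lambda>x. triple (x 2) (x 3) (x 1)) -` Pi\<^sub>E {1..3} A \<inter> space lborel3 = Pi\<^sub>E {1..3} B"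
    proof (intro set_eqI iffI)
      fix x assume x: "x \<in> (\<lambda>x. triple (x 2) (x 3) (x 1)) -` Pi\<^sub>E {1..3} A \<inter> space lborel3"
      then have t: "triple (x 2) (x 3) (x 1) i \<in> A i" if "i \<in> {1..3}" for i using that by auto
      have "x 2 \<in> A 1" "x 3 \<in> A 2" "x 1 \<in> A 3" using t[of 1] t[of 2] t[of 3] by auto
      moreover have "x \<in> extensional {1..3}" using x by (auto simp: lborel3_def space_PiM PiE_def)
      moreover have "x j \<in> B j" if "j \<in> {1..3}" for j
        using atLeastAtMost_3_cases[OF that] calculation by (auto simp: B_def)
      ultimately show "x \<in> Pi\<^sub>E {1..3} B" by (simp add: PiE_def Pi_def)
    next
      fix x assume x: "x \<in> Pi\<^sub>E {1..3} B"
      then have "x 1 \<in> B 1" "x 2 \<in> B 2" "x 3 \<in> B 3" by auto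
      then have "x 1 \<in> A 3" "x 2 \<in> A 1" "x 3 \<in> A 2" by (auto simp: B_def)
      then have "triple (x 2) (x 3) (x 1) j \<in> A j" if "j \<in> {1..3}" for j
        using atLeastAtMost_3_cases[OF that] by auto
      then have "triple (x 2) (x 3) (x 1) \<in> Pi\<^sub>E {1..3} A"
        by (auto simp: triple_def)
      moreover have "x \<in> space lborel3" using x by (auto simp: lborel3_def space_PiM PiE_def)
      ultimately show "x \<in> (\<lambda>x. triple (x 2) (x 3) (x 1)) -` Pi\<^sub>E {1..3} A \<inter> space lborel3" by auto
    qed
    also have "emeasure lborel3 (Pi\<^sub>E {1..3} B) = (\<Prod>i\<in>{1..3}. emeasure lborel (B i))"
      unfolding lborel3_def by (rule emeasure_PiM) (use A in \<open>auto simp: B_def\<close>)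
    also have "\<dots> = (\<Prod>i\<in>{1..3}. emeasure lborel (A i))"
      unfolding prod_nat_3 by (simp add: B_def mult_ac)
    finally show "emeasure (distr lborel3 lborel3 (\<lambda>x. triple (x 2) (x 3) (x 1))) (Pi\<^sub>E {1..3} A) = (\<Prod>i\<in>{1..3}. emeasure lborel (A i))" .
  qed (simp_all add: lborel3_def)
  then show ?thesis by (simp add: lborel3_def)
qed


lemma simplex_inner_permute:
  assumes [measurable]: "F \<in> borel_measurable lborel3" "G \<in> borel_measurable lborel3"
  shows "simplex_inner 3 (\<kappa> \<circ> cyc123) F G =
    simplex_inner 3 \<kappa> (\<lambda>x. F (triple (x 2) (x 3) (x 1))) (\<lambda>x. G (triple (x 2) (x 3) (x 1)))"
proof -
  define \<pi> :: "(nat \<Rightarrow> real) \<Rightarrow> nat \<Rightarrow> real" where "\<pi> x = triple (x 2) (x 3) (x 1)" for x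
  have [measurable]: "\<pi> \<in> measurable lborel3 lborel3" unfolding \<pi>_def[abs_def] by measurable
  define H where "H x = (if open_simplex x then 1 else 0) * (F x * G x * simplex_weight 3 (\<kappa> \<circ> cyc123) x)" for x
  have [measurable]: "H \<in> borel_measurable lborel3" unfolding H_def by measurable
  have "integral\<^sup>L lborel3 H = integral\<^sup>L (distr lborel3 lborel3 \<pi>) H"
    unfolding \<pi>_def[abs_def] lborel3_permute ..
  also have "\<dots> = integral\<^sup>L lborel3 (\<lambda>x. H (\<pi> x))" by (rule integral_distr) measurable
  also have "(\<lambda>x. H (\<pi> x)) = (\<lambda>x. (if open_simplex x then 1 else 0) * (F (\<pi> x) * G (\<pi> x) * simplex_weight 3 \<kappa> x))"
  proof
    fix x
    have "open_simplex (\<pi> x) \<longleftrightarrow> open_simplex x" by (auto simp: open_simplex_def \<pi>_def)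
    moreover have "simplex_weight 3 (\<kappa> \<circ> cyc123) (\<pi> x) = simplex_weight 3 \<kappa> x"
      unfolding simplex_weight_three by (simp add: \<pi>_def add_ac mult_ac)
    ultimately show "H (\<pi> x) = (if open_simplex x then 1 else 0) * (F (\<pi> x) * G (\<pi> x) * simplex_weight 3 \<kappa> x)"
      by (simp add: H_def)
  qed
  finally have "integral\<^sup>L lborel3 H = integral\<^sup>L lborel3 (\<lambda>x. (if open_simplex x then 1 else 0) * (F (\<pi> x) * G (\<pi> x) * simplex_weight 3 \<kappa> x))" .
  moreover have "simplex_mass (\<kappa> \<circ> cyc123) = simplex_mass \<kappa>"
    unfolding simplex_mass_def sum_nat_intervals prod_nat_4 by (simp add: add_ac mult_ac)
  ultimately show ?thesis
    unfolding simplex_inner_lborel3 simplex_indicator_weight H_def \<pi>_def by simp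
qed

section \<open>Connection coefficients of the cyclic permutations\<close>

lemma cyc_inverse: "cyc123 \<circ> cyc132 = id" "cyc132 \<circ> cyc123 = id"
proof -
  have "cyc123 (cyc132 i) = i \<and> cyc132 (cyc123 i) = i" for i
    by (auto simp: cyc123_def cyc132_def Transposition.transpose_def)
  then show "cyc123 \<circ> cyc132 = id" "cyc132 \<circ> cyc123 = id" by (auto simp: fun_eq_iff)
qed

lemma comp_cyc_inverse [simp]: "(f \<circ> cyc123) \<circ> cyc132 = f" "(f \<circ> cyc132) \<circ> cyc123 = f"
  by (simp_all add: comp_assoc cyc_inverse)

lemma multi_index3_eqI:
  assumes "\<mu> \<in> multi_index 3 n" "\<mu>' \<in> multi_index 3 n" "\<mu> 1 = \<mu>' 1" "\<mu> 2 = \<mu>' 2" "\<mu> 3 = \<mu>' 3"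
  shows "\<mu> = \<mu>'"
  using multi_index_eq_index3[OF assms(1)] multi_index_eq_index3[OF assms(2)] assms(3-5) by simp

lemma simplex_inner_cong:
  assumes "\<And>x. x \<in> simplex_set 3 \<Longrightarrow> f x = f' x" "\<And>x. x \<in> simplex_set 3 \<Longrightarrow> g x = g' x"
  shows "simplex_inner 3 \<kappa> f g = simplex_inner 3 \<kappa> f' g'"
proof -
  have e: "indicator (simplex_set 3) x *\<^sub>R (f x * g x * w) = indicator (simplex_set 3) x *\<^sub>R (f' x * g' x * w)" for x and w :: real
    using assms[of x] by (cases "x \<in> simplex_set 3") auto
  show ?thesis unfolding simplex_inner_lborel3 by (simp only: e)
qed

lemma simplex_inner_commute: "simplex_inner 3 \<kappa> f g = simplex_inner 3 \<kappa> g f"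
  unfolding simplex_inner_lborel3 by (simp add: mult.commute)

text \<open>
  Integrate the expansion against \<open>P\<^sub>\<mu>\<close>: by orthogonality one term remains.
\<close>

lemma coefficient_extraction:
  assumes \<kappa>: "admissible \<kappa>" and \<mu>: "\<mu> \<in> multi_index 3 n"
    and f: "\<And>x. x \<in> simplex_set 3 \<Longrightarrow> f x = (\<Sum>\<mu>\<in>multi_index 3 n. c \<mu> * simplex_jacobi 3 \<mu> \<kappa> x)"
  shows "simplex_inner 3 \<kappa> f (simplex_jacobi 3 \<mu> \<kappa>) = c \<mu> * norm_formula \<mu> \<kappa>"
proof -
  note orth = simplex_jacobi_orthogonal[OF \<kappa>]
  define h where "h \<mu>' x = indicator (simplex_set 3) x *\<^sub>R (simplex_jacobi 3 \<mu>' \<kappa> x * simplex_jacobi 3 \<mu> \<kappa> x * simplex_weight 3 \<kappa> x)" for \<mu>' x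
  have "has_bochner_integral lborel3 (\<lambda>x. \<Sum>\<mu>'\<in>multi_index 3 n. c \<mu>' * h \<mu>' x)
     (\<Sum>\<mu>'\<in>multi_index 3 n. c \<mu>' * (if \<mu>' 1 = \<mu> 1 \<and> \<mu>' 2 = \<mu> 2 \<and> \<mu>' 3 = \<mu> 3 then simplex_mass \<kappa> * norm_formula \<mu>' \<kappa> else 0))"
    unfolding h_def by (intro has_bochner_integral_sum has_bochner_integral_mult_right orth)
  moreover have "(\<lambda>x. \<Sum>\<mu>'\<in>multi_index 3 n. c \<mu>' * h \<mu>' x) =
    (\<lambda>x. indicator (simplex_set 3) x *\<^sub>R (f x * simplex_jacobi 3 \<mu> \<kappa> x * simplex_weight 3 \<kappa> x))"
  proof
    fix x show "(\<Sum>\<mu>'\<in>multi_index 3 n. c \<mu>' * h \<mu>' x) = indicator (simplex_set 3) x *\<^sub>R (f x * simplex_jacobi 3 \<mu> \<kappa> x * simplex_weight 3 \<kappa> x)"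
      by (cases "x \<in> simplex_set 3") (simp_all add: h_def f sum_distrib_right mult.assoc)
  qed
  moreover have "(\<Sum>\<mu>'\<in>multi_index 3 n. c \<mu>' * (if \<mu>' 1 = \<mu> 1 \<and> \<mu>' 2 = \<mu> 2 \<and> \<mu>' 3 = \<mu> 3 then simplex_mass \<kappa> * norm_formula \<mu>' \<kappa> else 0))
     = c \<mu> * (simplex_mass \<kappa> * norm_formula \<mu> \<kappa>)"
  proof -
    have "(\<Sum>\<mu>'\<in>multi_index 3 n. c \<mu>' * (if \<mu>' 1 = \<mu> 1 \<and> \<mu>' 2 = \<mu> 2 \<and> \<mu>' 3 = \<mu> 3 then simplex_mass \<kappa> * norm_formula \<mu>' \<kappa> else 0))
      = (\<Sum>\<mu>'\<in>{\<mu>}. c \<mu>' * (simplex_mass \<kappa> * norm_formula \<mu>' \<kappa>))"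
      by (rule sum.mono_neutral_cong_right) (use \<mu> finite_multi_index3 multi_index3_eqI[OF _ \<mu>] in auto)
    then show ?thesis by simp
  qed
  ultimately show ?thesis
    using simplex_mass_pos[OF \<kappa>] by (simp add: simplex_inner_lborel3 has_bochner_integral_iff)
qed

lemma coefficients_unique:
  assumes \<kappa>: "admissible \<kappa>" and \<mu>: "\<mu> \<in> multi_index 3 n"
    and eq: "\<And>x. x \<in> simplex_set 3 \<Longrightarrow>
      (\<Sum>\<mu>\<in>multi_index 3 n. c \<mu> * simplex_jacobi 3 \<mu> \<kappa> x) = (\<Sum>\<mu>\<in>multi_index 3 n. c' \<mu> * simplex_jacobi 3 \<mu> \<kappa> x)"
  shows "c \<mu> = c' \<mu>"
proof -
  define S where "S x = (\<Sum>\<mu>\<in>multi_index 3 n. c \<mu> * simplex_jacobi 3 \<mu> \<kappa> x)" for x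
  have "simplex_inner 3 \<kappa> S (simplex_jacobi 3 \<mu> \<kappa>) = c \<mu> * norm_formula \<mu> \<kappa>"
    by (rule coefficient_extraction[OF \<kappa> \<mu>]) (simp add: S_def)
  moreover have "simplex_inner 3 \<kappa> S (simplex_jacobi 3 \<mu> \<kappa>) = c' \<mu> * norm_formula \<mu> \<kappa>"
    by (rule coefficient_extraction[OF \<kappa> \<mu>]) (simp add: S_def eq)
  moreover have "norm_formula \<mu> \<kappa> > 0" by (rule norm_formula_pos[OF \<kappa>])
  ultimately show ?thesis by simp
qed

lemma connection_coeff_eqI:
  assumes \<kappa>: "admissible \<kappa>" and \<nu>: "\<nu> \<in> multi_index 3 n" and \<mu>: "\<mu> \<in> multi_index 3 n"
    and exp: "\<And>x. x \<in> simplex_set 3 \<Longrightarrow>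
      simplex_jacobi 3 \<nu> (\<kappa> \<circ> \<tau>) (simplex_permute 3 \<tau> x) = (\<Sum>\<mu>\<in>multi_index 3 n. c \<mu> * simplex_jacobi 3 \<mu> \<kappa> x)"
  shows "connection_coeff 3 \<tau> \<kappa> \<nu> \<mu> = c \<mu>"
proof -
  have n: "(\<Sum>i=1..3. \<nu> i) = n" using \<nu> by (simp add: multi_index_def)
  have "connection_coeff 3 \<tau> \<kappa> \<nu> = (\<lambda>\<mu>. if \<mu> \<in> multi_index 3 n then c \<mu> else 0)"
    unfolding connection_coeff_def n
  proof (rule the_equality)
    show "(\<forall>\<mu>. \<mu> \<notin> multi_index 3 n \<longrightarrow> (if \<mu> \<in> multi_index 3 n then c \<mu> else 0) = 0) \<and>
      (\<forall>x\<in>simplex_set 3. simplex_jacobi 3 \<nu> (\<kappa> \<circ> \<tau>) (simplex_permute 3 \<tau> x) =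
         (\<Sum>\<mu>\<in>multi_index 3 n. (if \<mu> \<in> multi_index 3 n then c \<mu> else 0) * simplex_jacobi 3 \<mu> \<kappa> x))"
      using exp by (auto intro!: sum.cong)
  next
    fix d assume d: "(\<forall>\<mu>. \<mu> \<notin> multi_index 3 n \<longrightarrow> d \<mu> = 0) \<and>
      (\<forall>x\<in>simplex_set 3. simplex_jacobi 3 \<nu> (\<kappa> \<circ> \<tau>) (simplex_permute 3 \<tau> x) =
         (\<Sum>\<mu>\<in>multi_index 3 n. d \<mu> * simplex_jacobi 3 \<mu> \<kappa> x))"
    show "d = (\<lambda>\<mu>. if \<mu> \<in> multi_index 3 n then c \<mu> else 0)"
    proof
      fix \<mu>
      show "d \<mu> = (if \<mu> \<in> multi_index 3 n then c \<mu> else 0)"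
        using d exp coefficients_unique[OF \<kappa>, of \<mu> n d c] by auto
    qed
  qed
  then show ?thesis using \<mu> by simp
qed

lemma simplex_permute_simps:
  "simplex_permute 3 cyc123 x 1 = x 2" "simplex_permute 3 cyc123 x 2 = x 3" "simplex_permute 3 cyc123 x 3 = x 1"
  "simplex_permute 3 cyc132 x 1 = x 3" "simplex_permute 3 cyc132 x 2 = x 1" "simplex_permute 3 cyc132 x 3 = x 2"
  by (simp_all add: simplex_permute_def)

lemma simplex_set_three: "x \<in> simplex_set 3 \<longleftrightarrow> 0 \<le> x 1 \<and> 0 \<le> x 2 \<and> 0 \<le> x 3 \<and> x 1 + x 2 + x 3 \<le> 1"
proof -
  have "(\<forall>i\<in>{1..3}. 0 \<le> x i) \<longleftrightarrow> 0 \<le> x 1 \<and> 0 \<le> x 2 \<and> 0 \<le> x (3::nat)"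
  proof -
    have "{1..3} = {1, 2, 3::nat}" by auto
    then show ?thesis by (simp only:) simp
  qed
  then show ?thesis unfolding simplex_set_def sum_nat_3 by auto
qed

lemma simplex_permute_in:
  "x \<in> simplex_set 3 \<Longrightarrow> simplex_permute 3 cyc123 x \<in> simplex_set 3"
  "x \<in> simplex_set 3 \<Longrightarrow> simplex_permute 3 cyc132 x \<in> simplex_set 3"
  unfolding simplex_set_three simplex_permute_simps by auto

lemma simplex_jacobi_cong:
  assumes "x 1 = y 1" "x 2 = y 2" "x 3 = y 3"
  shows "simplex_jacobi 3 \<nu> \<kappa> x = simplex_jacobi 3 \<nu> \<kappa> y"
  unfolding simplex_jacobi_three assms ..

lemma simplex_jacobi_permute:
  assumes "x \<in> simplex_set 3"
  shows "simplex_jacobi 3 \<nu> (\<kappa> \<circ> cyc123) (simplex_permute 3 cyc123 x) = simplex_hom \<nu> (\<kappa> \<circ> cyc123) (x(4 := 1 - (\<Sum>i=1..3. x i)) \<circ> cyc123)"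
    and "simplex_jacobi 3 \<nu> (\<kappa> \<circ> cyc132) (simplex_permute 3 cyc132 x) = simplex_hom \<nu> (\<kappa> \<circ> cyc132) (x(4 := 1 - (\<Sum>i=1..3. x i)) \<circ> cyc132)"
proof -
  have s: "(\<Sum>i=1..3. simplex_permute 3 cyc123 x i) = (\<Sum>i=1..3. x i)" "(\<Sum>i=1..3. simplex_permute 3 cyc132 x i) = (\<Sum>i=1..3. x i)"
    unfolding sum_nat_3 simplex_permute_simps by simp_all
  have "simplex_permute 3 cyc123 x 4 = 1 - (\<Sum>i=1..3. x i)" "simplex_permute 3 cyc132 x 4 = 1 - (\<Sum>i=1..3. x i)"
    by (simp_all add: simplex_permute_def)
  then have e: "(simplex_permute 3 cyc123 x)(4 := 1 - (\<Sum>i=1..3. x i)) = x(4 := 1 - (\<Sum>i=1..3. x i)) \<circ> cyc123"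
     "(simplex_permute 3 cyc132 x)(4 := 1 - (\<Sum>i=1..3. x i)) = x(4 := 1 - (\<Sum>i=1..3. x i)) \<circ> cyc132"
    by (simp_all add: fun_upd_idem simplex_permute_def)
  show "simplex_jacobi 3 \<nu> (\<kappa> \<circ> cyc123) (simplex_permute 3 cyc123 x) = simplex_hom \<nu> (\<kappa> \<circ> cyc123) (x(4 := 1 - (\<Sum>i=1..3. x i)) \<circ> cyc123)"
    unfolding simplex_jacobi_hom[OF simplex_permute_in(1)[OF assms]] s e ..
  show "simplex_jacobi 3 \<nu> (\<kappa> \<circ> cyc132) (simplex_permute 3 cyc132 x) = simplex_hom \<nu> (\<kappa> \<circ> cyc132) (x(4 := 1 - (\<Sum>i=1..3. x i)) \<circ> cyc132)"
    unfolding simplex_jacobi_hom[OF simplex_permute_in(2)[OF assms]] s e ..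
qed

lemma cyc123_jacobi_expansion:
  assumes \<kappa>: "admissible \<kappa>" and \<nu>: "\<nu> \<in> multi_index 3 n" and x: "x \<in> simplex_set 3"
  shows "simplex_jacobi 3 \<nu> (\<kappa> \<circ> cyc123) (simplex_permute 3 cyc123 x) = (\<Sum>\<mu>\<in>multi_index 3 n. cyc_coeff \<kappa> \<nu> \<mu> * simplex_jacobi 3 \<mu> \<kappa> x)"
  unfolding simplex_jacobi_permute[OF x] simplex_jacobi_hom[OF x]
  by (rule cyc_expansion[OF \<kappa> \<nu>])

lemma cyc132_jacobi_expansion:
  assumes \<kappa>: "admissible \<kappa>" and \<mu>: "\<mu> \<in> multi_index 3 n"
  shows "\<exists>d. \<forall>x\<in>simplex_set 3. simplex_jacobi 3 \<mu> (\<kappa> \<circ> cyc132) (simplex_permute 3 cyc132 x) = (\<Sum>\<nu>\<in>multi_index 3 n. d \<nu> * simplex_jacobi 3 \<nu> \<kappa> x)"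
proof -
  have "combination_of (multi_index 3 n) (\<lambda>\<nu> x. simplex_hom \<nu> ((\<kappa> \<circ> cyc132) \<circ> cyc123) (x \<circ> cyc123)) (simplex_hom \<mu> (\<kappa> \<circ> cyc132))"
    by (rule cyc_expansion_inverse) (use \<kappa> \<mu> in simp_all)
  then obtain d where d: "\<And>x. simplex_hom \<mu> (\<kappa> \<circ> cyc132) x = (\<Sum>\<nu>\<in>multi_index 3 n. d \<nu> * simplex_hom \<nu> \<kappa> (x \<circ> cyc123))"
    unfolding combination_of_def comp_cyc_inverse by blast
  have "\<forall>x\<in>simplex_set 3. simplex_jacobi 3 \<mu> (\<kappa> \<circ> cyc132) (simplex_permute 3 cyc132 x) = (\<Sum>\<nu>\<in>multi_index 3 n. d \<nu> * simplex_jacobi 3 \<nu> \<kappa> x)"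
  proof
    fix x assume x: "x \<in> simplex_set 3"
    show "simplex_jacobi 3 \<mu> (\<kappa> \<circ> cyc132) (simplex_permute 3 cyc132 x) = (\<Sum>\<nu>\<in>multi_index 3 n. d \<nu> * simplex_jacobi 3 \<nu> \<kappa> x)"
      unfolding simplex_jacobi_permute[OF x] simplex_jacobi_hom[OF x] d comp_cyc_inverse ..
  qed
  then show ?thesis by blast
qed

lemma connection_coeff_cyc123:
  assumes "admissible \<kappa>" "\<nu> \<in> multi_index 3 n" "\<mu> \<in> multi_index 3 n"
  shows "connection_coeff 3 cyc123 \<kappa> \<nu> \<mu> = cyc_coeff \<kappa> \<nu> \<mu>"
  by (rule connection_coeff_eqI[OF assms]) (rule cyc123_jacobi_expansion[OF assms(1,2)])

lemma connection_coeff_cyc132_expansion: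
  assumes "admissible \<kappa>" "\<mu> \<in> multi_index 3 n" "x \<in> simplex_set 3"
  shows "simplex_jacobi 3 \<mu> (\<kappa> \<circ> cyc132) (simplex_permute 3 cyc132 x) =
    (\<Sum>\<nu>\<in>multi_index 3 n. connection_coeff 3 cyc132 \<kappa> \<mu> \<nu> * simplex_jacobi 3 \<nu> \<kappa> x)"
proof -
  obtain d where d: "\<And>x. x \<in> simplex_set 3 \<Longrightarrow> simplex_jacobi 3 \<mu> (\<kappa> \<circ> cyc132) (simplex_permute 3 cyc132 x) = (\<Sum>\<nu>\<in>multi_index 3 n. d \<nu> * simplex_jacobi 3 \<nu> \<kappa> x)"
    using cyc132_jacobi_expansion[OF assms(1,2)] by blast
  have "connection_coeff 3 cyc132 \<kappa> \<mu> \<nu> = d \<nu>" if "\<nu> \<in> multi_index 3 n" for \<nu>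
    by (rule connection_coeff_eqI[OF assms(1,2) that d])
  then show ?thesis using d[OF assms(3)] by simp
qed

lemma simplex_permute_measurable [measurable]:
  "(\<lambda>x. simplex_jacobi 3 \<nu> \<kappa> (simplex_permute 3 cyc132 x)) \<in> borel_measurable lborel3"
  unfolding simplex_jacobi_three simplex_permute_simps by measurable

text \<open>
  Both sides are the inner product of the same two functions on the simplex, taken before and after
  the cyclic permutation of the variables.
\<close>

lemma connection_coeff_adjoint:
  assumes \<kappa>: "admissible \<kappa>" and \<nu>: "\<nu> \<in> multi_index 3 n" and \<mu>: "\<mu> \<in> multi_index 3 n"
  shows "connection_coeff 3 cyc132 (\<kappa> \<circ> cyc123) \<mu> \<nu> * norm_formula \<nu> (\<kappa> \<circ> cyc123) = cyc_coeff \<kappa> \<nu> \<mu> * norm_formula \<mu> \<kappa>"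
proof -
  define \<kappa>' where "\<kappa>' = \<kappa> \<circ> cyc123"
  have \<kappa>': "admissible \<kappa>'" "\<kappa>' \<circ> cyc132 = \<kappa>" using \<kappa> by (simp_all add: \<kappa>'_def)
  have "connection_coeff 3 cyc132 \<kappa>' \<mu> \<nu> * norm_formula \<nu> \<kappa>' =
     simplex_inner 3 \<kappa>' (\<lambda>x. simplex_jacobi 3 \<mu> \<kappa> (simplex_permute 3 cyc132 x)) (simplex_jacobi 3 \<nu> \<kappa>')"
    by (rule coefficient_extraction[OF \<kappa>'(1) \<nu>, symmetric])
      (use connection_coeff_cyc132_expansion[OF \<kappa>'(1) \<mu>] \<kappa>'(2) in simp)
  also have "\<dots> = simplex_inner 3 \<kappa> (\<lambda>x. simplex_jacobi 3 \<mu> \<kappa> (simplex_permute 3 cyc132 (triple (x 2) (x 3) (x 1))))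
     (\<lambda>x. simplex_jacobi 3 \<nu> \<kappa>' (triple (x 2) (x 3) (x 1)))"
    unfolding \<kappa>'_def by (rule simplex_inner_permute) measurable
  also have "\<dots> = simplex_inner 3 \<kappa> (simplex_jacobi 3 \<mu> \<kappa>) (\<lambda>x. simplex_jacobi 3 \<nu> \<kappa>' (simplex_permute 3 cyc123 x))"
    by (intro simplex_inner_cong simplex_jacobi_cong) (simp_all only: simplex_permute_simps triple_simps)
  also have "\<dots> = simplex_inner 3 \<kappa> (\<lambda>x. simplex_jacobi 3 \<nu> \<kappa>' (simplex_permute 3 cyc123 x)) (simplex_jacobi 3 \<mu> \<kappa>)"
    by (rule simplex_inner_commute)
  also have "\<dots> = cyc_coeff \<kappa> \<nu> \<mu> * norm_formula \<mu> \<kappa>"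
    by (rule coefficient_extraction[OF \<kappa> \<mu>]) (use cyc123_jacobi_expansion[OF \<kappa> \<nu>] in \<open>simp add: \<kappa>'_def\<close>)
  finally show ?thesis unfolding \<kappa>'_def .
qed

text \<open>
  Expand \<open>P\<^sub>\<mu>\<close> in the permuted polynomials and these again in the original ones. The coefficient of
  \<open>P\<^sub>\<mu>\<close> in the result is \<open>1\<close>, and \<open>connection_coeff_adjoint\<close> turns it into a sum of squares.
\<close>

lemma cyc_coeff_parseval:
  assumes \<kappa>: "admissible \<kappa>" and \<mu>: "\<mu> \<in> multi_index 3 n"
  shows "(\<Sum>\<nu>\<in>multi_index 3 n. (cyc_coeff \<kappa> \<nu> \<mu>)\<^sup>2 * norm_formula \<mu> \<kappa> / norm_formula \<nu> (\<kappa> \<circ> cyc123)) = 1"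
proof -
  define \<kappa>' where "\<kappa>' = \<kappa> \<circ> cyc123"
  have \<kappa>': "admissible \<kappa>'" "\<kappa>' \<circ> cyc132 = \<kappa>" using \<kappa> by (simp_all add: \<kappa>'_def)
  \<comment> \<open>The coefficients of \<open>P\<^sub>\<mu>\<close> in the permuted polynomials.\<close>
  define d where "d = connection_coeff 3 cyc132 \<kappa>' \<mu>"
  have "(if \<mu> = \<mu> then 1 else 0) = (\<Sum>\<nu>\<in>multi_index 3 n. d \<nu> * cyc_coeff \<kappa> \<nu> \<mu>)"
  proof (rule coefficients_unique[OF \<kappa> \<mu>, where c = "\<lambda>\<mu>'. if \<mu>' = \<mu> then 1 else 0"
        and c' = "\<lambda>\<mu>'. \<Sum>\<nu>\<in>multi_index 3 n. d \<nu> * cyc_coeff \<kappa> \<nu> \<mu>'"])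
    fix x assume x: "x \<in> simplex_set 3"
    have "(\<Sum>\<mu>'\<in>multi_index 3 n. (if \<mu>' = \<mu> then 1 else 0) * simplex_jacobi 3 \<mu>' \<kappa> x) = simplex_jacobi 3 \<mu> \<kappa> x"
      using \<mu> finite_multi_index3 by (simp add: if_distrib[of "\<lambda>c. c * _"] cong: if_cong)
    also have "\<dots> = simplex_jacobi 3 \<mu> \<kappa> (simplex_permute 3 cyc132 (simplex_permute 3 cyc123 x))"
      by (rule simplex_jacobi_cong) (simp_all only: simplex_permute_simps)
    also have "\<dots> = (\<Sum>\<nu>\<in>multi_index 3 n. d \<nu> * simplex_jacobi 3 \<nu> \<kappa>' (simplex_permute 3 cyc123 x))"
      using connection_coeff_cyc132_expansion[OF \<kappa>'(1) \<mu> simplex_permute_in(1)[OF x]] by (simp add: d_def \<kappa>'(2))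
    also have "\<dots> = (\<Sum>\<nu>\<in>multi_index 3 n. \<Sum>\<mu>'\<in>multi_index 3 n. d \<nu> * cyc_coeff \<kappa> \<nu> \<mu>' * simplex_jacobi 3 \<mu>' \<kappa> x)"
      by (intro sum.cong refl) (simp add: \<kappa>'_def cyc123_jacobi_expansion[OF \<kappa> _ x] sum_distrib_left mult.assoc)
    also have "\<dots> = (\<Sum>\<mu>'\<in>multi_index 3 n. (\<Sum>\<nu>\<in>multi_index 3 n. d \<nu> * cyc_coeff \<kappa> \<nu> \<mu>') * simplex_jacobi 3 \<mu>' \<kappa> x)"
      unfolding sum_distrib_right by (rule sum.swap)
    finally show "(\<Sum>\<mu>'\<in>multi_index 3 n. (if \<mu>' = \<mu> then 1 else 0) * simplex_jacobi 3 \<mu>' \<kappa> x) =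
      (\<Sum>\<mu>'\<in>multi_index 3 n. (\<Sum>\<nu>\<in>multi_index 3 n. d \<nu> * cyc_coeff \<kappa> \<nu> \<mu>') * simplex_jacobi 3 \<mu>' \<kappa> x)" .
  qed
  moreover have "d \<nu> * cyc_coeff \<kappa> \<nu> \<mu> = (cyc_coeff \<kappa> \<nu> \<mu>)\<^sup>2 * norm_formula \<mu> \<kappa> / norm_formula \<nu> (\<kappa> \<circ> cyc123)"
    if \<nu>: "\<nu> \<in> multi_index 3 n" for \<nu>
  proof -
    have "norm_formula \<nu> (\<kappa> \<circ> cyc123) > 0" using \<kappa>'(1) by (intro norm_formula_pos) (simp add: \<kappa>'_def)
    then have "d \<nu> = cyc_coeff \<kappa> \<nu> \<mu> * norm_formula \<mu> \<kappa> / norm_formula \<nu> (\<kappa> \<circ> cyc123)"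
      using connection_coeff_adjoint[OF \<kappa> \<nu> \<mu>] by (simp add: d_def \<kappa>'_def field_simps)
    then show ?thesis by (simp add: power2_eq_square)
  qed
  ultimately show ?thesis by simp
qed

lemma connection_coeff_hat_cyc123:
  assumes \<kappa>: "admissible \<kappa>" and \<nu>: "\<nu> \<in> multi_index 3 n" and \<mu>: "\<mu> \<in> multi_index 3 n"
  shows "connection_coeff_hat 3 cyc123 \<kappa> \<nu> \<mu> = sqrt (norm_formula \<mu> \<kappa> / norm_formula \<nu> (\<kappa> \<circ> cyc123)) * cyc_coeff \<kappa> \<nu> \<mu>"
proof -
  have "simplex_sqnorm 3 \<mu> \<kappa> = norm_formula \<mu> \<kappa>" "simplex_sqnorm 3 \<nu> (\<kappa> \<circ> cyc123) = norm_formula \<nu> (\<kappa> \<circ> cyc123)"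
    using \<kappa> by (auto intro!: simplex_sqnorm_eq)
  then show ?thesis by (simp add: connection_coeff_hat_def connection_coeff_cyc123[OF assms])
qed

lemma connection_coeff_hat_inverse:
  assumes \<kappa>: "admissible \<kappa>" and \<nu>: "\<nu> \<in> multi_index 3 n" and \<mu>: "\<mu> \<in> multi_index 3 n"
  shows "connection_coeff_hat 3 cyc132 \<kappa> \<nu> \<mu> = connection_coeff_hat 3 cyc123 (\<kappa> \<circ> cyc132) \<mu> \<nu>"
proof -
  define \<kappa>' where "\<kappa>' = \<kappa> \<circ> cyc132"
  have \<kappa>': "admissible \<kappa>'" "\<kappa>' \<circ> cyc123 = \<kappa>" using \<kappa> by (simp_all add: \<kappa>'_def)
  define a where "a = norm_formula \<mu> \<kappa>"
  define b where "b = norm_formula \<nu> \<kappa>'"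
  have ab: "a > 0" "b > 0" unfolding a_def b_def using \<kappa> \<kappa>' by (auto intro!: norm_formula_pos)
  have sq: "simplex_sqnorm 3 \<mu> \<kappa> = a" "simplex_sqnorm 3 \<nu> \<kappa>' = b"
    unfolding a_def b_def using \<kappa> \<kappa>' by (auto intro!: simplex_sqnorm_eq)
  have "connection_coeff 3 cyc132 \<kappa> \<nu> \<mu> * a = cyc_coeff \<kappa>' \<mu> \<nu> * b"
    using connection_coeff_adjoint[OF \<kappa>'(1) \<mu> \<nu>] by (simp add: \<kappa>'(2) a_def b_def)
  then have c: "connection_coeff 3 cyc132 \<kappa> \<nu> \<mu> = cyc_coeff \<kappa>' \<mu> \<nu> * (b / a)"
    using ab by (simp add: field_simps)
  have s: "sqrt (a / b) * (b / a) = sqrt (b / a)"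
  proof -
    have "sqrt (a / b) * (b / a) = sqrt (a / b) * sqrt ((b / a)\<^sup>2)" using ab by simp
    also have "\<dots> = sqrt (b / a)" unfolding real_sqrt_mult[symmetric] using ab by (simp add: power2_eq_square)
    finally show ?thesis .
  qed
  have "connection_coeff_hat 3 cyc132 \<kappa> \<nu> \<mu> = sqrt (a / b) * (b / a) * cyc_coeff \<kappa>' \<mu> \<nu>"
    by (simp add: connection_coeff_hat_def sq \<kappa>'_def[symmetric] c)
  also have "\<dots> = connection_coeff_hat 3 cyc123 \<kappa>' \<mu> \<nu>"
    unfolding s by (simp add: connection_coeff_hat_cyc123[OF \<kappa>'(1) \<mu> \<nu>] \<kappa>'(2) a_def b_def)
  finally show ?thesis by (simp add: \<kappa>'_def)
qed

section \<open>Norms of the Racah polynomials and exceptional parameters\<close>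

lemma racah_sqnorm_sum:
  "racah_sqnorm 2 m \<beta> n = (\<Sum>\<nu>\<in>multi_index 3 n. racah_weight 2 (racah_point \<nu>) \<beta> n * (racah_poly 2 m (racah_point \<nu>) \<beta> n)\<^sup>2)"
  unfolding racah_sqnorm_def by (rule racah_points_sum)

text \<open>
  The constant in \<open>racah_weight_eq\<close>. For \<open>n > 0\<close> it equals \<open>\<beta>\<^sub>3 / (\<beta>\<^sub>3 + 2 n)\<close>; thus it vanishes for
  \<open>\<beta>\<^sub>3 = 0\<close> and is negative for \<open>-1 < \<beta>\<^sub>3 < 0\<close>.
\<close>

definition racah_mass :: "(nat \<Rightarrow> real) \<Rightarrow> nat \<Rightarrow> real" where
  "racah_mass \<beta> n = pochhammer (\<beta> 3) (2 * n) / pochhammer (\<beta> 3 + 1) (2 * n)"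

text \<open>
  Up to constant factors the summands of the norm are the squares of the normalised connection
  coefficients, whose sum is known from \<open>cyc_coeff_parseval\<close>.
\<close>

lemma racah_sqnorm_eq:
  assumes \<kappa>: "admissible \<kappa>" and \<mu>: "\<mu> \<in> multi_index 3 n"
    and reg: "n = 0 \<or> (racah_params \<kappa> 1 \<noteq> 0 \<and> racah_params \<kappa> 2 \<noteq> 0)"
  shows "racah_sqnorm 2 (racah_index \<mu>) (racah_params \<kappa>) n =
    racah_mass (racah_params \<kappa>) n / ((index_factor \<kappa> \<mu>)\<^sup>2 * norm_formula \<mu> \<kappa>)"
proof -
  define g where "g = index_factor \<kappa> \<mu>"
  define N where "N = norm_formula \<mu> \<kappa>"
  have pos: "g > 0" "N > 0" unfolding g_def N_def using \<kappa> by (auto intro: index_factor_pos norm_formula_pos)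
  have "racah_sqnorm 2 (racah_index \<mu>) (racah_params \<kappa>) n =
    (\<Sum>\<nu>\<in>multi_index 3 n. racah_mass (racah_params \<kappa>) n / (g\<^sup>2 * N) * ((cyc_coeff \<kappa> \<nu> \<mu>)\<^sup>2 * N / norm_formula \<nu> (\<kappa> \<circ> cyc123)))"
    unfolding racah_sqnorm_sum
  proof (rule sum.cong[OF refl])
    fix \<nu> assume \<nu>: "\<nu> \<in> multi_index 3 n"
    define R where "R = racah_poly 2 (racah_index \<mu>) (racah_point \<nu>) (racah_params \<kappa>) n"
    have "cyc_coeff \<kappa> \<nu> \<mu> = (-1) ^ (n + \<nu> 3) * node_factor \<kappa> \<nu> * g * R"
      unfolding g_def R_def by (rule cyc_coeff_racah[OF \<kappa> \<nu> \<mu>])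
    then have sq: "(cyc_coeff \<kappa> \<nu> \<mu>)\<^sup>2 = (node_factor \<kappa> \<nu>)\<^sup>2 * g\<^sup>2 * R\<^sup>2"
      by (simp add: power_mult_distrib power_mult[symmetric] mult.commute[of _ 2])
    show "racah_weight 2 (racah_point \<nu>) (racah_params \<kappa>) n * (racah_poly 2 (racah_index \<mu>) (racah_point \<nu>) (racah_params \<kappa>) n)\<^sup>2 =
      racah_mass (racah_params \<kappa>) n / (g\<^sup>2 * N) * ((cyc_coeff \<kappa> \<nu> \<mu>)\<^sup>2 * N / norm_formula \<nu> (\<kappa> \<circ> cyc123))"
      unfolding racah_weight_eq[OF \<kappa> \<nu> reg] racah_mass_def[symmetric] sq R_def[symmetric] using pos by simp
  qed
  also have "\<dots> = racah_mass (racah_params \<kappa>) n / (g\<^sup>2 * N) * 1"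
    unfolding sum_distrib_left[symmetric] N_def cyc_coeff_parseval[OF \<kappa> \<mu>] ..
  finally show ?thesis by (simp add: g_def N_def)
qed

text \<open>
  The formula behind \<open>racah_weighted_orthonormal\<close>, without the passage to the limit.
\<close>

definition weighted_racah :: "(nat \<Rightarrow> nat) \<Rightarrow> (nat \<Rightarrow> nat) \<Rightarrow> (nat \<Rightarrow> real) \<Rightarrow> nat \<Rightarrow> real" where
  "weighted_racah m x \<beta> n = racah_poly 2 m x \<beta> n * sqrt (racah_weight 2 x \<beta> n / racah_sqnorm 2 m \<beta> n)"

text \<open>
  The normalised connection coefficient without its sign \<open>(-1) ^ (n + \<nu> 3)\<close>, as an expression that is finite
  and continuous for all \<open>\<kappa>\<^sub>i > -1\<close>.
\<close>

definition unsigned_connection :: "(nat \<Rightarrow> nat) \<Rightarrow> (nat \<Rightarrow> nat) \<Rightarrow> (nat \<Rightarrow> real) \<Rightarrow> nat \<Rightarrow> real" where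
  "unsigned_connection \<nu> \<mu> \<kappa> n = sqrt (norm_formula \<mu> \<kappa> / norm_formula \<nu> (\<kappa> \<circ> cyc123)) *
     (node_factor \<kappa> \<nu> * index_factor \<kappa> \<mu> * racah_poly 2 (racah_index \<mu>) (racah_point \<nu>) (racah_params \<kappa>) n)"

lemma connection_coeff_hat_unsigned_connection:
  assumes \<kappa>: "admissible \<kappa>" and \<nu>: "\<nu> \<in> multi_index 3 n" and \<mu>: "\<mu> \<in> multi_index 3 n"
  shows "connection_coeff_hat 3 cyc123 \<kappa> \<nu> \<mu> = (-1) ^ (n + \<nu> 3) * unsigned_connection \<nu> \<mu> \<kappa> n"
proof -
  have "cyc_coeff \<kappa> \<nu> \<mu> = (-1) ^ (n + \<nu> 3) * node_factor \<kappa> \<nu> * index_factor \<kappa> \<mu> *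
           racah_poly 2 (racah_index \<mu>) (racah_point \<nu>) (racah_params \<kappa>) n"
    by (rule cyc_coeff_racah[OF \<kappa> \<nu> \<mu>])
  then show ?thesis
    unfolding connection_coeff_hat_cyc123[OF assms] unsigned_connection_def by (simp add: mult_ac)
qed

text \<open>
  The constant of \<open>racah_weight_eq\<close> cancels between the weight and the norm, together with its sign.
  The factors \<open>f\<close> and \<open>g\<close> come out of the root as they are, since they are positive.
\<close>

lemma weighted_racah_regular:
  assumes \<kappa>: "admissible \<kappa>" and \<nu>: "\<nu> \<in> multi_index 3 n" and \<mu>: "\<mu> \<in> multi_index 3 n"
    and reg: "n = 0 \<or> (racah_params \<kappa> 1 \<noteq> 0 \<and> racah_params \<kappa> 2 \<noteq> 0)" and K: "racah_mass (racah_params \<kappa>) n \<noteq> 0"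
  shows "weighted_racah (racah_index \<mu>) (racah_point \<nu>) (racah_params \<kappa>) n = unsigned_connection \<nu> \<mu> \<kappa> n"
proof -
  have w: "racah_weight 2 (racah_point \<nu>) (racah_params \<kappa>) n = racah_mass (racah_params \<kappa>) n * ((node_factor \<kappa> \<nu>)\<^sup>2 / norm_formula \<nu> (\<kappa> \<circ> cyc123))"
    unfolding racah_weight_eq[OF \<kappa> \<nu> reg] racah_mass_def ..
  define f where "f = node_factor \<kappa> \<nu>"
  define g where "g = index_factor \<kappa> \<mu>"
  have pos: "f > 0" "g > 0" unfolding f_def g_def using \<kappa> by (auto intro: node_factor_pos index_factor_pos)
  have N: "norm_formula \<mu> \<kappa> > 0" "norm_formula \<nu> (\<kappa> \<circ> cyc123) > 0"
    using \<kappa> by (auto intro!: norm_formula_pos)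
  have "racah_weight 2 (racah_point \<nu>) (racah_params \<kappa>) n / racah_sqnorm 2 (racah_index \<mu>) (racah_params \<kappa>) n =
    (f * g)\<^sup>2 * (norm_formula \<mu> \<kappa> / norm_formula \<nu> (\<kappa> \<circ> cyc123))"
    unfolding w racah_sqnorm_eq[OF \<kappa> \<mu> reg] f_def[symmetric] g_def[symmetric]
    using K pos N by (simp add: power_mult_distrib)
  then have "sqrt (racah_weight 2 (racah_point \<nu>) (racah_params \<kappa>) n / racah_sqnorm 2 (racah_index \<mu>) (racah_params \<kappa>) n) =
    f * g * sqrt (norm_formula \<mu> \<kappa> / norm_formula \<nu> (\<kappa> \<circ> cyc123))"
    using pos by (simp only: real_sqrt_mult real_sqrt_abs) simp
  then show ?thesis
    unfolding weighted_racah_def unsigned_connection_def f_def g_def by (simp add: mult_ac)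
qed

lemma racah_mass_nonzero:
  assumes "n \<noteq> 0 \<Longrightarrow> \<beta> 3 \<noteq> 0" "\<beta> 3 > -1"
  shows "racah_mass \<beta> n \<noteq> 0"
proof (cases "n = 0")
  case False
  then show ?thesis
    unfolding racah_mass_def using assms pochhammer_nonzero_gt_minus_one[of "\<beta> 3" "2 * n"] by (simp add: pochhammer_nonzero)
qed (simp add: racah_mass_def)

text \<open>
  The denominators with \<open>\<beta>\<^sub>j + 1\<close> never vanish, those with \<open>\<beta>\<^sub>j / 2\<close> only for \<open>\<beta>\<^sub>j = 0\<close>, and
  otherwise the norm vanishes only with \<open>racah_mass\<close>.
\<close>

lemma racah_regular_iff:
  assumes \<kappa>: "admissible \<kappa>" and \<mu>: "\<mu> \<in> multi_index 3 n"
  shows "racah_params \<kappa> \<in> racah_regular 2 (racah_index \<mu>) n \<longleftrightarrow>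
    n = 0 \<or> (racah_params \<kappa> 1 \<noteq> 0 \<and> racah_params \<kappa> 2 \<noteq> 0 \<and> racah_params \<kappa> 3 \<noteq> 0)"
proof
  have \<beta>: "racah_params \<kappa> 1 > -1" "racah_params \<kappa> 2 > -1" "racah_params \<kappa> 3 > -1" "racah_params \<kappa> 0 > -1"
    using \<kappa> by (simp_all add: admissible_def)
  have pos: "index_factor \<kappa> \<mu> > 0" "norm_formula \<mu> \<kappa> > 0"
    using \<kappa> by (auto intro!: index_factor_pos norm_formula_pos)
  {
    assume r: "racah_params \<kappa> \<in> racah_regular 2 (racah_index \<mu>) n"
    show "n = 0 \<or> (racah_params \<kappa> 1 \<noteq> 0 \<and> racah_params \<kappa> 2 \<noteq> 0 \<and> racah_params \<kappa> 3 \<noteq> 0)"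
    proof (cases "n = 0")
      case False
      \<comment> \<open>At the corner \<open>x\<^sub>1 = x\<^sub>2 = n\<close> the denominators contain \<open>(\<beta>\<^sub>1 / 2)\<^sub>n\<close> and \<open>(\<beta>\<^sub>2 / 2)\<^sub>n\<close>.\<close>
      have y: "racah_point (index3 0 0 n) \<in> racah_points 2 n" by (rule racah_point_in) simp
      have "pochhammer (racah_params \<kappa> j / 2) (racah_node 2 n (racah_point (index3 0 0 n)) j) \<noteq> 0" if "j \<in> {1..2}" for j
        using r y that unfolding racah_regular_def by blast
      from this[of 1] this[of 2] have "pochhammer (racah_params \<kappa> 1 / 2) n \<noteq> 0" "pochhammer (racah_params \<kappa> 2 / 2) n \<noteq> 0"
        by (simp_all add: racah_node_def)
      then have 12: "racah_params \<kappa> 1 \<noteq> 0" "racah_params \<kappa> 2 \<noteq> 0" using False by (auto simp: pochhammer_0_left)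
      have "racah_mass (racah_params \<kappa>) n \<noteq> 0"
        using r racah_sqnorm_eq[OF \<kappa> \<mu>] 12 by (auto simp: racah_regular_def)
      then have "racah_params \<kappa> 3 \<noteq> 0" using False by (auto simp: racah_mass_def pochhammer_0_left)
      with 12 show ?thesis by simp
    qed simp
  }
  {
    assume c: "n = 0 \<or> (racah_params \<kappa> 1 \<noteq> 0 \<and> racah_params \<kappa> 2 \<noteq> 0 \<and> racah_params \<kappa> 3 \<noteq> 0)"
    have "pochhammer (racah_params \<kappa> j + 1) m \<noteq> 0" if "j \<le> 2" for j m
    proof -
      have "j = 0 \<or> j = 1 \<or> j = 2" using that by linarith
      then show ?thesis using \<beta> by (auto intro!: pochhammer_nonzero)
    qed
    moreover have "pochhammer (racah_params \<kappa> j / 2) (racah_node 2 n y j) \<noteq> 0" if "j \<in> {1..2}" "y \<in> racah_points 2 n" for j y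
    proof (cases "n = 0")
      case True
      have mono: "racah_node 2 n y i \<le> racah_node 2 n y (i + 1)" if "i \<le> 2" for i
        using \<open>y \<in> racah_points 2 n\<close> that by (auto simp: racah_points_def)
      have "racah_node 2 n y 2 \<le> 0" using mono[of 2] True by (simp add: racah_node_def)
      moreover have "racah_node 2 n y 1 \<le> racah_node 2 n y 2" using mono[of 1] by (simp add: numeral_2_eq_2)
      moreover have "j = 1 \<or> j = 2" using that(1) unfolding atLeastAtMost_iff by linarith
      ultimately have "racah_node 2 n y j = 0" by auto
      then show ?thesis by simp
    next
      case False
      have "j = 1 \<or> j = 2" using that(1) unfolding atLeastAtMost_iff by linarith
      then have "racah_params \<kappa> j / 2 > -1" "racah_params \<kappa> j / 2 \<noteq> 0" using c False \<beta> by auto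
      then show ?thesis by (rule pochhammer_nonzero_gt_minus_one)
    qed
    moreover have "racah_sqnorm 2 (racah_index \<mu>) (racah_params \<kappa>) n \<noteq> 0"
    proof -
      have "racah_mass (racah_params \<kappa>) n \<noteq> 0" by (rule racah_mass_nonzero) (use c \<beta> in auto)
      then show ?thesis using racah_sqnorm_eq[OF \<kappa> \<mu>] c pos by auto
    qed
    ultimately show "racah_params \<kappa> \<in> racah_regular 2 (racah_index \<mu>) n"
      unfolding racah_regular_def by blast
  }
qed

text \<open>
  A neighbourhood of \<open>\<beta>\<close> in the product topology contains vectors with arbitrary entries beyond
  \<open>\<beta>\<^sub>3\<close>; this reduces them to vectors of the form \<open>racah_params \<kappa>\<close>.
\<close>

lemma racah_weight_two_cong:
  assumes "\<And>i. i \<le> 3 \<Longrightarrow> \<beta> i = \<beta>' i"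
  shows "racah_weight 2 x \<beta> N = racah_weight 2 x \<beta>' N" "racah_poly 2 m x \<beta> N = racah_poly 2 m x \<beta>' N"
    "racah_sqnorm 2 m \<beta> N = racah_sqnorm 2 m \<beta>' N"
proof -
  have e: "\<beta> 0 = \<beta>' 0" "\<beta> 1 = \<beta>' 1" "\<beta> 2 = \<beta>' 2" "\<beta> 3 = \<beta>' 3" using assms by simp_all
  show w: "racah_weight 2 x \<beta> N = racah_weight 2 x \<beta>' N" for x unfolding racah_weight_two e ..
  show p: "racah_poly 2 m x \<beta> N = racah_poly 2 m x \<beta>' N" for x unfolding racah_poly_two e ..
  show "racah_sqnorm 2 m \<beta> N = racah_sqnorm 2 m \<beta>' N" unfolding racah_sqnorm_def w p ..
qed

lemma racah_regular_cong:
  assumes "\<And>i. i \<le> 3 \<Longrightarrow> \<beta> i = \<beta>' i"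
  shows "\<beta> \<in> racah_regular 2 m N \<longleftrightarrow> \<beta>' \<in> racah_regular 2 m N"
  using assms racah_weight_two_cong(3)[OF assms, where m = m and N = N] unfolding racah_regular_def by simp

text \<open>
  The inverse of \<open>racah_params\<close>, between the entries \<open>1, \<dots>, 4\<close> of \<open>\<kappa>\<close> and \<open>0, \<dots>, 3\<close> of \<open>\<beta>\<close>.
\<close>

definition jacobi_params :: "(nat \<Rightarrow> real) \<Rightarrow> nat \<Rightarrow> real" where
  "jacobi_params \<beta> i = (if i = 1 then \<beta> 0 else if i = 2 then \<beta> 3 - \<beta> 2 - 1 else if i = 3 then \<beta> 2 - \<beta> 1 - 1 else if i = 4 then \<beta> 1 - \<beta> 0 - 1 else 0)"

lemma racah_params_jacobi_params: "i \<le> 3 \<Longrightarrow> racah_params (jacobi_params \<beta>) i = \<beta> i"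
proof -
  assume "i \<le> 3"
  then have "i = 0 \<or> i = 1 \<or> i = 2 \<or> i = 3" by linarith
  then show ?thesis by (auto simp: jacobi_params_def)
qed

lemma tendsto_pochhammer [tendsto_intros]:
  fixes f :: "'a \<Rightarrow> real"
  assumes "(f \<longlongrightarrow> a) F"
  shows "((\<lambda>x. pochhammer (f x) n) \<longlongrightarrow> pochhammer a n) F"
  unfolding pochhammer_prod by (intro tendsto_intros assms)

lemma tendsto_cleared_4F3 [tendsto_intros]:
  assumes "(a \<longlongrightarrow> a') F" "(b \<longlongrightarrow> b') F" "(c \<longlongrightarrow> c') F" "(u \<longlongrightarrow> u') F" "(v \<longlongrightarrow> v') F" "(t \<longlongrightarrow> t') F"
  shows "((\<lambda>x. cleared_4F3 m (a x) (b x) (c x) (u x) (v x) (t x)) \<longlongrightarrow> cleared_4F3 m a' b' c' u' v' t') F"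
  unfolding cleared_4F3_def by (intro tendsto_intros assms) auto

lemma tendsto_unsigned_connection:
  assumes k: "((\<lambda>t. k t 1) \<longlongrightarrow> \<kappa> 1) F" "((\<lambda>t. k t 2) \<longlongrightarrow> \<kappa> 2) F" "((\<lambda>t. k t 3) \<longlongrightarrow> \<kappa> 3) F" "((\<lambda>t. k t 4) \<longlongrightarrow> \<kappa> 4) F"
    and \<kappa>: "admissible \<kappa>"
  shows "((\<lambda>t. unsigned_connection \<nu> \<mu> (k t) n) \<longlongrightarrow> unsigned_connection \<nu> \<mu> \<kappa> n) F"
proof -
  note \<kappa>' = admissibleD[OF \<kappa>]
  have norm: "((\<lambda>t. norm_formula \<mu> (k t)) \<longlongrightarrow> norm_formula \<mu> \<kappa>) F"
    if "((\<lambda>t. k t 1) \<longlongrightarrow> \<kappa> 1) F" "((\<lambda>t. k t 2) \<longlongrightarrow> \<kappa> 2) F" "((\<lambda>t. k t 3) \<longlongrightarrow> \<kappa> 3) F" "((\<lambda>t. k t 4) \<longlongrightarrow> \<kappa> 4) F"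
      "\<kappa> 1 > -1" "\<kappa> 2 > -1" "\<kappa> 3 > -1" "\<kappa> 4 > -1" for \<mu> k \<kappa>
  proof -
    have "pochhammer (\<kappa> 1 + \<kappa> 2 + \<kappa> 3 + \<kappa> 4 + 4) m \<noteq> 0" for m
      using that by (intro pochhammer_nonzero) simp
    then show ?thesis unfolding norm_formula_def by (intro tendsto_intros that) auto
  qed
  have 1: "((\<lambda>t. norm_formula \<mu> (k t)) \<longlongrightarrow> norm_formula \<mu> \<kappa>) F" by (rule norm[OF k \<kappa>'])
  have 2: "((\<lambda>t. norm_formula \<nu> (k t \<circ> cyc123)) \<longlongrightarrow> norm_formula \<nu> (\<kappa> \<circ> cyc123)) F"
    by (rule norm) (use k \<kappa>' in simp_all)
  have 3: "((\<lambda>t. node_factor (k t) \<nu>) \<longlongrightarrow> node_factor \<kappa> \<nu>) F"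
    unfolding node_factor_def by (intro tendsto_intros k) auto
  have 4: "((\<lambda>t. index_factor (k t) \<mu>) \<longlongrightarrow> index_factor \<kappa> \<mu>) F"
  proof -
    have "index_factor \<kappa> \<mu> > 0" by (rule index_factor_pos[OF \<kappa>])
    then show ?thesis unfolding index_factor_def Let_def by (intro tendsto_intros k) auto
  qed
  have 5: "((\<lambda>t. racah_poly 2 (racah_index \<mu>) (racah_point \<nu>) (racah_params (k t)) n) \<longlongrightarrow>
     racah_poly 2 (racah_index \<mu>) (racah_point \<nu>) (racah_params \<kappa>) n) F"
    unfolding racah_poly_two One_nat_def racah_params_simps
    unfolding One_nat_def[symmetric] by (intro tendsto_intros k)
  have "norm_formula \<nu> (\<kappa> \<circ> cyc123) > 0" using \<kappa> by (intro norm_formula_pos) simp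
  then show ?thesis unfolding unsigned_connection_def by (intro tendsto_intros 1 2 3 4 5) simp
qed

lemma tendsto_coordinate: "((\<lambda>\<beta>. \<beta> i) \<longlongrightarrow> \<beta>0 i) (at \<beta>0 within A)" for \<beta>0 :: "nat \<Rightarrow> real"
proof -
  have "continuous_on UNIV (\<lambda>\<beta> :: nat \<Rightarrow> real. \<beta> i)" by (rule continuous_on_product_coordinates)
  then have "isCont (\<lambda>\<beta> :: nat \<Rightarrow> real. \<beta> i) \<beta>0"
    by (simp only: continuous_on_eq_continuous_at[OF open_UNIV] ball_UNIV)
  then show ?thesis
    using continuous_at_imp_continuous_within continuous_within by blast
qed

text \<open>
  Near \<open>racah_params \<kappa>\<close> every regular vector comes from parameters \<open>k\<close> with all \<open>k\<^sub>i > -1\<close>. There the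
  formula agrees with \<open>unsigned_connection\<close>, which is continuous.
\<close>

lemma weighted_racah_tendsto:
  assumes \<kappa>: "admissible \<kappa>" and \<nu>: "\<nu> \<in> multi_index 3 n" and \<mu>: "\<mu> \<in> multi_index 3 n"
  shows "((\<lambda>\<beta>. weighted_racah (racah_index \<mu>) (racah_point \<nu>) \<beta> n) \<longlongrightarrow> unsigned_connection \<nu> \<mu> \<kappa> n)
     (at (racah_params \<kappa>) within racah_regular 2 (racah_index \<mu>) n)"
proof -
  define A where "A = racah_regular 2 (racah_index \<mu>) n"
  define Fl where "Fl = at (racah_params \<kappa>) within A"
  have c: "((\<lambda>\<beta>. \<beta> i) \<longlongrightarrow> racah_params \<kappa> i) Fl" for i
    unfolding Fl_def by (rule tendsto_coordinate)
  have coord: "((\<lambda>\<beta>. jacobi_params \<beta> 1) \<longlongrightarrow> \<kappa> 1) Fl" "((\<lambda>\<beta>. jacobi_params \<beta> 2) \<longlongrightarrow> \<kappa> 2) Fl"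
    "((\<lambda>\<beta>. jacobi_params \<beta> 3) \<longlongrightarrow> \<kappa> 3) Fl" "((\<lambda>\<beta>. jacobi_params \<beta> 4) \<longlongrightarrow> \<kappa> 4) Fl"
    using c[of 0] tendsto_diff[OF tendsto_diff[OF c[of 3] c[of 2]] tendsto_const[of 1]]
      tendsto_diff[OF tendsto_diff[OF c[of 2] c[of 1]] tendsto_const[of 1]]
      tendsto_diff[OF tendsto_diff[OF c[of 1] c[of 0]] tendsto_const[of 1]]
    by (simp_all add: jacobi_params_def)
  have lim: "((\<lambda>\<beta>. unsigned_connection \<nu> \<mu> (jacobi_params \<beta>) n) \<longlongrightarrow> unsigned_connection \<nu> \<mu> \<kappa> n) Fl"
    by (rule tendsto_unsigned_connection[OF coord \<kappa>])
  have "eventually (\<lambda>\<beta>. admissible (jacobi_params \<beta>)) Fl"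
    unfolding admissible_def
    by (intro eventually_conj order_tendstoD(1)[OF coord(1)] order_tendstoD(1)[OF coord(2)]
        order_tendstoD(1)[OF coord(3)] order_tendstoD(1)[OF coord(4)])
      (use \<kappa> in \<open>simp_all add: admissible_def\<close>)
  moreover have "eventually (\<lambda>\<beta>. \<beta> \<in> A) Fl" unfolding Fl_def by (simp add: eventually_at_filter)
  ultimately have "eventually (\<lambda>\<beta>. unsigned_connection \<nu> \<mu> (jacobi_params \<beta>) n = weighted_racah (racah_index \<mu>) (racah_point \<nu>) \<beta> n) Fl"
  proof eventually_elim
    case (elim \<beta>)
    define k where "k = jacobi_params \<beta>"
    have e: "racah_params k i = \<beta> i" if "i \<le> 3" for i unfolding k_def by (rule racah_params_jacobi_params[OF that])
    have "racah_params k \<in> racah_regular 2 (racah_index \<mu>) n"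
      using elim(2) racah_regular_cong[of "racah_params k" \<beta>, OF e] by (simp add: A_def)
    then have r: "n = 0 \<or> (racah_params k 1 \<noteq> 0 \<and> racah_params k 2 \<noteq> 0 \<and> racah_params k 3 \<noteq> 0)"
      using racah_regular_iff[OF _ \<mu>] elim(1) by (simp add: k_def)
    have "racah_params k 3 > -1" using elim(1) by (simp add: k_def admissible_def)
    then have "racah_mass (racah_params k) n \<noteq> 0" using r by (intro racah_mass_nonzero) auto
    then have "weighted_racah (racah_index \<mu>) (racah_point \<nu>) (racah_params k) n = unsigned_connection \<nu> \<mu> k n"
      using elim(1) r by (intro weighted_racah_regular[OF _ \<nu> \<mu>]) (auto simp: k_def)
    then show ?case
      using racah_weight_two_cong[of "racah_params k" \<beta>, OF e] by (simp add: weighted_racah_def k_def)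
  qed
  then show ?thesis
    using Lim_transform_eventually[OF lim] unfolding Fl_def A_def by simp
qed

text \<open>
  Moving \<open>\<kappa>\<^sub>4\<close> to \<open>\<kappa>\<^sub>4 + \<epsilon>\<close> moves \<open>\<beta>\<^sub>1, \<beta>\<^sub>2, \<beta>\<^sub>3\<close> by \<open>\<epsilon>\<close> simultaneously, so for small \<open>\<epsilon> > 0\<close> none of
  them is zero.
\<close>

lemma at_within_racah_regular_nontrivial:
  assumes \<kappa>: "admissible \<kappa>" and \<mu>: "\<mu> \<in> multi_index 3 n"
  shows "at (racah_params \<kappa>) within racah_regular 2 (racah_index \<mu>) n \<noteq> bot"
proof
  assume bot: "at (racah_params \<kappa>) within racah_regular 2 (racah_index \<mu>) n = bot"
  define k where "k \<epsilon> = \<kappa>(4 := \<kappa> 4 + \<epsilon>)" for \<epsilon> :: real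
  define b where "b \<epsilon> = racah_params (k \<epsilon>)" for \<epsilon>
  have b: "b \<epsilon> 0 = racah_params \<kappa> 0" "b \<epsilon> 1 = racah_params \<kappa> 1 + \<epsilon>" "b \<epsilon> 2 = racah_params \<kappa> 2 + \<epsilon>" "b \<epsilon> 3 = racah_params \<kappa> 3 + \<epsilon>" for \<epsilon>
    by (simp_all add: b_def k_def)
  have "continuous_on UNIV b"
  proof (rule continuous_on_coordinatewise_then_product)
    fix i :: nat
    consider "i = 0" | "i = 1" | "i = 2" | "i = 3" | "i > 3" by linarith
    then show "continuous_on UNIV (\<lambda>\<epsilon>. b \<epsilon> i)"
    proof cases
      case 5
      then have "b \<epsilon> i = 0" for \<epsilon> by (simp add: b_def racah_params_def)
      then show ?thesis by simp
    qed (simp_all only: b, (intro continuous_intros)+)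
  qed
  then have "isCont b 0" by (simp only: continuous_on_eq_continuous_at[OF open_UNIV] ball_UNIV)
  then have "(b \<longlongrightarrow> b 0) (at_right 0)"
    using continuous_at_imp_continuous_within continuous_within by blast
  moreover have "b 0 = racah_params \<kappa>" by (simp add: b_def k_def)
  moreover have "eventually (\<lambda>\<epsilon>. b \<epsilon> \<in> racah_regular 2 (racah_index \<mu>) n \<and> b \<epsilon> \<noteq> racah_params \<kappa>) (at_right 0)"
  proof -
    have ne: "eventually (\<lambda>\<epsilon>. c + \<epsilon> \<noteq> 0) (at_right (0::real))" for c :: real
    proof (cases "c < 0")
      case True
      then have "eventually (\<lambda>\<epsilon>. \<epsilon> < - c) (at_right (0::real))"
        by (intro eventually_at_rightI[of 0 "- c"]) auto
      then show ?thesis by eventually_elim auto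
    next
      case False
      have "eventually (\<lambda>\<epsilon>. \<epsilon> > 0) (at_right (0::real))" by (simp add: eventually_at_right_less)
      then show ?thesis by eventually_elim (use False in auto)
    qed
    have "eventually (\<lambda>\<epsilon>. \<epsilon> > 0) (at_right (0::real))" by (simp add: eventually_at_right_less)
    then show ?thesis
      using ne[of "racah_params \<kappa> 1"] ne[of "racah_params \<kappa> 2"] ne[of "racah_params \<kappa> 3"]
    proof eventually_elim
      case (elim \<epsilon>)
      have "admissible (k \<epsilon>)" using \<kappa> elim by (simp add: admissible_def k_def)
      then have "b \<epsilon> \<in> racah_regular 2 (racah_index \<mu>) n"
        unfolding b_def using elim b[of \<epsilon>] by (subst racah_regular_iff[OF _ \<mu>]) (simp_all only: b_def[symmetric], simp)
      moreover have "b \<epsilon> \<noteq> racah_params \<kappa>" using b(2)[of \<epsilon>] elim by auto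
      ultimately show ?case by simp
    qed
  qed
  ultimately have "filterlim b (at (racah_params \<kappa>) within racah_regular 2 (racah_index \<mu>) n) (at_right 0)"
    by (simp add: filterlim_at)
  then have "filterlim b bot (at_right 0)" by (simp only: bot)
  then have "eventually (\<lambda>\<epsilon>. False) (at_right (0::real))"
    unfolding filterlim_iff by (elim allE[of _ "\<lambda>_. False"]) simp
  then show False by simp
qed

lemma racah_weighted_orthonormal_eq:
  assumes \<kappa>: "admissible \<kappa>" and \<nu>: "\<nu> \<in> multi_index 3 n" and \<mu>: "\<mu> \<in> multi_index 3 n"
  shows "racah_weighted_orthonormal 2 (racah_index \<mu>) (racah_point \<nu>) (racah_params \<kappa>) n = unsigned_connection \<nu> \<mu> \<kappa> n"
proof -
  have F: "(\<lambda>\<beta>. racah_poly 2 (racah_index \<mu>) (racah_point \<nu>) \<beta> n *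
      sqrt (racah_weight 2 (racah_point \<nu>) \<beta> n / racah_sqnorm 2 (racah_index \<mu>) \<beta> n)) =
      (\<lambda>\<beta>. weighted_racah (racah_index \<mu>) (racah_point \<nu>) \<beta> n)"
    by (simp add: weighted_racah_def)
  show ?thesis
  proof (cases "racah_params \<kappa> \<in> racah_regular 2 (racah_index \<mu>) n")
    case True
    then have r: "n = 0 \<or> (racah_params \<kappa> 1 \<noteq> 0 \<and> racah_params \<kappa> 2 \<noteq> 0 \<and> racah_params \<kappa> 3 \<noteq> 0)"
      using racah_regular_iff[OF \<kappa> \<mu>] by simp
    have "racah_params \<kappa> 3 > -1" using \<kappa> by (simp add: admissible_def)
    then have "racah_mass (racah_params \<kappa>) n \<noteq> 0" using r by (intro racah_mass_nonzero) auto
    then show ?thesis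
      using True weighted_racah_regular[OF \<kappa> \<nu> \<mu>] r unfolding racah_weighted_orthonormal_def F Let_def by auto
  next
    case False
    then show ?thesis
      unfolding racah_weighted_orthonormal_def F Let_def
      using tendsto_Lim[OF _ weighted_racah_tendsto[OF \<kappa> \<nu> \<mu>]] at_within_racah_regular_nontrivial[OF \<kappa> \<mu>] by simp
  qed
qed

text \<open>
  The formula for the second permutation is the one for the first, at \<open>(132) \<kappa>\<close> and with \<open>\<nu>\<close> and \<open>\<mu>\<close>
  exchanged.
\<close>

theorem proposition5p5:
  fixes \<kappa> :: "nat \<Rightarrow> real" and \<nu> \<mu> :: "nat \<Rightarrow> nat" and n :: nat
  assumes "\<forall>i\<in>{1..4}. \<kappa> i > -1"
    and "\<nu> \<in> multi_index 3 n" and "\<mu> \<in> multi_index 3 n"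
  shows "connection_coeff_hat 3 (cycle_of_list [1, 2, 3]) \<kappa> \<nu> \<mu> =
           (-1) ^ (n + \<nu> 3) *
           racah_weighted_orthonormal 2
             ((\<lambda>_. 0)(1 := \<mu> 3, 2 := \<mu> 2))
             ((\<lambda>_. 0)(1 := \<nu> 3, 2 := \<nu> 2 + \<nu> 3))
             ((\<lambda>_. 0)(0 := \<kappa> 1,
                      1 := \<kappa> 1 + \<kappa> 4 + 1,
                      2 := \<kappa> 1 + \<kappa> 3 + \<kappa> 4 + 2,
                      3 := (\<Sum>i=1..4. \<kappa> i) + 3)) n \<and>
         connection_coeff_hat 3 (cycle_of_list [1, 3, 2]) \<kappa> \<nu> \<mu> =
           connection_coeff_hat 3 (cycle_of_list [1, 2, 3]) (\<kappa> \<circ> cycle_of_list [1, 3, 2]) \<mu> \<nu> \<and>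
         connection_coeff_hat 3 (cycle_of_list [1, 2, 3]) (\<kappa> \<circ> cycle_of_list [1, 3, 2]) \<mu> \<nu> =
           (-1) ^ (n + \<mu> 3) *
           racah_weighted_orthonormal 2
             ((\<lambda>_. 0)(1 := \<nu> 3, 2 := \<nu> 2))
             ((\<lambda>_. 0)(1 := \<mu> 3, 2 := \<mu> 2 + \<mu> 3))
             ((\<lambda>_. 0)(0 := \<kappa> 3,
                      1 := \<kappa> 3 + \<kappa> 4 + 1,
                      2 := \<kappa> 2 + \<kappa> 3 + \<kappa> 4 + 2,
                      3 := (\<Sum>i=1..4. \<kappa> i) + 3)) n"
proof -
  have \<kappa>: "admissible \<kappa>" using assms(1) by (simp add: admissible_def)
  have first: "connection_coeff_hat 3 cyc123 \<kappa> \<nu> \<mu> = (-1) ^ (n + \<nu> 3) *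
      racah_weighted_orthonormal 2 (racah_index \<mu>) (racah_point \<nu>) (racah_params \<kappa>) n"
    if "admissible \<kappa>" "\<nu> \<in> multi_index 3 n" "\<mu> \<in> multi_index 3 n" for \<kappa> \<nu> \<mu>
    by (simp only: connection_coeff_hat_unsigned_connection[OF that] racah_weighted_orthonormal_eq[OF that])
  have "racah_params (\<kappa> \<circ> cyc132) = (\<lambda>_. 0)(0 := \<kappa> 3, 1 := \<kappa> 3 + \<kappa> 4 + 1, 2 := \<kappa> 2 + \<kappa> 3 + \<kappa> 4 + 2, 3 := (\<Sum>i=1..4. \<kappa> i) + 3)"
    unfolding racah_params_def sum_nat_intervals comp_apply cyc132_simps by (simp add: add_ac)
  then show ?thesis
    using first[OF \<kappa> assms(2,3)] connection_coeff_hat_inverse[OF \<kappa> assms(2,3)] first[of "\<kappa> \<circ> cyc132", OF _ assms(3,2)] \<kappa>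
    by (simp only: cyc123_def[symmetric] cyc132_def[symmetric] racah_params_def[symmetric] racah_index_def[symmetric] racah_point_def[symmetric] admissible_cyc simp_thms)
qed

end
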